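(* Let $m\ge1$ and $n_1,\dots,n_m\ge2$ be integers, $\underline n=(n_1,\dots,n_m)$, and let $\mathcal H$ be a separable Hilbert space. Let $p\in B(\mathcal H)\otimes\mathrm{povm}(\underline n)$ be of degree at most $2d+1$ (as an element of $B(\mathcal H)\otimes\mathbb C\langle y\rangle$). Then $p$ is positive if and only if the following hold. (1) If $\mathcal H$ is infinite-dimensional, then there exist $f,f_i,f_{i,j}\in B(\mathcal H)\otimes\mathrm{povm}(\underline n)$ ($1\le i\le m$, $1\le j\le n_i-1$) of degree at most $d$ such that $$p=f^*f+\sum_{i=1}^m\Big[\sum_{j=1}^{n_i-1}f_{i,j}^*\,y_{i,j}\,f_{i,j}+f_i^*\Big(1-\sum_{j=1}^{n_i-1}y_{i,j}\Big)f_i\Big].$$ (2) If $\mathcal H=\mathbb C^\nu$ is finite-dimensional, then there exist a positive integer $N$ and elements $f_k,f_{i,k},f_{i,j,k}\in M_\nu(\mathbb C)\otimes\mathrm{povm}(\underline n)$ ($1\le k\le N$, $1\le i\le m$, $1\le j\le n_i-1$) of degree at most $d$ such that $$p=\sum_{k=1}^N f_k^*f_k+\sum_{k=1}^N\sum_{i=1}^m\Big[\sum_{j=1}^{n_i-1}f_{i,j,k}^*\,y_{i,j}\,f_{i,j,k}+f_{i,k}^*\Big(1-\sum_{j=1}^{n_i-1}y_{i,j}\Big)f_{i,k}\Big].$$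
   Context: Let $y=\{y_{i,j}:1\le i\le m,\ 1\le j\le n_i-1\}$ be freely noncommuting self-adjoint variables and $\mathbb C\langle y\rangle$ the unital free $*$-algebra on them (the involution reverses words and fixes each $y_{i,j}$; on $B(\mathcal H)\otimes\mathbb C\langle y\rangle$ it also takes adjoints of coefficients). For a positive integer $\ell$ let $\mathcal D(\mathbb C^\ell)$ be the set of tuples $E=(E_{i,j})$ of positive semidefinite $\ell\times\ell$ matrices, $1\le i\le m$, $1\le j\le n_i-1$, with $\sum_{j=1}^{n_i-1}E_{i,j}\preceq I$ for each $i$. The $*$-algebra $\mathrm{povm}(\underline n)$ is $\mathbb C\langle y\rangle$ regarded as a pre-$C^*$-algebra through the faithful $*$-homomorphism $\Psi(p)=\bigoplus_{\ell\ge1}\bigoplus_{E\in\mathcal D(\mathbb C^\ell)}p(E)$. For $p=\sum_wP_ww\in B(\mathcal H)\otimes\mathbb C\langle y\rangle$, $p(E)=\sum_wP_w\otimes E^w$, and $p$ is positive if $p(E)\succeq0$ for all $\ell$ and all $E\in\mathcal D(\mathbb C^\ell)$. Degree means the largest length of a word occurring in the polynomial. *)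

theory Defs
  imports
    "HOL-Analysis.Analysis"
    "HOL-Library.Poly_Mapping"
    "HOL-Library.Complex_Order"
    "Jordan_Normal_Form.Matrix"
begin

text \<open>
  Complex Hilbert spaces, presented as real inner product spaces together with a complex scalar
  multiplication and a sesquilinear form (linear in the second argument) whose real part is the
  given real inner product. The norm and the topology are those of \<^class>\<open>real_inner\<close>,
  i.e. those coming from the complex inner product. The zero space is included.
\<close>

class complex_inner = real_inner +
  fixes scaleC :: "complex \<Rightarrow> 'a \<Rightarrow> 'a"  (infixr \<open>*\<^sub>C\<close> 75)
    and cinner :: "'a \<Rightarrow> 'a \<Rightarrow> complex"
  assumes scaleC_add_right: "c *\<^sub>C (x + y) = c *\<^sub>C x + c *\<^sub>C y"
    and scaleC_add_left: "(b + c) *\<^sub>C x = b *\<^sub>C x + c *\<^sub>C x"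
    and scaleC_scaleC: "b *\<^sub>C (c *\<^sub>C x) = (b * c) *\<^sub>C x"
    and scaleC_complex_of_real: "complex_of_real r *\<^sub>C x = r *\<^sub>R x"
    and cinner_commute: "cinner x y = cnj (cinner y x)"
    and cinner_add_right: "cinner x (y + z) = cinner x y + cinner x z"
    and cinner_scaleC_right: "cinner x (c *\<^sub>C y) = c * cinner x y"
    and inner_eq_Re_cinner: "inner x y = Re (cinner x y)"

class chilbert_space = complex_inner + complete_space

definition cfinite_dim :: "'h::complex_inner itself \<Rightarrow> bool" where
  "cfinite_dim _ \<longleftrightarrow>
     (\<exists>B::'h set. finite_dimensional_vector_space (scaleC :: complex \<Rightarrow> 'h \<Rightarrow> 'h) B)"


definition bounded_clinear :: "('a::complex_inner \<Rightarrow> 'a) \<Rightarrow> bool" where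
  "bounded_clinear f \<longleftrightarrow> bounded_linear f \<and> (\<forall>c x. f (c *\<^sub>C x) = c *\<^sub>C f x)"

lemma complex_vector_space: "vector_space (scaleC :: complex \<Rightarrow> 'a \<Rightarrow> 'a::complex_inner)"
proof
  show "1 *\<^sub>C x = x" for x :: 'a
    using scaleC_complex_of_real[of 1 x] by simp
qed (simp_all add: scaleC_add_right scaleC_add_left scaleC_scaleC)

lemma scaleC_minus_right: "c *\<^sub>C (- x) = - (c *\<^sub>C (x::'a::complex_inner))"
proof -
  interpret vector_space "scaleC :: complex \<Rightarrow> 'a \<Rightarrow> 'a" by (rule complex_vector_space)
  show ?thesis by (rule scale_minus_right)
qed

lemma scaleC_diff_right: "c *\<^sub>C (x - y) = c *\<^sub>C x - c *\<^sub>C (y::'a::complex_inner)"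
proof -
  interpret vector_space "scaleC :: complex \<Rightarrow> 'a \<Rightarrow> 'a" by (rule complex_vector_space)
  show ?thesis by (rule scale_right_diff_distrib)
qed

lemma scaleC_zero_right: "c *\<^sub>C 0 = (0::'a::complex_inner)"
proof -
  interpret vector_space "scaleC :: complex \<Rightarrow> 'a \<Rightarrow> 'a" by (rule complex_vector_space)
  show ?thesis by (rule scale_zero_right)
qed

text \<open>The algebra $B(\mathcal H)$, with composition as multiplication.\<close>

typedef (overloaded) 'h bop = "{f :: 'h::complex_inner \<Rightarrow> 'h. bounded_clinear f}"
  morphisms bop_apply Bop
proof
  show "(\<lambda>_. 0) \<in> {f :: 'h \<Rightarrow> 'h. bounded_clinear f}"
    by (simp add: bounded_clinear_def bounded_linear_zero scaleC_zero_right)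
qed

setup_lifting type_definition_bop

instantiation bop :: (complex_inner) "{ring, monoid_mult}"
begin

lift_definition zero_bop :: "'a bop" is "\<lambda>_. 0"
  by (simp add: bounded_clinear_def bounded_linear_zero scaleC_zero_right)

lift_definition one_bop :: "'a bop" is "\<lambda>x. x"
  by (simp add: bounded_clinear_def bounded_linear_ident)

lift_definition plus_bop :: "'a bop \<Rightarrow> 'a bop \<Rightarrow> 'a bop" is "\<lambda>f g x. f x + g x"
  by (auto simp: bounded_clinear_def bounded_linear_add scaleC_add_right)

lift_definition uminus_bop :: "'a bop \<Rightarrow> 'a bop" is "\<lambda>f x. - f x"
  by (auto simp: bounded_clinear_def bounded_linear_minus scaleC_minus_right)

lift_definition minus_bop :: "'a bop \<Rightarrow> 'a bop \<Rightarrow> 'a bop" is "\<lambda>f g x. f x - g x"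
  by (auto simp: bounded_clinear_def bounded_linear_sub scaleC_diff_right)

lift_definition times_bop :: "'a bop \<Rightarrow> 'a bop \<Rightarrow> 'a bop" is "\<lambda>f g x. f (g x)"
  by (auto simp: bounded_clinear_def bounded_linear_compose)

instance
proof
  fix a b c :: "'a bop"
  show "a * (b + c) = a * b + a * c"
    by transfer (auto simp: bounded_clinear_def linear_add dest: bounded_linear.linear)
qed (transfer; force)+

end

text \<open>The adjoint; its existence in a Hilbert space is the Riesz representation theorem.\<close>

definition adj :: "'h::chilbert_space bop \<Rightarrow> 'h bop" where
  "adj A = (THE B. \<forall>x y. cinner (bop_apply A x) y = cinner x (bop_apply B y))"


text \<open>
  The free monoid. It is wrapped in a type of its own so that concatenation can be the addition
  that the convolution product of \<^type>\<open>poly_mapping\<close> refers to. A polynomial $\sum_w P_w w$ in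
  $B(\mathcal H)\otimes\mathbb C\langle y\rangle$ is the finitely supported map $w\mapsto P_w$, and
  \<open>*\<close> on such maps is the product of $B(\mathcal H)\otimes\mathbb C\langle y\rangle$.
  The variable $y_{i,j}$ is the letter \<open>(i, j)\<close>.
\<close>

datatype 'x ncword = Word (letters: "'x list")

instantiation ncword :: (type) monoid_add
begin

definition zero_ncword :: "'a ncword" where "0 = Word []"

definition plus_ncword :: "'a ncword \<Rightarrow> 'a ncword \<Rightarrow> 'a ncword" where
  "u + v = Word (letters u @ letters v)"

instance
  by standard (simp_all add: zero_ncword_def plus_ncword_def)

end

type_synonym 'h ncpoly = "(nat \<times> nat) ncword \<Rightarrow>\<^sub>0 'h bop"

definition indices :: "nat \<Rightarrow> (nat \<Rightarrow> nat) \<Rightarrow> (nat \<times> nat) set" where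
  "indices m n = (SIGMA i:{1..m}. {1..n i - 1})"

definition op_povm :: "nat \<Rightarrow> (nat \<Rightarrow> nat) \<Rightarrow> 'h::complex_inner ncpoly set" where
  "op_povm m n = {p. \<forall>w \<in> Poly_Mapping.keys p. set (letters w) \<subseteq> indices m n}"

text \<open>The degree of the zero polynomial is 0 here.\<close>

definition ncdeg :: "'h::complex_inner ncpoly \<Rightarrow> nat" where
  "ncdeg p = Max (insert 0 ((\<lambda>w. length (letters w)) ` Poly_Mapping.keys p))"

text \<open>Written out, since \<open>1\<close> of \<^type>\<open>poly_mapping\<close> would exclude the zero space.\<close>

definition ncone :: "'h::complex_inner ncpoly" where
  "ncone = Poly_Mapping.single 0 1"

definition ncvar :: "nat \<Rightarrow> nat \<Rightarrow> 'h::complex_inner ncpoly" where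
  "ncvar i j = Poly_Mapping.single (Word [(i, j)]) 1"

definition ncstar :: "'h::chilbert_space ncpoly \<Rightarrow> 'h ncpoly" where
  "ncstar p = (\<Sum>w \<in> Poly_Mapping.keys p.
     Poly_Mapping.single (Word (rev (letters w))) (adj (Poly_Mapping.lookup p w)))"


definition psd_mat :: "nat \<Rightarrow> complex mat \<Rightarrow> bool" where
  "psd_mat l A \<longleftrightarrow> A \<in> carrier_mat l l \<and> (\<forall>v \<in> carrier_vec l. 0 \<le> (A *\<^sub>v v) \<bullet>c v)"

definition povm_tuples :: "nat \<Rightarrow> (nat \<Rightarrow> nat) \<Rightarrow> nat \<Rightarrow> (nat \<times> nat \<Rightarrow> complex mat) set" where
  "povm_tuples m n l = {E.
     (\<forall>i \<in> {1..m}. \<forall>j \<in> {1..n i - 1}. psd_mat l (E (i, j))) \<and>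
     (\<forall>i \<in> {1..m}. psd_mat l
        (1\<^sub>m l - mat l l (\<lambda>(a, b). \<Sum>j \<in> {1..n i - 1}. E (i, j) $$ (a, b))))}"

definition eval_word :: "nat \<Rightarrow> (nat \<times> nat \<Rightarrow> complex mat) \<Rightarrow> (nat \<times> nat) ncword \<Rightarrow> complex mat" where
  "eval_word l E w = foldr (\<lambda>x M. E x * M) (letters w) (1\<^sub>m l)"

text \<open>
  $\mathcal H\otimes\mathbb C^\ell$ is identified with $\mathcal H^\ell$: a vector is a function
  \<open>v\<close> on \<open>{..<l}\<close> (values elsewhere are ignored) standing for $\sum_{b<\ell} v_b\otimes e_b$.
\<close>

definition tensor_apply :: "nat \<Rightarrow> 'h::complex_inner bop \<Rightarrow> complex mat \<Rightarrow> (nat \<Rightarrow> 'h) \<Rightarrow> (nat \<Rightarrow> 'h)" where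
  "tensor_apply l P M v = (\<lambda>a. \<Sum>b<l. (M $$ (a, b)) *\<^sub>C bop_apply P (v b))"

definition ncpoly_eval ::
  "nat \<Rightarrow> 'h::complex_inner ncpoly \<Rightarrow> (nat \<times> nat \<Rightarrow> complex mat) \<Rightarrow> (nat \<Rightarrow> 'h) \<Rightarrow> (nat \<Rightarrow> 'h)" where
  "ncpoly_eval l p E v = (\<lambda>a. \<Sum>w \<in> Poly_Mapping.keys p.
     tensor_apply l (Poly_Mapping.lookup p w) (eval_word l E w) v a)"

text \<open>For complex numbers \<open>0 \<le> z\<close> means that \<open>z\<close> is real and nonnegative.\<close>

definition povm_positive :: "nat \<Rightarrow> (nat \<Rightarrow> nat) \<Rightarrow> 'h::complex_inner ncpoly \<Rightarrow> bool" where
  "povm_positive m n p \<longleftrightarrow>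
     (\<forall>l \<ge> 1. \<forall>E \<in> povm_tuples m n l. \<forall>v.
        0 \<le> (\<Sum>a<l. cinner (v a) (ncpoly_eval l p E v a)))"

end

theory Submission
  imports Defs
begin

text \<open>
  Put $y_{i,0} = 1 - \sum_j y_{i,j}$, so that the outcomes $y_{i,0}, \dots, y_{i,n_i-1}$ of each
  measurement \<open>i\<close> sum to \<open>1\<close>. Then $f^*f$ is itself a sum of weighted squares $f^* y_{i,j} f$, and the
  theorem says that the positive polynomials are the sums of weighted squares $f_x^* y_x f_x$ over
  all outcomes \<open>x\<close>. Such sums are positive because the value of $f^* y_x f$ at a measurement
  \<open>E\<close> is $f(E)^* (1 \otimes E_x) f(E)$ (\<open>eval_form_weighted_square\<close>).

  For the converse a sum of weighted squares is written as $\sum_x \sum_{u,v} u^* G_x(u,v)\, y_x v$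
  with positive kernels $G_x$ on words of length at most \<open>d\<close>. In an orthonormal basis of the Hilbert
  space these are scalar kernels indexed by a word and a basis index. When only finitely many basis
  vectors are kept, the coefficient arrays that arise this way form a convex cone in a
  finite-dimensional space, and a positive array lies in its closure
  (\<open>approximate_certificate\<close>). Otherwise a functional $\varphi$ separates it from the cone, that is,
  all forms $\varphi(f^* y_x g)$ on polynomials of degree at most \<open>d\<close> are positive. The operators of these
  forms with respect to $\varphi(f^*g)$ are the compressions of the multiplications by $y_x$, and they form a
  measurement: positivity and summing to \<open>1\<close> are linear conditions, which survive compression.
  The vector \<open>1\<close> then reproduces $\varphi$ up to degree $2d+1$ (\<open>truncated_gns\<close>), so $\varphi$ is
  nonnegative on positive arrays, a contradiction. Only the values of $\varphi$ up to degree $2d+1$ enter, so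
  no degree is lost.

  The limits are governed by one faithful functional \<open>L\<close>, for which
  $L(f^* y_x f) \ge \kappa \|f\|^2$ for every outcome \<open>x\<close> (\<open>faithful_functional\<close>). It comes from explicit
  matrices, small multiples of creation plus annihilation operators added to scalars. Adding a multiple of
  it makes any positive functional strictly positive, so that the forms above are nondegenerate. It bounds
  the kernels of a certificate by the value of the certificate
  (\<open>certificate_bound\<close>). Therefore approximate certificates for more and more basis vectors have a limit,
  an exact certificate with bounded diagonal blocks (\<open>exact_certificate\<close>, \<open>kernel_block_bounded\<close>).

  The limit kernels have triangular factors (\<open>psd_factor\<close>). In infinite dimension the rows are sent to the members of an orthonormal
  sequence, which gives one operator polynomial per outcome (\<open>weighted_squares_infinite_dim\<close>). In finite
  dimension there are finitely many rows, and each gives a square of its own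
  (\<open>weighted_squares_finite_dim\<close>).
\<close>

section \<open>Hermitian forms on finitely supported functions\<close>

definition hform :: "'s set \<Rightarrow> ('s \<Rightarrow> 's \<Rightarrow> complex) \<Rightarrow> ('s \<Rightarrow> complex) \<Rightarrow> ('s \<Rightarrow> complex) \<Rightarrow> complex" where
  "hform S K f g = (\<Sum>s\<in>S. \<Sum>t\<in>S. cnj (f s) * K s t * g t)"

definition psd :: "'s set \<Rightarrow> ('s \<Rightarrow> 's \<Rightarrow> complex) \<Rightarrow> bool" where
  "psd S K \<longleftrightarrow> (\<forall>f. 0 \<le> hform S K f f)"

definition hermitian :: "'s set \<Rightarrow> ('s \<Rightarrow> 's \<Rightarrow> complex) \<Rightarrow> bool" where
  "hermitian S K \<longleftrightarrow> (\<forall>s\<in>S. \<forall>t\<in>S. cnj (K s t) = K t s)"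

abbreviation dirac :: "'s \<Rightarrow> 's \<Rightarrow> complex" where
  "dirac s t \<equiv> (if t = s then 1 else 0)"

lemma psdD: "psd S K \<Longrightarrow> 0 \<le> hform S K f f"
  by (simp add: psd_def)

lemma hform_add_right: "hform S K f (\<lambda>s. g s + h s) = hform S K f g + hform S K f h"
  by (simp add: hform_def distrib_left sum.distrib)

lemma hform_add_left: "hform S K (\<lambda>s. f s + g s) h = hform S K f h + hform S K g h"
  by (simp add: hform_def distrib_left distrib_right sum.distrib)

lemma hform_scale_right: "hform S K f (\<lambda>s. c * g s) = c * hform S K f g"
  by (simp add: hform_def sum_distrib_left mult_ac)

lemma hform_scale_left: "hform S K (\<lambda>s. c * f s) g = cnj c * hform S K f g"
  by (simp add: hform_def sum_distrib_left mult_ac)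

lemma hform_zero [simp]: "hform S K f (\<lambda>_. 0) = 0" "hform S K (\<lambda>_. 0) f = 0"
  by (simp_all add: hform_def)

lemma hform_sum_right: "hform S K f (\<lambda>s. \<Sum>k\<in>A. g k s) = (\<Sum>k\<in>A. hform S K f (g k))"
  by (induction A rule: infinite_finite_induct) (simp_all add: hform_add_right)

lemma hform_sum_left: "hform S K (\<lambda>s. \<Sum>k\<in>A. f k s) g = (\<Sum>k\<in>A. hform S K (f k) g)"
  by (induction A rule: infinite_finite_induct) (simp_all add: hform_add_left)

lemma hform_cong:
  "(\<And>s t. s \<in> S \<Longrightarrow> t \<in> S \<Longrightarrow> K s t = K' s t) \<Longrightarrow> (\<And>s. s \<in> S \<Longrightarrow> f s = f' s) \<Longrightarrow>
   (\<And>s. s \<in> S \<Longrightarrow> g s = g' s) \<Longrightarrow> hform S K f g = hform S K' f' g'"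
  unfolding hform_def by (intro sum.cong) auto

lemma psd_cong:
  "(\<And>s t. s \<in> S \<Longrightarrow> t \<in> S \<Longrightarrow> K s t = K' s t) \<Longrightarrow> psd S K \<longleftrightarrow> psd S K'"
  unfolding psd_def using hform_cong[of S K K'] by metis

lemma hform_kernel_add: "hform S (\<lambda>s t. K s t + L s t) f g = hform S K f g + hform S L f g"
  by (simp add: hform_def distrib_left distrib_right sum.distrib)

lemma hform_kernel_scale: "hform S (\<lambda>s t. c * K s t) f g = c * hform S K f g"
  by (simp add: hform_def sum_distrib_left mult_ac)

lemma hform_kernel_sum: "hform S (\<lambda>s t. \<Sum>k\<in>A. K k s t) f g = (\<Sum>k\<in>A. hform S (K k) f g)"
  by (induction A rule: infinite_finite_induct) (simp_all add: hform_kernel_add, simp_all add: hform_def)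

lemma hform_dirac:
  assumes "finite S" "s \<in> S"
  shows "hform S K (dirac s) g = (\<Sum>t\<in>S. K s t * g t)" "hform S K f (dirac s) = (\<Sum>t\<in>S. cnj (f t) * K t s)"
proof -
  have "hform S K (dirac s) g = (\<Sum>r\<in>S. if r = s then (\<Sum>t\<in>S. K r t * g t) else 0)"
    unfolding hform_def by (intro sum.cong) auto
  thus "hform S K (dirac s) g = (\<Sum>t\<in>S. K s t * g t)" using assms by (simp add: sum.delta)
  have "hform S K f (dirac s) = (\<Sum>t\<in>S. \<Sum>r\<in>S. if r = s then cnj (f t) * K t r else 0)"
    unfolding hform_def by (intro sum.cong) auto
  thus "hform S K f (dirac s) = (\<Sum>t\<in>S. cnj (f t) * K t s)" using assms by (simp add: sum.delta)
qed

lemma hform_dirac_dirac: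
  assumes "finite S" "s \<in> S" "t \<in> S"
  shows "hform S K (dirac s) (dirac t) = K s t"
  using assms by (simp add: hform_dirac if_distrib[of "\<lambda>x. _ * x"] sum.delta cong: if_cong)

lemma hform_id:
  assumes "finite S"
  shows "hform S (\<lambda>s t. if s = t then c else 0) f g = c * (\<Sum>s\<in>S. cnj (f s) * g s)"
proof -
  have "hform S (\<lambda>s t. if s = t then c else 0) f g = (\<Sum>s\<in>S. \<Sum>t\<in>S. if t = s then cnj (f s) * c * g t else 0)"
    unfolding hform_def by (intro sum.cong) auto
  thus ?thesis using assms by (simp add: sum.delta sum_distrib_left mult_ac)
qed

lemma sum_cnj_mult_self: "(\<Sum>s\<in>S. cnj (f s) * f s) = of_real (\<Sum>s\<in>S. (cmod (f s))\<^sup>2)"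
  unfolding of_real_sum
  by (rule sum.cong) (simp_all only: mult.commute[of "cnj _"] complex_norm_square[symmetric] of_real_power[symmetric])

lemma hform_hermitian:
  assumes "hermitian S K"
  shows "hform S K g f = cnj (hform S K f g)"
proof -
  have "hform S K g f = (\<Sum>t\<in>S. \<Sum>s\<in>S. cnj (g s) * K s t * f t)"
    unfolding hform_def by (rule sum.swap)
  also have "\<dots> = cnj (hform S K f g)"
    unfolding hform_def cnj_sum
    by (intro sum.cong refl) (use assms in \<open>simp add: hermitian_def mult_ac\<close>)
  finally show ?thesis .
qed

lemma psd_two_point:
  assumes "psd S K" "finite S" "s \<in> S" "t \<in> S"
  shows "0 \<le> cnj x * x * K s s + cnj x * y * K s t + cnj y * x * K t s + cnj y * y * K t t"
  using psdD[OF assms(1), of "\<lambda>r. x * dirac s r + y * dirac t r"] assms(2-)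
  by (simp only: hform_add_left hform_add_right hform_scale_left hform_scale_right hform_dirac_dirac)
     (simp add: algebra_simps)

lemma psd_diag: "psd S K \<Longrightarrow> finite S \<Longrightarrow> s \<in> S \<Longrightarrow> 0 \<le> K s s"
  using psd_two_point[of S K s s 1 0] by simp

lemma psd_hermitian:
  assumes "psd S K" "finite S"
  shows "hermitian S K"
  unfolding hermitian_def
proof (intro ballI)
  fix s t assume st: "s \<in> S" "t \<in> S"
  have d: "Im (K s s) = 0" "Im (K t t) = 0"
    using psd_diag[OF assms, of s] psd_diag[OF assms, of t] st by (auto simp: less_eq_complex_def)
  have "Im (K s t) + Im (K t s) = 0"
    using psd_two_point[OF assms st, of 1 1] d by (simp add: less_eq_complex_def)
  moreover have "Re (K s t) - Re (K t s) = 0"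
    using psd_two_point[OF assms st, of 1 \<i>] d by (simp add: less_eq_complex_def)
  ultimately show "cnj (K s t) = K t s" by (simp add: complex_eq_iff)
qed

lemma psd_cauchy:
  assumes "psd S K" "finite S" "s \<in> S" "t \<in> S"
  shows "(cmod (K s t))\<^sup>2 \<le> Re (K s s) * Re (K t t)"
proof -
  define a b c where "a = Re (K s s)" "b = K s t" "c = Re (K t t)"
  have K: "K s s = of_real a" "K t t = of_real c" "K t s = cnj b" and ac: "0 \<le> a" "0 \<le> c"
    using psd_diag[OF assms(1,2,3)] psd_diag[OF assms(1,2,4)] psd_hermitian[OF assms(1,2)] assms(3,4)
    by (auto simp: a_b_c_def complex_eq_iff less_eq_complex_def hermitian_def)
  have *: "0 \<le> x\<^sup>2 * a - 2 * x * y * (cmod b)\<^sup>2 + y\<^sup>2 * (cmod b)\<^sup>2 * c" for x y :: real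
    using psd_two_point[OF assms, of "of_real x" "of_real (-y) * cnj b"] K(1,2)
    unfolding K a_b_c_def(2)[symmetric] cmod_power2
    by (simp add: less_eq_complex_def power2_eq_square algebra_simps)
  show ?thesis
  proof (cases "c = 0")
    case False
    have "0 \<le> c * (a * c - (cmod b)\<^sup>2)" using *[of c 1] by (simp add: power2_eq_square algebra_simps)
    thus ?thesis using False ac by (simp add: zero_le_mult_iff a_b_c_def)
  next
    case True
    have "b = 0"
    proof (rule ccontr)
      assume "b \<noteq> 0"
      thus False using *[of 1 "(a + 1) / (2 * (cmod b)\<^sup>2)"] True by (simp add: field_simps)
    qed
    thus ?thesis using ac by (simp add: a_b_c_def)
  qed
qed

lemma hform_restrict:
  assumes "finite S'" "S \<subseteq> S'"
  shows "hform S K f g = hform S' K (\<lambda>s. if s \<in> S then f s else 0) (\<lambda>s. if s \<in> S then g s else 0)"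
proof -
  let ?f = "\<lambda>s. if s \<in> S then f s else 0" and ?g = "\<lambda>s. if s \<in> S then g s else 0"
  have "(\<Sum>s\<in>S'. \<Sum>t\<in>S'. cnj (?f s) * K s t * ?g t) = (\<Sum>s\<in>S. \<Sum>t\<in>S'. cnj (?f s) * K s t * ?g t)"
    by (rule sum.mono_neutral_right) (use assms in auto)
  also have "\<dots> = (\<Sum>s\<in>S. \<Sum>t\<in>S. cnj (?f s) * K s t * ?g t)"
    by (intro sum.cong refl sum.mono_neutral_right) (use assms in auto)
  finally show ?thesis unfolding hform_def by simp
qed

lemma psd_subset: "psd S' K \<Longrightarrow> finite S' \<Longrightarrow> S \<subseteq> S' \<Longrightarrow> psd S K"
  unfolding psd_def by (simp add: hform_restrict[of S' S K])

text \<open>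
  The factorization below eliminates indices of an infinite kernel, so it needs positivity on
  every finite set. Extension by zero makes it available to kernels on a fixed finite set.
\<close>

lemma psd_extend_zero:
  assumes "psd S K" "finite S" "finite T"
  shows "psd T (\<lambda>s t. if s \<in> S \<and> t \<in> S then K s t else 0)"
  unfolding psd_def
proof
  fix f :: "'a \<Rightarrow> complex"
  let ?K = "\<lambda>s t. if s \<in> S \<and> t \<in> S then K s t else 0"
  let ?f = "\<lambda>s. if s \<in> T then f s else 0"
  have "hform T ?K f f = hform (S \<union> T) ?K ?f ?f"
    by (rule hform_restrict) (use assms in auto)
  also have "\<dots> = hform (S \<union> T) K (\<lambda>s. if s \<in> S then ?f s else 0) (\<lambda>s. if s \<in> S then ?f s else 0)"
    unfolding hform_def by (intro sum.cong) auto
  also have "\<dots> = hform S K ?f ?f"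
    by (rule hform_restrict[symmetric]) (use assms in auto)
  finally show "0 \<le> hform T ?K f f" by (simp only: psdD[OF assms(1)])
qed

text \<open>
  One step of Gaussian elimination (a Schur complement). If the pivot of a positive kernel
  vanishes, so does its row, and then \<open>x / 0 = 0\<close> leaves the kernel alone, as it should.
\<close>

definition eliminate :: "'s \<Rightarrow> ('s \<Rightarrow> 's \<Rightarrow> complex) \<Rightarrow> 's \<Rightarrow> 's \<Rightarrow> complex" where
  "eliminate k K s t = K s t - K s k * K k t / K k k"

text \<open>
  Subtracting the pivot term is the same as completing the square: the value of the complement at
  \<open>f\<close> is the value of the kernel at \<open>f\<close> corrected in the pivot coordinate.
\<close>

lemma psd_eliminate:
  assumes "\<And>S. finite S \<Longrightarrow> psd S K" "finite S"
  shows "psd S (eliminate k K)"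
proof -
  define S' where "S' = insert k S"
  have fin: "finite S'" "k \<in> S'" and K: "psd S' K" using assms by (auto simp: S'_def)
  have herm: "hermitian S' K" by (rule psd_hermitian[OF K fin(1)])
  have real: "cnj (K k k) = K k k" using herm fin by (simp add: hermitian_def)
  have "0 \<le> hform S' (eliminate k K) f f" for f
  proof (cases "K k k = 0")
    case True
    hence "eliminate k K = K" by (simp add: eliminate_def fun_eq_iff)
    thus ?thesis using psdD[OF K] by simp
  next
    case False
    define r where "r = hform S' K (dirac k) f"
    define c where "c = - r / K k k"
    have r': "hform S' K f (dirac k) = cnj r"
      unfolding r_def by (rule hform_hermitian[OF herm])
    have "hform S' (eliminate k K) f f
        = hform S' K f f - (\<Sum>s\<in>S'. \<Sum>t\<in>S'. (cnj (f s) * K s k) * (K k t * f t) / K k k)"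
      unfolding hform_def eliminate_def sum_subtractf[symmetric]
      by (intro sum.cong refl) (simp add: algebra_simps)
    also have "(\<Sum>s\<in>S'. \<Sum>t\<in>S'. (cnj (f s) * K s k) * (K k t * f t) / K k k) = cnj r * r / K k k"
      unfolding r'[symmetric] unfolding r_def hform_dirac[OF fin]
      by (simp add: sum_product sum_divide_distrib)
    \<comment> \<open>\<open>c\<close> is the minimizer of the form in the direction of the pivot.\<close>
    also have "hform S' K f f - cnj r * r / K k k
        = hform S' K (\<lambda>s. f s + c * dirac k s) (\<lambda>s. f s + c * dirac k s)"
      unfolding hform_add_left hform_add_right hform_scale_left hform_scale_right r'
        r_def[symmetric] hform_dirac_dirac[OF fin(1,2,2)] c_def
      using False real by (simp add: field_simps)
    finally show ?thesis by (simp only: psdD[OF K])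
  qed
  hence "psd S' (eliminate k K)" by (simp add: psd_def)
  thus ?thesis by (rule psd_subset) (auto simp: S'_def assms)
qed

lemma psd_zero_row:
  assumes "\<And>S. finite S \<Longrightarrow> psd S K" "K k k = 0"
  shows "K k t = 0" "K t k = 0"
  using psd_cauchy[OF assms(1), of "{k, t}" k t] psd_cauchy[OF assms(1), of "{k, t}" t k] assms(2)
  by simp_all

lemma eliminate_pivot:
  assumes "\<And>S. finite S \<Longrightarrow> psd S K"
  shows "eliminate k K k t = 0" "eliminate k K t k = 0"
proof -
  have "eliminate k K k t = 0 \<and> eliminate k K t k = 0"
  proof (cases "K k k = 0")
    case True
    have "K k t = 0" "K t k = 0" by (rule psd_zero_row[of K, OF assms True], assumption)+
    thus ?thesis by (simp add: eliminate_def)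
  qed (simp add: eliminate_def)
  thus "eliminate k K k t = 0" "eliminate k K t k = 0" by simp_all
qed

text \<open>
  A Cholesky factorization over a countable index set: the indices are eliminated one after
  the other, in the order of their codes. The factor is triangular, so every entry of the
  kernel is a finite sum.
\<close>

lemma psd_factor:
  fixes K :: "'s::countable \<Rightarrow> 's \<Rightarrow> complex"
  assumes psd: "\<And>S. finite S \<Longrightarrow> psd S K"
  obtains R :: "nat \<Rightarrow> 's \<Rightarrow> complex"
  where "\<And>k s. k > to_nat s \<Longrightarrow> R k s = 0"
    and "\<And>n s t. n > to_nat s \<Longrightarrow> K s t = (\<Sum>k<n. cnj (R k s) * R k t)"
proof -
  define G where "G = rec_nat K (\<lambda>k. eliminate (from_nat k))"
  have G_0: "G 0 = K" and G_Suc: "G (Suc k) = eliminate (from_nat k) (G k)" for k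
    by (simp_all add: G_def)
  have G_psd: "finite S \<Longrightarrow> psd S (G k)" for S k
  proof (induction k arbitrary: S)
    case (Suc k) thus ?case unfolding G_Suc by (intro psd_eliminate)
  qed (simp add: G_0 psd)
  have G_zero: "(\<forall>t. G n s t = 0) \<and> (\<forall>t. G n t s = 0)" if "n > to_nat s" for n and s :: 's
    using that
  proof (induction n)
    case 0 thus ?case by simp
  next
    case (Suc n)
    show ?case
    proof (cases "n = to_nat s")
      case True
      thus ?thesis using eliminate_pivot[OF G_psd, of s n] by (simp add: G_Suc)
    next
      case False
      thus ?thesis using Suc by (simp add: G_Suc eliminate_def)
    qed
  qed
  define piv where "piv k = Re (G k (from_nat k) (from_nat k))" for k
  define R where "R k s = G k (from_nat k) s / of_real (sqrt (piv k))" for k s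
  have "0 \<le> G k (from_nat k) (from_nat k)" for k
    by (rule psd_diag[OF G_psd, of "{from_nat k}"]) simp_all
  hence piv: "piv k \<ge> 0" "G k (from_nat k) (from_nat k) = of_real (piv k)" for k
    by (simp_all add: piv_def less_eq_complex_def complex_eq_iff)
  have step: "G k s t = cnj (R k s) * R k t + G (Suc k) s t" for k s t
  proof -
    have "hermitian {s, from_nat k} (G k)" by (intro psd_hermitian G_psd) simp_all
    hence h: "cnj (G k (from_nat k) s) = G k s (from_nat k)" by (simp add: hermitian_def)
    have "cnj (R k s) * R k t = G k s (from_nat k) * G k (from_nat k) t / of_real (piv k)"
      using piv(1)[of k] by (simp add: R_def h flip: of_real_mult)
    thus ?thesis by (simp add: G_Suc eliminate_def piv)
  qed
  have sum: "K s t = (\<Sum>k<n. cnj (R k s) * R k t) + G n s t" for n s t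
  proof (induction n)
    case (Suc n) show ?case
      unfolding Suc.IH step[of n s t] by (simp add: add.assoc)
  qed (simp add: G_0)
  have R_zero: "R k s = 0" if "k > to_nat s" for k s
    using G_zero[OF that] by (simp add: R_def)
  have R_sum: "K s t = (\<Sum>k<n. cnj (R k s) * R k t)" if "n > to_nat s" for n s t
    unfolding sum[of s t n] using G_zero[OF that] by simp
  show thesis by (rule that[of R, OF R_zero R_sum])
qed

text \<open>
  A factorization of one kernel turns the trace pairing into a sum of values of the form of the
  other one, at the rows of the factor.
\<close>

lemma psd_pairing:
  fixes K :: "'s::countable \<Rightarrow> 's \<Rightarrow> complex"
  assumes "finite S" "psd S K" "psd S A"
  shows "0 \<le> (\<Sum>s\<in>S. \<Sum>t\<in>S. K s t * A s t)"
proof -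
  let ?K = "\<lambda>s t. if s \<in> S \<and> t \<in> S then K s t else 0"
  obtain R :: "nat \<Rightarrow> 's \<Rightarrow> complex"
    where R: "\<And>n s t. n > to_nat s \<Longrightarrow> ?K s t = (\<Sum>k<n. cnj (R k s) * R k t)"
    by (rule psd_factor[OF psd_extend_zero[OF assms(2,1)]]) blast+
  define n where "n = Suc (Max (insert 0 (to_nat ` S)))"
  have n: "n > to_nat s" if "s \<in> S" for s
    unfolding n_def less_Suc_eq_le by (intro Max_ge) (use assms that in auto)
  have "(\<Sum>s\<in>S. \<Sum>t\<in>S. K s t * A s t) = (\<Sum>s\<in>S. \<Sum>t\<in>S. \<Sum>k<n. cnj (R k s) * A s t * R k t)"
  proof (intro sum.cong refl)
    fix s t assume "s \<in> S" "t \<in> S"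
    thus "K s t * A s t = (\<Sum>k<n. cnj (R k s) * A s t * R k t)"
      using R[OF n, of s t] by (simp add: sum_distrib_left mult_ac)
  qed
  also have "\<dots> = (\<Sum>s\<in>S. \<Sum>k<n. \<Sum>t\<in>S. cnj (R k s) * A s t * R k t)"
    by (intro sum.cong refl) (rule sum.swap)
  also have "\<dots> = (\<Sum>k<n. hform S A (R k) (R k))"
    unfolding hform_def by (rule sum.swap)
  also have "\<dots> \<ge> 0" using assms(3) by (intro sum_nonneg psdD)
  finally show ?thesis .
qed

definition definite :: "'s set \<Rightarrow> ('s \<Rightarrow> 's \<Rightarrow> complex) \<Rightarrow> bool" where
  "definite S K \<longleftrightarrow> psd S K \<and> (\<forall>f. hform S K f f = 0 \<longrightarrow> (\<forall>s\<in>S. f s = 0))"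

text \<open>
  Gram--Schmidt applied to the point masses. Keeping the support of the first vectors inside the
  index set already treated shows that the next remainder does not vanish.
\<close>

lemma definite_orthonormal_basis:
  assumes "finite S" "definite S K"
  obtains q :: "nat \<Rightarrow> 's \<Rightarrow> complex"
  where "\<And>j k. j < card S \<Longrightarrow> k < card S \<Longrightarrow> hform S K (q j) (q k) = (if j = k then 1 else 0)"
    and "\<And>f s. s \<in> S \<Longrightarrow> f s = (\<Sum>k<card S. hform S K (q k) f * q k s)"
proof -
  let ?h = "hform S K"
  have psd: "psd S K" using assms by (simp add: definite_def)
  have herm: "?h g f = cnj (?h f g)" for f g
    by (rule hform_hermitian[OF psd_hermitian[OF psd assms(1)]])
  have "\<exists>q. (\<forall>j<card F. \<forall>k<card F. ?h (q j) (q k) = (if j = k then 1 else 0)) \<and>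
      (\<forall>k<card F. \<forall>t\<in>S - F. q k t = 0) \<and>
      (\<forall>s\<in>F. \<forall>t\<in>S. dirac s t = (\<Sum>k<card F. ?h (q k) (dirac s) * q k t))"
    if "finite F" "F \<subseteq> S" for F
    using that
  proof (induction F rule: finite_induct)
    case empty show ?case by simp
  next
    case (insert s F)
    define n where "n = card F"
    have "F \<subseteq> S" using insert.prems by simp
    from insert.IH[OF this, folded n_def] obtain q where
      q0: "\<forall>j<n. \<forall>k<n. ?h (q j) (q k) = (if j = k then 1 else 0)"
      and supp0: "\<forall>k<n. \<forall>t\<in>S - F. q k t = 0"
      and exp0: "\<forall>s\<in>F. \<forall>t\<in>S. dirac s t = (\<Sum>k<n. ?h (q k) (dirac s) * q k t)"
      by (elim exE conjE)
    have q: "?h (q j) (q k) = (if j = k then 1 else 0)" if "j < n" "k < n" for j k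
      using q0 that by blast
    have supp: "q k t = 0" if "k < n" "t \<in> S" "t \<notin> F" for k t
      using supp0 that by blast
    have exp: "dirac s t = (\<Sum>k<n. ?h (q k) (dirac s) * q k t)" if "s \<in> F" "t \<in> S" for s t
      using exp0 that by blast
    define c where "c k = ?h (q k) (dirac s)" for k
    define r where "r t = dirac s t + (\<Sum>k<n. - c k * q k t)" for t
    have s: "s \<in> S" "s \<notin> F" using insert by auto
    \<comment> \<open>All earlier vectors vanish at the new point \<open>s\<close>.\<close>
    have "r s = 1" unfolding r_def using supp[OF _ s] by simp
    hence "?h r r \<noteq> 0" using assms(2) s(1) unfolding definite_def by (metis one_neq_zero)
    moreover define \<rho> where "\<rho> = Re (?h r r)"
    ultimately have rho: "?h r r = of_real \<rho>" "\<rho> > 0"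
      using psdD[OF psd, of r] by (auto simp: \<rho>_def less_eq_complex_def complex_eq_iff)
    have r_orth: "?h (q j) r = 0" if "j < n" for j
    proof -
      have "?h (q j) r = c j + (\<Sum>k<n. - c k * ?h (q j) (q k))"
        unfolding r_def hform_add_right hform_sum_right hform_scale_right by (simp add: c_def)
      also have "(\<Sum>k<n. - c k * ?h (q j) (q k)) = (\<Sum>k<n. if k = j then - c j else 0)"
        by (intro sum.cong) (use q that in auto)
      finally show ?thesis using that by (simp add: sum.delta)
    qed
    have r_orth': "?h r (q j) = 0" if "j < n" for j
      using r_orth[OF that] herm[of "q j" r] by simp
    have root: "inverse (of_real (sqrt \<rho>)) * (inverse (of_real (sqrt \<rho>)) * of_real \<rho>) = (1::complex)"
    proof -
      have "complex_of_real \<rho> = of_real (sqrt \<rho>) * of_real (sqrt \<rho>)"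
        using rho(2) by (simp flip: of_real_mult)
      thus ?thesis using rho(2) by (simp add: field_simps)
    qed
    define v where "v t = inverse (of_real (sqrt \<rho>)) * r t" for t
    define q' where "q' k = (if k = n then v else q k)" for k
    have v: "?h v f = inverse (of_real (sqrt \<rho>)) * ?h r f" "?h f v = inverse (of_real (sqrt \<rho>)) * ?h f r" for f
      unfolding v_def hform_scale_left hform_scale_right by simp_all
    have card: "card (insert s F) = Suc n" using insert by (simp add: n_def)
    have 1: "?h (q' j) (q' k) = (if j = k then 1 else 0)" if "j < Suc n" "k < Suc n" for j k
      using that q r_orth r_orth' rho by (auto simp: q'_def v less_Suc_eq root)
    have 2: "q' k t = 0" if "k < Suc n" "t \<in> S" "t \<notin> insert s F" for k t
      using that supp by (auto simp: q'_def v_def r_def less_Suc_eq)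
    have 3: "dirac s' t = (\<Sum>k<Suc n. ?h (q' k) (dirac s') * q' k t)"
      if s': "s' \<in> insert s F" and t: "t \<in> S" for s' t
    proof -
      have q'n: "(\<Sum>k<Suc n. ?h (q' k) (dirac s') * q' k t) =
          (\<Sum>k<n. ?h (q k) (dirac s') * q k t) + ?h v (dirac s') * v t" for s'
        by (simp add: q'_def)
      show ?thesis
      proof (cases "s' = s")
        case True
        have "?h r (dirac s) = ?h r (\<lambda>t. r t + (\<Sum>k<n. c k * q k t))"
          by (rule arg_cong[of _ _ "?h r"]) (simp add: r_def fun_eq_iff sum_negf)
        also have "\<dots> = of_real \<rho>"
          unfolding hform_add_right hform_sum_right hform_scale_right using r_orth' rho by simp
        finally have "?h v (dirac s) * v t = r t"
          using rho unfolding v(1) by (simp add: v_def field_simps flip: of_real_mult)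
        thus ?thesis unfolding q'n True by (simp add: r_def c_def sum_negf)
      next
        case False
        hence F: "s' \<in> F" using s' by simp
        have "?h r (dirac s') = ?h r (\<lambda>t. \<Sum>k<n. ?h (q k) (dirac s') * q k t)"
          by (rule hform_cong) (use exp[OF F] in auto)
        also have "\<dots> = 0" unfolding hform_sum_right hform_scale_right using r_orth' by simp
        finally have "?h v (dirac s') = 0" unfolding v(1) by simp
        thus ?thesis unfolding q'n using exp[OF F t] by simp
      qed
    qed
    show ?case unfolding card by (rule exI[of _ q']) (use 1 2 3 in blast)
  qed
  from this[OF assms(1) order_refl] obtain q where
    q0: "\<forall>j<card S. \<forall>k<card S. ?h (q j) (q k) = (if j = k then 1 else 0)"
    and exp0: "\<forall>s\<in>S. \<forall>t\<in>S. dirac s t = (\<Sum>k<card S. ?h (q k) (dirac s) * q k t)"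
    by (elim exE conjE)
  have q: "?h (q j) (q k) = (if j = k then 1 else 0)" if "j < card S" "k < card S" for j k
    using q0 that by blast
  have exp: "dirac s t = (\<Sum>k<card S. ?h (q k) (dirac s) * q k t)" if "s \<in> S" "t \<in> S" for s t
    using exp0 that by blast
  have "f t = (\<Sum>k<card S. ?h (q k) f * q k t)" if t: "t \<in> S" for f t
  proof -
    have f: "f t = (\<Sum>s\<in>S. f s * dirac s t)" if "t \<in> S" for t
      using that assms(1) by (simp add: if_distrib[of "\<lambda>x. _ * x"] sum.delta' cong: if_cong)
    have hf: "?h (q k) f = (\<Sum>s\<in>S. f s * ?h (q k) (dirac s))" for k
    proof -
      have "?h (q k) f = ?h (q k) (\<lambda>t. \<Sum>s\<in>S. f s * dirac s t)" by (rule hform_cong) (auto intro: f)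
      thus ?thesis unfolding hform_sum_right hform_scale_right .
    qed
    have "f t = (\<Sum>s\<in>S. \<Sum>k<card S. f s * ?h (q k) (dirac s) * q k t)"
      unfolding f[OF t] by (intro sum.cong refl) (simp only: exp[OF _ t] sum_distrib_left mult.assoc)
    also have "\<dots> = (\<Sum>k<card S. ?h (q k) f * q k t)"
      unfolding hf sum_distrib_right by (rule sum.swap)
    finally show ?thesis .
  qed
  thus thesis using q by (intro that[of q])
qed

text \<open>
  By Parseval's identity the value of the form is the squared length of the coefficient vector,
  and each $f(s)$ is a fixed linear combination of the coefficients.
\<close>

lemma definite_bounded_below:
  fixes K :: "'s \<Rightarrow> 's \<Rightarrow> complex"
  assumes "finite S" "definite S K"
  obtains \<kappa> where "\<kappa> > 0" "\<And>f. \<kappa> * (\<Sum>s\<in>S. (cmod (f s))\<^sup>2) \<le> Re (hform S K f f)"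
proof -
  obtain q :: "nat \<Rightarrow> 's \<Rightarrow> complex"
    where "\<And>j k. j < card S \<Longrightarrow> k < card S \<Longrightarrow> hform S K (q j) (q k) = (if j = k then 1 else 0)"
      and exp: "\<And>f s. s \<in> S \<Longrightarrow> f s = (\<Sum>k<card S. hform S K (q k) f * q k s)"
    using definite_orthonormal_basis[OF assms] by blast
  define M where "M = (\<Sum>s\<in>S. \<Sum>k<card S. (cmod (q k s))\<^sup>2)"
  have M: "M \<ge> 0" unfolding M_def by (intro sum_nonneg) auto
  show thesis
  proof (rule that[of "inverse (M + 1)"])
    show "inverse (M + 1) > 0" using M by simp
    fix f :: "'s \<Rightarrow> complex"
    define c where "c k = hform S K (q k) f" for k
    have "hform S K f f = hform S K (\<lambda>s. \<Sum>k<card S. c k * q k s) f"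
      unfolding c_def by (rule hform_cong[OF refl exp refl])
    also have "\<dots> = of_real (\<Sum>k<card S. (cmod (c k))\<^sup>2)"
      unfolding hform_sum_left hform_scale_left c_def[symmetric] by (rule sum_cnj_mult_self)
    finally have parseval: "Re (hform S K f f) = (\<Sum>k<card S. (cmod (c k))\<^sup>2)" by simp
    hence nonneg: "0 \<le> Re (hform S K f f)" by (simp add: sum_nonneg)
    have "(cmod (f s))\<^sup>2 \<le> Re (hform S K f f) * (\<Sum>k<card S. (cmod (q k s))\<^sup>2)" if "s \<in> S" for s
    proof -
      have "cmod (f s) \<le> (\<Sum>k<card S. cmod (c k) * cmod (q k s))"
        unfolding exp[OF that, of f] c_def by (rule sum_norm_le) (simp add: norm_mult)
      hence "(cmod (f s))\<^sup>2 \<le> (\<Sum>k<card S. cmod (c k) * cmod (q k s))\<^sup>2" by (rule power_mono) simp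
      also note Cauchy_Schwarz_ineq_sum
      finally show ?thesis unfolding parseval .
    qed
    hence "(\<Sum>s\<in>S. (cmod (f s))\<^sup>2) \<le> Re (hform S K f f) * M"
      unfolding M_def sum_distrib_left[of "Re _"] by (rule sum_mono)
    also have "\<dots> \<le> Re (hform S K f f) * (M + 1)" using nonneg by (simp add: mult_left_mono)
    finally show "inverse (M + 1) * (\<Sum>s\<in>S. (cmod (f s))\<^sup>2) \<le> Re (hform S K f f)"
      using M by (simp add: field_simps)
  qed
qed

section \<open>Compactness and separation\<close>

lemma pointwise_bounded_subseq:
  fixes X :: "nat \<Rightarrow> 's::countable \<Rightarrow> complex"
  assumes "\<And>k s. cmod (X k s) \<le> B s"
  obtains r l where "strict_mono r" "\<And>s. (\<lambda>k. X (r k) s) \<longlonglongrightarrow> l s"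
proof -
  let ?C = "PiE UNIV (\<lambda>s. cball 0 (B s)) :: ('s \<Rightarrow> complex) set"
  have "compactin (product_topology (\<lambda>_. euclidean) UNIV) ?C"
    unfolding compactin_PiE by simp
  hence "compact ?C" by (simp add: euclidean_product_topology)
  hence "seq_compact ?C" by (simp add: compact_eq_seq_compact_metric)
  moreover have "\<forall>k. X k \<in> ?C" using assms by auto
  ultimately obtain l r where r: "strict_mono r" "(X \<circ> r) \<longlonglongrightarrow> l"
    by (blast elim: seq_compactE)
  have "(\<lambda>k. X (r k) s) \<longlonglongrightarrow> l s" for s
  proof -
    have "isCont (\<lambda>f. f s) l" for l :: "'s \<Rightarrow> complex"
      by (metis UNIV_I continuous_on_eq_continuous_at open_UNIV continuous_on_product_coordinates)
    from isCont_tendsto_compose[OF this r(2)] show ?thesis by (simp add: o_def)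
  qed
  thus thesis using r(1) by (intro that)
qed

lemma hform_tendsto:
  assumes "\<And>s. s \<in> S \<Longrightarrow> (\<lambda>k. f k s) \<longlonglongrightarrow> f' s" "\<And>s t. s \<in> S \<Longrightarrow> t \<in> S \<Longrightarrow> (\<lambda>k. K k s t) \<longlonglongrightarrow> K' s t"
    "\<And>s. s \<in> S \<Longrightarrow> (\<lambda>k. g k s) \<longlonglongrightarrow> g' s"
  shows "(\<lambda>k. hform S (K k) (f k) (g k)) \<longlonglongrightarrow> hform S K' f' g'"
  unfolding hform_def by (intro tendsto_intros assms)

text \<open>
  The bound \<open>t \<le> 1\<close> is there for displacements inside a cone, where a vector can be
  diminished at most to zero.
\<close>

lemma nonneg_if_perturbed_nonneg:
  fixes R Q :: real
  assumes "\<And>t. 0 < t \<Longrightarrow> t \<le> 1 \<Longrightarrow> 0 \<le> R + t * Q"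
  shows "0 \<le> R"
proof -
  have "((\<lambda>t. R + t * Q) \<longlongrightarrow> R + 0 * Q) (at_right 0)" by (intro tendsto_intros)
  moreover have "\<forall>\<^sub>F t in at_right (0::real). 0 \<le> R + t * Q"
    using eventually_at_right_less[of "0::real"] eventually_at_right_real[of 0 1]
    by (rule eventually_elim2[OF _ _]) (use assms in auto)
  ultimately show ?thesis by (intro tendsto_lowerbound[of _ _ _ 0]) auto
qed

text \<open>
  The separating functional is the displacement from the given element to a limit of almost
  closest points of the cone. Such a limit lies in the closure of the cone and exists by
  compactness, because almost closest points are bounded.
\<close>

lemma cone_approximation_or_separation:
  fixes C :: "('t::countable \<Rightarrow> complex) set"
  assumes "finite T" and zero: "(\<lambda>_. 0) \<in> C"
    and add: "\<And>c c'. c \<in> C \<Longrightarrow> c' \<in> C \<Longrightarrow> (\<lambda>t. c t + c' t) \<in> C"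
    and scale: "\<And>a c. 0 \<le> a \<Longrightarrow> c \<in> C \<Longrightarrow> (\<lambda>t. of_real a * c t) \<in> C"
    and far: "\<epsilon> > 0" "\<And>c. c \<in> C \<Longrightarrow> \<exists>t\<in>T. \<epsilon> \<le> cmod (p t - c t)"
  obtains L where "\<And>c. c \<in> C \<Longrightarrow> 0 \<le> Re (\<Sum>t\<in>T. L t * c t)" "Re (\<Sum>t\<in>T. L t * p t) < 0"
proof -
  define D where "D c = (\<Sum>t\<in>T. (cmod (c t - p t))\<^sup>2)" for c
  have D_far: "\<epsilon>\<^sup>2 \<le> D c" if "c \<in> C" for c
  proof -
    from far(2)[OF that] obtain t where t: "t \<in> T" "\<epsilon> \<le> cmod (p t - c t)" by blast
    have "\<epsilon>\<^sup>2 \<le> (cmod (c t - p t))\<^sup>2" using t far(1) by (simp add: norm_minus_commute power_mono)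
    also have "\<dots> \<le> D c" unfolding D_def by (rule member_le_sum) (use t assms in auto)
    finally show ?thesis .
  qed
  define \<delta> where "\<delta> = Inf (D ` C)"
  have ne: "D ` C \<noteq> {}" using zero by blast
  have bdd: "bdd_below (D ` C)" using D_far by (intro bdd_belowI[of _ "\<epsilon>\<^sup>2"]) blast
  have \<delta>_le: "\<delta> \<le> D c" if "c \<in> C" for c unfolding \<delta>_def using bdd that by (intro cInf_lower) auto
  have \<delta>_pos: "\<delta> > 0"
  proof -
    have "\<epsilon>\<^sup>2 \<le> \<delta>" unfolding \<delta>_def using ne D_far by (intro cInf_greatest) auto
    moreover have "0 < \<epsilon>\<^sup>2" using far(1) by simp
    ultimately show ?thesis by linarith
  qed
  have "\<exists>c\<in>C. D c < \<delta> + inverse (real (Suc k))" for k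
    using cInf_lessD[OF ne, of "\<delta> + inverse (real (Suc k))"] unfolding \<delta>_def by force
  then obtain c where c: "\<And>k. c k \<in> C" "\<And>k. D (c k) < \<delta> + inverse (real (Suc k))" by metis
  define X where "X k t = (if t \<in> T then c k t else 0)" for k t
  have "cmod (X k t) \<le> cmod (p t) + sqrt (\<delta> + 1)" for k t
  proof (cases "t \<in> T")
    case True
    have "(cmod (c k t - p t))\<^sup>2 \<le> D (c k)" unfolding D_def by (rule member_le_sum) (use True assms in auto)
    also have "\<dots> \<le> \<delta> + 1" using c(2)[of k] le_imp_inverse_le[of 1 "real (Suc k)"] by simp
    finally have "cmod (c k t - p t) \<le> sqrt (\<delta> + 1)" by (rule real_le_rsqrt)
    thus ?thesis using norm_triangle_ineq[of "c k t - p t" "p t"] True by (simp add: X_def)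
  qed (use \<delta>_pos in \<open>simp add: X_def\<close>)
  then obtain r l where r: "strict_mono r" "\<And>s. (\<lambda>k. X (r k) s) \<longlonglongrightarrow> l s"
    using pointwise_bounded_subseq[of X "\<lambda>t. cmod (p t) + sqrt (\<delta> + 1)"] by blast
  have cl: "(\<lambda>k. c (r k) t) \<longlonglongrightarrow> l t" if "t \<in> T" for t
    using r(2)[of t] that by (simp add: X_def)
  have D_l: "D l \<le> \<delta>"
  proof (rule LIMSEQ_le)
    show "(\<lambda>k. D (c (r k))) \<longlonglongrightarrow> D l" unfolding D_def by (intro tendsto_intros cl)
    show "(\<lambda>k. \<delta> + inverse (real (Suc (r k)))) \<longlonglongrightarrow> \<delta>"
      using tendsto_add[OF tendsto_const LIMSEQ_subseq_LIMSEQ[OF LIMSEQ_inverse_real_of_nat r(1)], of \<delta>] by (simp add: o_def)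
    show "\<exists>N. \<forall>k\<ge>N. D (c (r k)) \<le> \<delta> + inverse (real (Suc (r k)))" using c(2) less_imp_le by blast
  qed
  have D_near: "\<delta> \<le> D (\<lambda>t. of_real a * l t + of_real b * e t)" if "a \<ge> 0" "b \<ge> 0" "e \<in> C" for a b e
  proof (rule LIMSEQ_le_const)
    show "(\<lambda>k. D (\<lambda>t. of_real a * c (r k) t + of_real b * e t)) \<longlonglongrightarrow> D (\<lambda>t. of_real a * l t + of_real b * e t)"
      unfolding D_def by (intro tendsto_intros cl)
    show "\<exists>N. \<forall>k\<ge>N. \<delta> \<le> D (\<lambda>t. of_real a * c (r k) t + of_real b * e t)"
      by (intro exI allI impI \<delta>_le add scale c(1) that)
  qed
  \<comment> \<open>Both \<open>l\<close> plus a nonnegative multiple of \<open>e\<close> and \<open>l\<close> diminished to \<open>(1 - b) l\<close> are limits of elements of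
    the cone, so neither displacement comes closer to \<open>p\<close>; the first order terms give the signs.\<close>
  define L where "L t = cnj (l t - p t)" for t
  have expand: "D (\<lambda>t. l t + of_real b * e t) = D l + 2 * b * Re (\<Sum>t\<in>T. L t * e t) + b\<^sup>2 * (\<Sum>t\<in>T. (cmod (e t))\<^sup>2)" for b e
    unfolding D_def Re_sum sum_distrib_left sum.distrib[symmetric]
    by (intro sum.cong refl) (simp add: L_def cmod_power2, simp add: power2_eq_square algebra_simps)
  have sep: "0 \<le> Re (\<Sum>t\<in>T. L t * e t)" if "\<And>b. 0 < b \<Longrightarrow> b \<le> 1 \<Longrightarrow> \<delta> \<le> D (\<lambda>t. l t + of_real b * e t)" for e
  proof -
    have "0 \<le> 2 * Re (\<Sum>t\<in>T. L t * e t) + b * (\<Sum>t\<in>T. (cmod (e t))\<^sup>2)" if b: "0 < b" "b \<le> 1" for b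
    proof -
      have "0 \<le> b * (2 * Re (\<Sum>t\<in>T. L t * e t) + b * (\<Sum>t\<in>T. (cmod (e t))\<^sup>2))"
        using \<open>\<And>b. 0 < b \<Longrightarrow> b \<le> 1 \<Longrightarrow> \<delta> \<le> D (\<lambda>t. l t + of_real b * e t)\<close>[OF b] D_l
        unfolding expand by (simp add: algebra_simps power2_eq_square)
      thus ?thesis using b by (simp add: zero_le_mult_iff)
    qed
    hence "0 \<le> 2 * Re (\<Sum>t\<in>T. L t * e t)" by (rule nonneg_if_perturbed_nonneg)
    thus ?thesis by simp
  qed
  show thesis
  proof (rule that)
    show "0 \<le> Re (\<Sum>t\<in>T. L t * e t)" if "e \<in> C" for e
      using D_near[of 1 _ e] that by (intro sep) simp
    have "0 \<le> Re (\<Sum>t\<in>T. L t * (- l t))"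
    proof (rule sep)
      fix b :: real assume b: "0 < b" "b \<le> 1"
      have "(\<lambda>t. l t + of_real b * (- l t)) = (\<lambda>t. of_real (1 - b) * l t + of_real 0 * (0::complex))"
        by (simp add: algebra_simps)
      thus "\<delta> \<le> D (\<lambda>t. l t + of_real b * (- l t))" using D_near[OF _ _ zero, of "1 - b" 0] b by simp
    qed
    moreover have "Re (\<Sum>t\<in>T. L t * p t) = Re (\<Sum>t\<in>T. L t * l t) - D l"
      unfolding D_def Re_sum sum_subtractf[symmetric]
      by (intro sum.cong refl) (simp add: L_def cmod_power2, simp add: power2_eq_square algebra_simps)
    moreover have "\<delta> \<le> D l" using D_near[OF _ _ zero, of 1 0] by simp
    ultimately show "Re (\<Sum>t\<in>T. L t * p t) < 0" using \<delta>_pos by (simp add: sum_negf)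
  qed
qed

section \<open>Words and weighted moments\<close>

type_synonym word = "(nat \<times> nat) list"

definition words :: "nat \<Rightarrow> (nat \<Rightarrow> nat) \<Rightarrow> nat \<Rightarrow> word set" where
  "words m n k = {w. set w \<subseteq> indices m n \<and> length w \<le> k}"

text \<open>
  The variables $y_{i,j}$ have $j \ge 1$, so the pair $(i, 0)$ is free to denote the complement
  $1 - \sum_j y_{i,j}$. With it the outcomes of each measurement sum to \<open>1\<close>.
\<close>

definition outcomes :: "nat \<Rightarrow> (nat \<Rightarrow> nat) \<Rightarrow> (nat \<times> nat) set" where
  "outcomes m n = (SIGMA i:{1..m}. {0..n i - 1})"

text \<open>
  The value $L(u^* y_x v)$ of the linear extension of \<open>L\<close>. The values of \<open>L\<close> lie in an arbitrary group, so that
  the same expression serves for moments, for matrix entries and for polynomials.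
\<close>

definition weighted ::
  "(nat \<Rightarrow> nat) \<Rightarrow> (word \<Rightarrow> 'b::ab_group_add) \<Rightarrow> word \<Rightarrow> nat \<times> nat \<Rightarrow> word \<Rightarrow> 'b" where
  "weighted n L u x v =
     (if snd x = 0 then L (rev u @ v) - (\<Sum>j\<in>{1..n (fst x) - 1}. L (rev u @ (fst x, j) # v))
      else L (rev u @ x # v))"

lemma finite_indices: "finite (indices m n)"
  by (simp add: indices_def)

lemma finite_words: "finite (words m n k)"
  unfolding words_def using finite_lists_length_le[OF finite_indices] by simp

lemma finite_outcomes: "finite (outcomes m n)"
  by (simp add: outcomes_def)

lemma nil_in_words [simp]: "[] \<in> words m n k"
  by (simp add: words_def)

lemma indices_subset_outcomes: "indices m n \<subseteq> outcomes m n"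
  by (auto simp: indices_def outcomes_def)

text \<open>
  Since the weights are linear, products of two words of length at most \<open>d\<close> with a weight between
  them involve only words of length at most $2d+1$.
\<close>

lemma weighted_cong:
  assumes "u \<in> words m n d" "v \<in> words m n d" "x \<in> outcomes m n"
    and "\<And>w. w \<in> words m n (2 * d + 1) \<Longrightarrow> L w = L' w"
  shows "weighted n L u x v = weighted n L' u x v"
proof -
  have 1: "L (rev u @ v) = L' (rev u @ v)" by (rule assms(4)) (use assms(1,2) in \<open>auto simp: words_def\<close>)
  have 2: "L (rev u @ y # v) = L' (rev u @ y # v)" if "y \<in> indices m n" for y
    by (rule assms(4)) (use assms(1,2) that in \<open>auto simp: words_def\<close>)
  obtain i j where x: "x = (i, j)" by force
  have i: "i \<in> {1..m}" "j \<le> n i - 1" using assms(3) by (auto simp: x outcomes_def)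
  have 3: "(\<Sum>j\<in>{1..n i - 1}. L (rev u @ (i, j) # v)) = (\<Sum>j\<in>{1..n i - 1}. L' (rev u @ (i, j) # v))"
    by (intro sum.cong refl 2) (use i in \<open>auto simp: indices_def\<close>)
  show ?thesis
    using 1 2[of x] 3 i by (auto simp: weighted_def x indices_def)
qed

lemma additive_weighted:
  assumes "Modules.additive \<theta>"
  shows "\<theta> (weighted n L u x v) = weighted n (\<lambda>w. \<theta> (L w)) u x v"
  by (simp add: weighted_def Modules.additive.diff[OF assms] Modules.additive.sum[OF assms])

lemma weighted_add: "weighted n (\<lambda>w. K w + L w) u x v = weighted n K u x v + weighted n L u x v"
  by (simp add: weighted_def sum.distrib)

lemma weighted_zero: "weighted n (\<lambda>w. 0) u x v = 0"
  by (simp add: weighted_def)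

lemma weighted_scale: "weighted n (\<lambda>w. c * L w) u x v = (c :: complex) * weighted n L u x v"
  by (simp add: weighted_def sum_distrib_left right_diff_distrib)

lemma weighted_sum: "weighted n (\<lambda>w. \<Sum>k\<in>A. L k w) u x v = (\<Sum>k\<in>A. weighted n (L k) u x v)"
  by (induction A rule: infinite_finite_induct) (simp_all add: weighted_add weighted_zero)

lemma weighted_expand:
  assumes "u \<in> words m n d" "v \<in> words m n d" "x \<in> outcomes m n"
  shows "weighted n L u x v = (\<Sum>w\<in>words m n (2 * d + 1). L w * weighted n (dirac w) u x v)"
proof -
  have "weighted n L u x v = weighted n (\<lambda>w'. \<Sum>w\<in>words m n (2 * d + 1). L w * dirac w w') u x v"
  proof (rule weighted_cong[OF assms])
    fix w' assume "w' \<in> words m n (2 * d + 1)"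
    thus "L w' = (\<Sum>w\<in>words m n (2 * d + 1). L w * dirac w w')"
      by (simp add: if_distrib[of "\<lambda>x. _ * x"] sum.delta' finite_words cong: if_cong)
  qed
  thus ?thesis by (simp add: weighted_sum weighted_scale)
qed

lemma weighted_partition: "(\<Sum>j\<in>{0..n i - 1}. weighted n L u (i, j) v) = L (rev u @ v)"
proof -
  have "{0..n i - 1} = insert 0 {1..n i - 1}" by auto
  hence "(\<Sum>j\<in>{0..n i - 1}. weighted n L u (i, j) v) =
      weighted n L u (i, 0) v + (\<Sum>j\<in>{1..n i - 1}. weighted n L u (i, j) v)" by simp
  also have "(\<Sum>j\<in>{1..n i - 1}. weighted n L u (i, j) v) = (\<Sum>j\<in>{1..n i - 1}. L (rev u @ (i, j) # v))"
    by (intro sum.cong) (auto simp: weighted_def)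
  finally show ?thesis by (simp add: weighted_def)
qed

lemma weighted_swap:
  assumes "\<And>w. cnj (L w) = L' (rev w)"
  shows "cnj (weighted n L u x v) = weighted n L' v x u"
  by (simp add: weighted_def assms)

section \<open>A faithful functional\<close>

lemma hform_bound:
  assumes "finite S"
  shows "cmod (hform S K g g) \<le> (\<Sum>s\<in>S. \<Sum>t\<in>S. cmod (K s t)) * (\<Sum>s\<in>S. (cmod (g s))\<^sup>2)"
proof -
  let ?N = "\<Sum>s\<in>S. (cmod (g s))\<^sup>2"
  have "cmod (g s) * cmod (g t) \<le> ?N" if "s \<in> S" "t \<in> S" for s t
  proof -
    have le: "(cmod (g s))\<^sup>2 \<le> ?N" if "s \<in> S" for s by (rule member_le_sum) (use that assms in auto)
    have "2 * (cmod (g s) * cmod (g t)) \<le> (cmod (g s))\<^sup>2 + (cmod (g t))\<^sup>2"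
      using sum_squares_bound[of "cmod (g s)" "cmod (g t)"] by (simp add: mult.assoc)
    thus ?thesis using le[OF that(1)] le[OF that(2)] by simp
  qed
  hence "cmod (cnj (g s) * K s t * g t) \<le> cmod (K s t) * ?N" if "s \<in> S" "t \<in> S" for s t
    using mult_left_mono[of "cmod (g s) * cmod (g t)" ?N "cmod (K s t)"] that by (simp add: norm_mult mult_ac)
  hence "cmod (hform S K g g) \<le> (\<Sum>s\<in>S. \<Sum>t\<in>S. cmod (K s t) * ?N)"
    unfolding hform_def by (intro sum_norm_le) auto
  thus ?thesis by (simp add: sum_distrib_right)
qed

lemma psdI_Re:
  assumes "hermitian S K" "\<And>f. 0 \<le> Re (hform S K f f)"
  shows "psd S K"
  unfolding psd_def
proof
  fix f
  have "Im (hform S K f f) = - Im (hform S K f f)"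
    using hform_hermitian[OF assms(1), of f f] by (metis complex_cnj_cnj cnj.sel(2))
  thus "0 \<le> hform S K f f" using assms(2)[of f] by (simp add: less_eq_complex_def)
qed

text \<open>
  The functional is the vector state at the empty word of explicit matrices on the words of length at
  most \<open>d\<close>: $E_x = c + \delta\, T_x$, where $T_x$ adds or removes the letter \<open>x\<close> in front. For small
  $\delta$ all effects, the complements included, are at least $c/2$. This reduces the claim to the
  linear independence of the vectors $E^u\Omega$, which holds because $E^u\Omega$ is $\delta^{|u|}$
  times the word \<open>u\<close> plus a combination of shorter words.
\<close>

lemma faithful_functional:
  obtains L :: "word \<Rightarrow> complex" and \<kappa> :: real
  where "\<kappa> > 0" "\<And>w. cnj (L w) = L (rev w)"
    "\<And>x f. x \<in> outcomes m n \<Longrightarrow>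
      \<kappa> * (\<Sum>u\<in>words m n d. (cmod (f u))\<^sup>2) \<le> Re (hform (words m n d) (\<lambda>u v. weighted n L u x v) f f)"
proof -
  define W where "W = words m n d"
  have finW: "finite W" and nilW: "[] \<in> W" by (simp_all add: W_def finite_words)
  \<comment> \<open>\<open>P - 1\<close> bounds the number of variables of each measurement, so that the scalars \<open>c = 1 / P\<close> leave at least
    \<open>c\<close> for the complement. \<open>M\<close> bounds the forms of all \<open>T x\<close>, and with the chosen \<open>\<delta>\<close> all the \<open>T x\<close> of one
    measurement together take away at most half of that.\<close>
  define P0 where "P0 = (\<Sum>i\<in>{1..m}. n i)"
  define P where "P = real P0 + 1"
  define c where "c = inverse P"
  define M where "M = (real (card W))\<^sup>2"
  define \<delta> where "\<delta> = c / (2 * P * M)"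
  have "card W > 0" using finW nilW by (auto simp: card_gt_0_iff)
  hence M: "M > 0" and P: "P > 0" and c: "c > 0" by (simp_all add: M_def P_def c_def)
  have \<delta>: "\<delta> > 0" using M P c by (simp add: \<delta>_def)
  define T :: "nat \<times> nat \<Rightarrow> word \<Rightarrow> word \<Rightarrow> complex"
    where "T x u v = (if u = x # v \<or> v = x # u then 1 else 0)" for x u v
  define E where "E x u v = (if u = v then of_real c else 0) + of_real \<delta> * T x u v" for x u v
  have E_sym: "E x u v = E x v u" and E_real: "cnj (E x u v) = E x u v" for x u v
    by (auto simp: E_def T_def)
  \<comment> \<open>\<open>vec w\<close> is the vector obtained by applying the matrices of the word \<open>w\<close> to the empty word.\<close>
  define vec where "vec = rec_list (dirac []) (\<lambda>x w f u. \<Sum>v\<in>W. E x u v * f v)"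
  have vec_Nil: "vec [] = dirac []" and vec_Cons: "vec (x # w) u = (\<Sum>v\<in>W. E x u v * vec w v)" for x w u
    by (simp_all add: vec_def)
  have vec_real: "cnj (vec w u) = vec w u" for w u
    by (induction w arbitrary: u) (simp_all add: vec_Nil vec_Cons E_real)
  define L where "L w = vec w []" for w
  have L_rev: "(\<Sum>s\<in>W. vec u s * vec v s) = L (rev u @ v)" for u v
  proof (induction u arbitrary: v)
    case Nil
    have "(\<Sum>s\<in>W. vec [] s * vec v s) = (\<Sum>s\<in>W. if s = [] then vec v s else 0)"
      by (intro sum.cong) (auto simp: vec_Nil)
    thus ?case using finW nilW by (simp add: sum.delta L_def)
  next
    case (Cons x u)
    have "(\<Sum>s\<in>W. vec (x # u) s * vec v s) = (\<Sum>s\<in>W. \<Sum>t\<in>W. vec u t * (E x t s * vec v s))"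
      unfolding vec_Cons sum_distrib_right by (intro sum.cong refl) (simp add: E_sym[of x] mult_ac)
    also have "\<dots> = (\<Sum>t\<in>W. vec u t * vec (x # v) t)"
      unfolding vec_Cons sum_distrib_left by (rule sum.swap)
    finally show ?case using Cons.IH[of "x # v"] by simp
  qed
  have L_herm: "cnj (L w) = L (rev w)" for w
  proof -
    have "L (rev w @ []) = (\<Sum>s\<in>W. vec [] s * vec w s)" unfolding L_rev[symmetric] by (simp add: mult.commute)
    also have "\<dots> = L w" using L_rev[of "[]" w] by simp
    finally show ?thesis by (simp add: L_def vec_real)
  qed
  define D where "D x s t = (if snd x = 0 then (if s = t then 1 else 0) - (\<Sum>j\<in>{1..n (fst x) - 1}. E (fst x, j) s t)
    else E x s t)" for x s t
  have one: "hform W (\<lambda>s t. if s = t then 1 else 0) (vec u) (vec v) = L (rev u @ v)" for u v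
    unfolding hform_id[OF finW] by (simp add: vec_real L_rev)
  have EL: "hform W (E x) (vec u) (vec v) = L (rev u @ x # v)" for x u v
    unfolding L_rev[symmetric] vec_Cons hform_def by (simp add: vec_real sum_distrib_left mult_ac)
  have weighted: "weighted n L u x v = hform W (D x) (vec u) (vec v)" for u x v
  proof (cases "snd x = 0")
    case True
    have "hform W (D x) (vec u) (vec v) = hform W (\<lambda>s t. (if s = t then 1 else 0) +
       (\<Sum>j\<in>{1..n (fst x) - 1}. (-1) * E (fst x, j) s t)) (vec u) (vec v)"
      by (rule hform_cong) (use True in \<open>auto simp: D_def sum_negf\<close>)
    thus ?thesis
      unfolding hform_kernel_add hform_kernel_sum hform_kernel_scale one EL using True
      by (simp add: weighted_def sum_negf)
  next
    case False
    hence "D x = E x" by (simp add: D_def fun_eq_iff)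
    thus ?thesis using False by (simp add: weighted_def EL)
  qed
  define N where "N g = (\<Sum>s\<in>W. (cmod (g s))\<^sup>2)" for g :: "word \<Rightarrow> complex"
  have N_pos: "N g \<ge> 0" for g by (simp add: N_def sum_nonneg)
  have T_bound: "cmod (hform W (T x) g g) \<le> M * N g" for x g
  proof -
    have "(\<Sum>s\<in>W. \<Sum>t\<in>W. cmod (T x s t)) \<le> (\<Sum>s\<in>W. \<Sum>t\<in>W. 1)"
      by (intro sum_mono) (simp add: T_def)
    also have "\<dots> = M" by (simp add: M_def power2_eq_square)
    finally show ?thesis
      using hform_bound[OF finW, of "T x" g] mult_right_mono[of _ M "N g"] N_pos[of g]
      unfolding N_def by (meson order_trans)
  qed
  have idN: "hform W (\<lambda>s t. if s = t then r else 0) g g = r * of_real (N g)" for r g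
    unfolding hform_id[OF finW] N_def sum_cnj_mult_self ..
  have E_form: "Re (hform W (E x) g g) = c * N g + \<delta> * Re (hform W (T x) g g)" for x g
    unfolding E_def[abs_def] hform_kernel_add hform_kernel_scale by (simp add: idN)
  have \<delta>M: "\<delta> * (M * N g) = c / (2 * P) * N g" for g using M by (simp add: \<delta>_def)
  have T_abs: "\<bar>\<delta> * Re (hform W (T x) g g)\<bar> \<le> c / (2 * P) * N g" for x g
  proof -
    have "\<bar>\<delta> * Re (hform W (T x) g g)\<bar> \<le> \<delta> * (M * N g)"
      using T_bound[of x g] abs_Re_le_cmod[of "hform W (T x) g g"] \<delta> by (simp add: abs_mult)
    thus ?thesis unfolding \<delta>M .
  qed
  have D_below: "c / 2 * N g \<le> Re (hform W (D x) g g)" if x: "x \<in> outcomes m n" for x g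
  proof (cases "snd x = 0")
    case False
    hence DE: "D x = E x" by (simp add: D_def fun_eq_iff)
    have "c / (2 * P) * N g \<le> c / 2 * N g"
      using N_pos[of g] c by (intro mult_right_mono) (auto simp: P_def field_simps)
    moreover have "c / 2 * N g + c / 2 * N g = c * N g" by simp
    ultimately show ?thesis
      unfolding DE E_form using abs_le_D2[OF T_abs[of x g]] by linarith
  next
    case True
    define k where "k = n (fst x) - 1"
    have "fst x \<in> {1..m}" using x by (auto simp: outcomes_def)
    hence "n (fst x) \<le> P0" unfolding P0_def by (intro member_le_sum) auto
    hence k: "real k \<le> P - 1" by (simp add: k_def P_def)
    have "hform W (D x) g g = hform W (\<lambda>s t. (if s = t then 1 else 0) +
       (\<Sum>j\<in>{1..n (fst x) - 1}. (-1) * E (fst x, j) s t)) g g"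
      by (rule hform_cong) (use True in \<open>auto simp: D_def sum_negf\<close>)
    hence "Re (hform W (D x) g g) = N g - (\<Sum>j\<in>{1..k}. Re (hform W (E (fst x, j)) g g))"
      unfolding hform_kernel_add hform_kernel_sum hform_kernel_scale idN k_def by (simp add: sum_negf)
    moreover have "(\<Sum>j\<in>{1..k}. Re (hform W (E (fst x, j)) g g)) \<le> (\<Sum>j\<in>{1..k}. (c + c / (2 * P)) * N g)"
      unfolding E_form using T_abs[of "(fst x, _)" g] by (intro sum_mono) (simp add: distrib_right abs_le_iff)
    moreover have "real k * ((c + c / (2 * P)) * N g) \<le> (1 - c / 2) * N g"
    proof -
      have "real k * (c + c / (2 * P)) \<le> (P - 1) * (c + c / (2 * P))"
        using k c P by (intro mult_right_mono) auto
      also have "\<dots> \<le> 1 - c / 2" using P by (simp add: c_def field_simps)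
      finally have "real k * (c + c / (2 * P)) * N g \<le> (1 - c / 2) * N g"
        using N_pos[of g] by (rule mult_right_mono)
      thus ?thesis by (simp only: mult.assoc)
    qed
    ultimately show ?thesis by (simp add: algebra_simps)
  qed
  have vec_top: "vec u w = (if w = u then of_real (\<delta> ^ length u) else 0)"
    if "u \<in> W" "w \<in> W" "length u \<le> length w" for u w
    using that
  proof (induction u arbitrary: w)
    case Nil thus ?case by (auto simp: vec_Nil)
  next
    case (Cons x u)
    have u: "u \<in> W" using Cons.prems(1) by (auto simp: W_def words_def)
    have "E x w v * vec u v = (if v = u then (if w = x # u then of_real \<delta> * of_real (\<delta> ^ length u) else 0) else 0)"
      if v: "v \<in> W" for v
    proof (cases "length u \<le> length v")
      case True
      show ?thesis using Cons.IH[OF u v True] Cons.prems(3) by (auto simp: E_def T_def)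
    next
      case False
      hence "E x w v = 0" using Cons.prems(3) by (auto simp: E_def T_def)
      thus ?thesis using False by auto
    qed
    hence "vec (x # u) w = (\<Sum>v\<in>W. if v = u then (if w = x # u then of_real \<delta> * of_real (\<delta> ^ length u) else 0) else 0)"
      unfolding vec_Cons by (intro sum.cong) auto
    thus ?case using finW u by (simp add: sum.delta')
  qed
  \<comment> \<open>A vanishing combination is killed from the longest words down.\<close>
  define comb where "comb f s = (\<Sum>u\<in>W. f u * vec u s)" for f s
  have comb_inj: "f u = 0" if z: "\<And>s. s \<in> W \<Longrightarrow> comb f s = 0" and u: "u \<in> W" for f u
    using u
  proof (induction "d - length u" arbitrary: u rule: less_induct)
    case less
    have "f u' * vec u' u = (if u' = u then f u * of_real (\<delta> ^ length u) else 0)" if u': "u' \<in> W" for u'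
    proof (cases "length u' \<le> length u")
      case True
      thus ?thesis using vec_top[OF u' less.prems True] by auto
    next
      case False
      hence "d - length u' < d - length u" using u' by (auto simp: W_def words_def)
      thus ?thesis using less.hyps[OF _ u'] False by auto
    qed
    hence "comb f u = (\<Sum>u'\<in>W. if u' = u then f u * of_real (\<delta> ^ length u) else 0)"
      unfolding comb_def by (intro sum.cong) auto
    hence "f u * of_real (\<delta> ^ length u) = 0" using z[OF less.prems] finW less.prems by (simp add: sum.delta')
    thus "f u = 0" using \<delta> by simp
  qed
  have comb_form: "hform W (\<lambda>u v. hform W K (vec u) (vec v)) f f = hform W K (comb f) (comb f)" for K f
    unfolding comb_def hform_sum_right hform_sum_left hform_scale_right hform_scale_left
    by (subst hform_def) (simp add: sum_distrib_left sum_distrib_right mult_ac)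
  define G where "G u v = hform W (\<lambda>s t. if s = t then 1 else 0) (vec u) (vec v)" for u v
  have G_form: "hform W G f f = of_real (N (comb f))" for f
    using comb_form[of "\<lambda>s t. if s = t then 1 else 0" f] by (simp add: G_def[abs_def] idN)
  have "definite W G"
    unfolding definite_def psd_def
  proof (intro conjI allI impI ballI)
    show "0 \<le> hform W G f f" for f unfolding G_form using N_pos by (simp add: less_eq_complex_def)
    fix f u assume "hform W G f f = 0" and u: "u \<in> W"
    hence "N (comb f) = 0" by (simp add: G_form)
    hence "\<forall>s\<in>W. comb f s = 0" unfolding N_def using finW by (simp add: sum_nonneg_eq_0_iff)
    thus "f u = 0" using comb_inj u by blast
  qed
  from definite_bounded_below[OF finW this]
  obtain \<kappa> where \<kappa>: "\<kappa> > 0" "\<And>f. \<kappa> * N f \<le> Re (hform W G f f)"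
    unfolding N_def by blast
  show thesis
  proof (rule that[of "c / 2 * \<kappa>" L])
    show "c / 2 * \<kappa> > 0" using c \<kappa> by simp
    show "cnj (L w) = L (rev w)" for w by (rule L_herm)
    fix x f assume x: "x \<in> outcomes m n"
    have "c / 2 * (\<kappa> * N f) \<le> c / 2 * N (comb f)"
      using \<kappa>(2)[of f] c by (intro mult_left_mono) (auto simp: G_form)
    also have "\<dots> \<le> Re (hform W (D x) (comb f) (comb f))" by (rule D_below[OF x])
    also have "hform W (D x) (comb f) (comb f) = hform W (\<lambda>u v. weighted n L u x v) f f"
      unfolding weighted comb_form ..
    finally show "c / 2 * \<kappa> * (\<Sum>u\<in>words m n d. (cmod (f u))\<^sup>2) \<le>
        Re (hform (words m n d) (\<lambda>u v. weighted n L u x v) f f)"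
      unfolding N_def W_def by (simp add: mult.assoc)
  qed
qed

section \<open>The Gelfand--Naimark--Segal construction for truncated functionals\<close>

text \<open>
  The kernels of the forms $\varphi(f^* y_x g)$ and $\varphi(f^* g)$ in the monomial basis. An index is a word
  together with a coefficient index.
\<close>

definition moment_kernel ::
  "(nat \<Rightarrow> nat) \<Rightarrow> (word \<Rightarrow> nat \<Rightarrow> nat \<Rightarrow> complex) \<Rightarrow> nat \<times> nat
    \<Rightarrow> word \<times> nat \<Rightarrow> word \<times> nat \<Rightarrow> complex" where
  "moment_kernel n \<phi> x s t = weighted n (\<lambda>w. \<phi> w (snd s) (snd t)) (fst s) x (fst t)"

definition gram_kernel ::
  "(word \<Rightarrow> nat \<Rightarrow> nat \<Rightarrow> complex)
    \<Rightarrow> word \<times> nat \<Rightarrow> word \<times> nat \<Rightarrow> complex" where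
  "gram_kernel \<phi> s t = \<phi> (rev (fst s) @ fst t) (snd s) (snd t)"

lemma moment_kernel_partition: "(\<Sum>j\<in>{0..n i - 1}. moment_kernel n \<phi> (i, j) s t) = gram_kernel \<phi> s t"
  unfolding moment_kernel_def gram_kernel_def by (rule weighted_partition)

text \<open>
  Only vectors of the form $E^w f$ matter below. Describing them by recursion on the word avoids the
  carrier conditions of matrix products.
\<close>

fun act :: "nat \<Rightarrow> (nat \<times> nat \<Rightarrow> complex mat) \<Rightarrow> word \<Rightarrow> (nat \<Rightarrow> complex) \<Rightarrow> nat \<Rightarrow> complex" where
  "act l E [] f a = f a"
| "act l E (x # w) f a = (\<Sum>b<l. E x $$ (a, b) * act l E w f b)"

lemma act_append: "act l E (u @ v) f a = act l E u (act l E v f) a"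
  by (induction u arbitrary: a) simp_all

lemma eval_word_carrier:
  assumes "\<And>x. x \<in> set w \<Longrightarrow> E x \<in> carrier_mat l l"
  shows "eval_word l E (Word w) \<in> carrier_mat l l"
  using assms by (induction w) (auto simp: eval_word_def intro!: mult_carrier_mat)

lemma eval_word_act:
  assumes "\<And>x. x \<in> set w \<Longrightarrow> E x \<in> carrier_mat l l" "a < l"
  shows "(\<Sum>b<l. eval_word l E (Word w) $$ (a, b) * f b) = act l E w f a"
  using assms
proof (induction w arbitrary: a)
  case Nil
  have "(\<Sum>b<l. eval_word l E (Word []) $$ (a, b) * f b) = (\<Sum>b<l. if b = a then f a else 0)"
    by (intro sum.cong) (use Nil in \<open>auto simp: eval_word_def\<close>)
  thus ?case using Nil by simp
next
  case (Cons x w)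
  have E: "E x \<in> carrier_mat l l" and M: "eval_word l E (Word w) \<in> carrier_mat l l"
    using Cons.prems by (auto intro: eval_word_carrier)
  have entry: "eval_word l E (Word (x # w)) $$ (a, b) = (\<Sum>c<l. E x $$ (a, c) * eval_word l E (Word w) $$ (c, b))"
    if "b < l" for b
  proof -
    have "eval_word l E (Word (x # w)) = E x * eval_word l E (Word w)" by (simp add: eval_word_def)
    thus ?thesis using E M that Cons.prems(2)
      by (auto simp: scalar_prod_def lessThan_atLeast0 intro!: sum.cong)
  qed
  have "(\<Sum>b<l. eval_word l E (Word (x # w)) $$ (a, b) * f b) =
      (\<Sum>b<l. \<Sum>c<l. E x $$ (a, c) * (eval_word l E (Word w) $$ (c, b) * f b))"
    by (intro sum.cong refl) (simp add: entry sum_distrib_right mult.assoc)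
  also have "\<dots> = (\<Sum>c<l. E x $$ (a, c) * (\<Sum>b<l. eval_word l E (Word w) $$ (c, b) * f b))"
    unfolding sum_distrib_left by (rule sum.swap)
  also have "\<dots> = act l E (x # w) f a" using Cons by simp
  finally show ?case .
qed

lemma act_adjoint:
  assumes "\<And>x a b. x \<in> set w \<Longrightarrow> a < l \<Longrightarrow> b < l \<Longrightarrow> cnj (E x $$ (a, b)) = E x $$ (b, a)"
  shows "(\<Sum>a<l. cnj (f a) * act l E w g a) = (\<Sum>a<l. cnj (act l E (rev w) f a) * g a)"
  using assms
proof (induction w arbitrary: f)
  case (Cons x w)
  have "(\<Sum>a<l. cnj (f a) * act l E (x # w) g a) = (\<Sum>a<l. \<Sum>b<l. cnj (f a) * E x $$ (a, b) * act l E w g b)"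
    by (simp add: sum_distrib_left mult.assoc)
  also have "\<dots> = (\<Sum>b<l. \<Sum>a<l. cnj (f a) * E x $$ (a, b) * act l E w g b)" by (rule sum.swap)
  also have "\<dots> = (\<Sum>b<l. cnj (act l E [x] f b) * act l E w g b)"
    using Cons.prems by (intro sum.cong refl) (simp add: sum_distrib_left mult_ac)
  also have "\<dots> = (\<Sum>a<l. cnj (act l E (rev w) (act l E [x] f) a) * g a)"
    by (rule Cons.IH) (use Cons.prems in auto)
  also have "\<dots> = (\<Sum>a<l. cnj (act l E (rev (x # w)) f a) * g a)" by (simp add: act_append)
  finally show ?case .
qed simp

lemma psd_mat_iff:
  "psd_mat l A \<longleftrightarrow> A \<in> carrier_mat l l \<and> psd {..<l} (\<lambda>a b. A $$ (a, b))"
proof -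
  have eq: "(A *\<^sub>v v) \<bullet>c v = hform {..<l} (\<lambda>a b. A $$ (a, b)) (vec_index v) (vec_index v)"
    if "A \<in> carrier_mat l l" "v \<in> carrier_vec l" for v
    using that unfolding hform_def
    by (auto simp: scalar_prod_def lessThan_atLeast0 sum_distrib_left sum_distrib_right mult_ac intro!: sum.cong)
  show ?thesis
  proof (intro iffI conjI)
    assume L: "psd_mat l A"
    show A: "A \<in> carrier_mat l l" using L by (simp add: psd_mat_def)
    show "psd {..<l} (\<lambda>a b. A $$ (a, b))"
      unfolding psd_def
    proof
      fix f :: "nat \<Rightarrow> complex"
      have "hform {..<l} (\<lambda>a b. A $$ (a, b)) f f = (A *\<^sub>v Matrix.vec l f) \<bullet>c Matrix.vec l f"
        unfolding eq[OF A vec_carrier] by (rule hform_cong) auto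
      thus "0 \<le> hform {..<l} (\<lambda>a b. A $$ (a, b)) f f" using L by (simp add: psd_mat_def)
    qed
  next
    assume R: "A \<in> carrier_mat l l \<and> psd {..<l} (\<lambda>a b. A $$ (a, b))"
    thus "psd_mat l A" unfolding psd_mat_def using eq psdD by auto
  qed
qed

definition vector_functional :: "nat \<Rightarrow> (nat \<times> nat \<Rightarrow> complex mat) \<Rightarrow> (nat \<Rightarrow> nat \<Rightarrow> complex) \<Rightarrow> word \<Rightarrow> nat \<Rightarrow> nat \<Rightarrow> complex" where
  "vector_functional l E \<xi> w a b =
    (\<Sum>\<alpha><l. \<Sum>\<beta><l. cnj (\<xi> a \<alpha>) * eval_word l E (Word w) $$ (\<alpha>, \<beta>) * \<xi> b \<beta>)"

text \<open>
  The space is that of polynomials of degree at most $d$ with the inner product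
  $\langle f, g\rangle = \varphi(f^*g)$. The effect of an outcome is not multiplication
  by $y_x$, which would raise the degree, but the operator of the form $\varphi(f^*y_xg)$, that is,
  multiplication followed by the projection to degree at most $d$. Such compressions of a
  measurement form a measurement again. They act as multiplication on degree less than $d$, so a
  word of length at most $d$ applied to the vector $1$ gives the word itself. A word of length up to
  $2d+1$ is a product $u^* y_x v$ of two such words and a letter, whose moment is a matrix entry of the
  effect of \<open>x\<close>.
\<close>

lemma truncated_gns:
  assumes N: "N \<ge> 1"
    and pos: "\<And>x. x \<in> outcomes m n \<Longrightarrow> psd (words m n d \<times> {..<N}) (moment_kernel n \<phi> x)"
    and def: "definite (words m n d \<times> {..<N}) (gram_kernel \<phi>)"
  obtains l E \<xi> where "l \<ge> 1" "E \<in> povm_tuples m n l"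
    "\<And>w a b. w \<in> words m n (2 * d + 1) \<Longrightarrow> a < N \<Longrightarrow> b < N \<Longrightarrow>
      \<phi> w a b = vector_functional l E \<xi> w a b"
proof -
  define S where "S = words m n d \<times> {..<N}"
  define l where "l = card S"
  let ?B = "gram_kernel \<phi>" and ?A = "moment_kernel n \<phi>"
  have fin: "finite S" by (simp add: S_def finite_words)
  have "([], 0) \<in> S" using N by (simp add: S_def)
  hence l: "l \<ge> 1" unfolding l_def using fin by (metis One_nat_def Suc_leI card_gt_0_iff empty_iff)
  obtain q :: "nat \<Rightarrow> word \<times> nat \<Rightarrow> complex"
    where orth: "\<And>j k. j < l \<Longrightarrow> k < l \<Longrightarrow> hform S ?B (q j) (q k) = (if j = k then 1 else 0)"
      and exp: "\<And>f s. s \<in> S \<Longrightarrow> f s = (\<Sum>k<l. hform S ?B (q k) f * q k s)"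
    using definite_orthonormal_basis[OF fin def[folded S_def]] unfolding l_def by blast
  define co where "co f k = hform S ?B (q k) f" for f k
  \<comment> \<open>In the orthonormal basis \<open>q\<close> of the space of polynomials, \<open>co f\<close> is the coordinate vector of \<open>f\<close>, and
    \<open>E x\<close> is the matrix of the form of the outcome \<open>x\<close>.\<close>
  define E where "E x = mat l l (\<lambda>(a, b). hform S (?A x) (q a) (q b))" for x
  have E_entry: "E x $$ (a, b) = hform S (?A x) (q a) (q b)" if "a < l" "b < l" for x a b
    using that by (simp add: E_def)
  have right: "hform S K g f = (\<Sum>k<l. hform S K g (q k) * co f k)" for K f g
  proof -
    have "hform S K g f = hform S K g (\<lambda>s. \<Sum>k<l. co f k * q k s)"
      by (rule hform_cong) (use exp in \<open>auto simp: co_def\<close>)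
    thus ?thesis unfolding hform_sum_right hform_scale_right by (simp add: mult.commute)
  qed
  have left: "hform S K f g = (\<Sum>k<l. cnj (co f k) * hform S K (q k) g)" for K f g
  proof -
    have "hform S K f g = hform S K (\<lambda>s. \<Sum>k<l. co f k * q k s) g"
      by (rule hform_cong) (use exp in \<open>auto simp: co_def\<close>)
    thus ?thesis unfolding hform_sum_left hform_scale_left .
  qed
  have E_right: "(\<Sum>b<l. E x $$ (a, b) * co f b) = hform S (?A x) (q a) f" if "a < l" for x a f
    unfolding right[of _ _ f] by (intro sum.cong refl) (use that in \<open>simp add: E_entry\<close>)
  have parseval: "(\<Sum>a<l. cnj (co f a) * co g a) = hform S ?B f g" for f g
    unfolding left[of _ f] co_def ..
  have E_form: "hform {..<l} (\<lambda>a b. E x $$ (a, b)) c c =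
      hform S (?A x) (\<lambda>s. \<Sum>k<l. c k * q k s) (\<lambda>s. \<Sum>k<l. c k * q k s)" for x c
    unfolding hform_sum_left hform_sum_right hform_scale_left hform_scale_right
    by (subst hform_def) (simp add: E_entry sum_distrib_left sum_distrib_right mult_ac)
  have E_psd: "psd {..<l} (\<lambda>a b. E x $$ (a, b))" if "x \<in> outcomes m n" for x
    unfolding psd_def E_form using pos[OF that] by (simp add: S_def psd_def)
  have E_sum: "(\<Sum>j\<in>{0..n i - 1}. E (i, j) $$ (a, b)) = (if a = b then 1 else 0)" if "a < l" "b < l" for i a b
    unfolding orth[OF that, symmetric] E_entry[OF that] hform_kernel_sum[symmetric] moment_kernel_partition ..
  have povm: "E \<in> povm_tuples m n l"
    unfolding povm_tuples_def mem_Collect_eq psd_mat_iff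
  proof (intro conjI ballI)
    fix i assume i: "i \<in> {1..m}"
    show "E (i, j) \<in> carrier_mat l l" for j by (simp add: E_def)
    show "psd {..<l} (\<lambda>a b. E (i, j) $$ (a, b))" if "j \<in> {1..n i - 1}" for j
      by (rule E_psd) (use i that in \<open>auto simp: outcomes_def\<close>)
    let ?C = "1\<^sub>m l - mat l l (\<lambda>(a, b). \<Sum>j\<in>{1..n i - 1}. E (i, j) $$ (a, b))"
    show "?C \<in> carrier_mat l l" by (intro minus_carrier_mat mat_carrier)
    have ins: "{0..n i - 1} = insert 0 {1..n i - 1}" by auto
    have "?C $$ (a, b) = E (i, 0) $$ (a, b)" if "a < l" "b < l" for a b
      using E_sum[OF that, of i] that unfolding ins by (auto simp: algebra_simps)
    hence "psd {..<l} (\<lambda>a b. ?C $$ (a, b)) \<longleftrightarrow> psd {..<l} (\<lambda>a b. E (i, 0) $$ (a, b))"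
      by (intro psd_cong) auto
    thus "psd {..<l} (\<lambda>a b. ?C $$ (a, b))" using E_psd[of "(i, 0)"] i by (auto simp: outcomes_def)
  qed
  have E_carrier: "E x \<in> carrier_mat l l" for x by (simp add: E_def)
  have E_herm: "cnj (E x $$ (a, b)) = E x $$ (b, a)" if "x \<in> outcomes m n" "a < l" "b < l" for x a b
    using psd_hermitian[OF E_psd[OF that(1)]] that(2,3) by (simp add: hermitian_def)
  define \<xi> where "\<xi> a = co (dirac ([], a))" for a
  \<comment> \<open>Below the top degree the compression acts as multiplication by the variable.\<close>
  have step: "hform S (?A x) f (dirac (v, b)) = hform S ?B f (dirac (x # v, b))"
    if "x \<in> indices m n" "x # v \<in> words m n d" "b < N" for x v b f
  proof -
    have "(v, b) \<in> S" "(x # v, b) \<in> S" "snd x \<noteq> 0"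
      using that by (auto simp: S_def words_def indices_def)
    thus ?thesis by (simp add: hform_dirac fin moment_kernel_def gram_kernel_def weighted_def)
  qed
  have reach: "act l E w (\<xi> b) a = co (dirac (w, b)) a" if "w \<in> words m n d" "b < N" "a < l" for w a b
    using that
  proof (induction w arbitrary: a)
    case (Cons x w)
    have x: "x \<in> indices m n" and w: "w \<in> words m n d" using Cons.prems by (auto simp: words_def)
    have "act l E (x # w) (\<xi> b) a = (\<Sum>c<l. E x $$ (a, c) * co (dirac (w, b)) c)"
      using Cons.IH[OF w Cons.prems(2)] by simp
    also have "\<dots> = co (dirac (x # w, b)) a"
      unfolding E_right[OF Cons.prems(3)] step[OF x Cons.prems(1,2)] by (simp only: co_def)
    finally show ?case .
  qed (simp add: \<xi>_def)
  have entry: "(\<Sum>a<l. cnj (\<xi> a' a) * act l E w (\<xi> b) a) = \<phi> w a' b"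
    if w: "w \<in> words m n (2 * d + 1)" and a': "a' < N" and b: "b < N" for w a' b
  proof (cases "length w \<le> d")
    case True
    hence "w \<in> words m n d" using w by (simp add: words_def)
    moreover have "hform S ?B (dirac ([], a')) (dirac (w, b)) = ?B ([], a') (w, b)"
      by (rule hform_dirac_dirac) (use calculation a' b fin in \<open>auto simp: S_def\<close>)
    ultimately show ?thesis using reach[of w b] b
      by (simp add: \<xi>_def parseval) (simp add: gram_kernel_def)
  next
    case False
    \<comment> \<open>The last \<open>d\<close> letters act on the vector, the letter before them is an effect between two vectors, and the
      remaining at most \<open>d\<close> letters are moved to the other side.\<close>
    define u where "u = take (length w - Suc d) w"
    define x where "x = w ! (length w - Suc d)"
    define v where "v = drop (length w - d) w"
    have w_eq: "w = u @ x # v"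
      using False id_take_nth_drop[of "length w - Suc d" w] by (simp add: u_def x_def v_def Suc_diff_Suc)
    have u: "rev u \<in> words m n d" and v: "v \<in> words m n d" and x: "x \<in> indices m n"
    proof -
      have "set u \<subseteq> set w" "set v \<subseteq> set w" "x \<in> set w"
        using set_take_subset set_drop_subset False by (simp_all add: u_def v_def x_def)
      thus "rev u \<in> words m n d" "v \<in> words m n d" "x \<in> indices m n"
        using w False by (auto simp: words_def u_def v_def)
    qed
    have x': "x \<in> outcomes m n" "snd x \<noteq> 0" using x indices_subset_outcomes by (auto simp: indices_def)
    have "set u \<subseteq> outcomes m n" using u indices_subset_outcomes by (auto simp: words_def)
    hence "(\<Sum>a<l. cnj (\<xi> a' a) * act l E w (\<xi> b) a) =
        (\<Sum>a<l. cnj (act l E (rev u) (\<xi> a') a) * act l E (x # v) (\<xi> b) a)"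
      unfolding w_eq act_append by (intro act_adjoint E_herm) auto
    also have "\<dots> = (\<Sum>a<l. cnj (co (dirac (rev u, a')) a) * hform S (?A x) (q a) (dirac (v, b)))"
      by (intro sum.cong refl) (use reach[OF u a'] reach[OF v b] in \<open>simp add: E_right\<close>)
    also have "\<dots> = hform S (?A x) (dirac (rev u, a')) (dirac (v, b))" unfolding left[of _ "dirac (rev u, a')"] ..
    also have "\<dots> = ?A x (rev u, a') (v, b)"
      by (rule hform_dirac_dirac) (use u v a' b fin in \<open>auto simp: S_def\<close>)
    also have "\<dots> = \<phi> w a' b" using x' by (simp add: moment_kernel_def weighted_def w_eq)
    finally show ?thesis .
  qed
  show thesis
  proof (rule that[OF l povm])
    fix w a b assume wab: "w \<in> words m n (2 * d + 1)" "a < N" "b < N"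
    have "(\<Sum>\<alpha><l. \<Sum>\<beta><l. cnj (\<xi> a \<alpha>) * eval_word l E (Word w) $$ (\<alpha>, \<beta>) * \<xi> b \<beta>) =
        (\<Sum>\<alpha><l. cnj (\<xi> a \<alpha>) * (\<Sum>\<beta><l. eval_word l E (Word w) $$ (\<alpha>, \<beta>) * \<xi> b \<beta>))"
      by (simp add: sum_distrib_left mult.assoc)
    also have "\<dots> = (\<Sum>\<alpha><l. cnj (\<xi> a \<alpha>) * act l E w (\<xi> b) \<alpha>)"
      by (intro sum.cong refl) (simp add: eval_word_act[OF E_carrier])
    finally show "\<phi> w a b = vector_functional l E \<xi> w a b"
      using entry[OF wab] by (simp add: vector_functional_def)
  qed
qed

section \<open>Certificates for positive coefficient arrays\<close>

definition pairing ::
  "nat \<Rightarrow> (nat \<Rightarrow> nat) \<Rightarrow> nat \<Rightarrow> nat \<Rightarrow> (word \<Rightarrow> nat \<Rightarrow> nat \<Rightarrow> complex)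
    \<Rightarrow> (word \<Rightarrow> nat \<Rightarrow> nat \<Rightarrow> complex) \<Rightarrow> complex" where
  "pairing m n d N c \<phi> = (\<Sum>w\<in>words m n (2 * d + 1). \<Sum>a<N. \<Sum>b<N. c w a b * \<phi> w a b)"

text \<open>
  Positivity in terms of the array \<open>c\<close> of the scalar coefficients $\langle e_a, P_w e_b\rangle$ of a polynomial: the
  test vectors are $\sum_{a<N} e_a \otimes \xi_a$.
\<close>

definition positive_coeffs ::
  "nat \<Rightarrow> (nat \<Rightarrow> nat) \<Rightarrow> nat \<Rightarrow> (word \<Rightarrow> nat \<Rightarrow> nat \<Rightarrow> complex) \<Rightarrow> bool" where
  "positive_coeffs m n d c \<longleftrightarrow> (\<forall>l\<ge>1. \<forall>E\<in>povm_tuples m n l. \<forall>N \<xi>.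
     0 \<le> pairing m n d N c (vector_functional l E \<xi>))"

text \<open>The coefficient array of the sum of weighted squares with Gram kernels \<open>G x\<close>.\<close>

definition certificate ::
  "nat \<Rightarrow> (nat \<Rightarrow> nat) \<Rightarrow> nat
    \<Rightarrow> (nat \<times> nat \<Rightarrow> word \<times> nat \<Rightarrow> word \<times> nat \<Rightarrow> complex)
    \<Rightarrow> word \<Rightarrow> nat \<Rightarrow> nat \<Rightarrow> complex" where
  "certificate m n d G w a b = (\<Sum>x\<in>outcomes m n. \<Sum>u\<in>words m n d. \<Sum>v\<in>words m n d.
     weighted n (dirac w) u x v * G x (u, a) (v, b))"

definition hermitian_functional :: "(word \<Rightarrow> nat \<Rightarrow> nat \<Rightarrow> complex) \<Rightarrow> bool" where
  "hermitian_functional \<phi> \<longleftrightarrow> (\<forall>w a b. cnj (\<phi> w a b) = \<phi> (rev w) b a)"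

lemma pairing_cong:
  "(\<And>w a b. w \<in> words m n (2 * d + 1) \<Longrightarrow> a < N \<Longrightarrow> b < N \<Longrightarrow> \<phi> w a b = \<phi>' w a b) \<Longrightarrow>
    pairing m n d N c \<phi> = pairing m n d N c \<phi>'"
  unfolding pairing_def by (intro sum.cong refl) auto

lemma pairing_add_right: "pairing m n d N c (\<lambda>w a b. \<phi> w a b + \<phi>' w a b) = pairing m n d N c \<phi> + pairing m n d N c \<phi>'"
  by (simp add: pairing_def distrib_left sum.distrib)

lemma pairing_scale_right: "pairing m n d N c (\<lambda>w a b. z * \<phi> w a b) = z * pairing m n d N c \<phi>"
  by (simp add: pairing_def sum_distrib_left mult_ac)

lemma pairing_add_left: "pairing m n d N (\<lambda>w a b. c w a b + c' w a b) \<phi> = pairing m n d N c \<phi> + pairing m n d N c' \<phi>"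
  by (simp add: pairing_def distrib_right sum.distrib)

lemma pairing_sum_left: "pairing m n d N (\<lambda>w a b. \<Sum>k\<in>A. c k w a b) \<phi> = (\<Sum>k\<in>A. pairing m n d N (c k) \<phi>)"
  by (induction A rule: infinite_finite_induct) (simp_all add: pairing_add_left, simp_all add: pairing_def)

lemma moment_kernel_add:
  "moment_kernel n (\<lambda>w a b. \<phi> w a b + \<phi>' w a b) x s t = moment_kernel n \<phi> x s t + moment_kernel n \<phi>' x s t"
  by (simp add: moment_kernel_def weighted_add)

lemma moment_kernel_scale:
  "moment_kernel n (\<lambda>w a b. z * \<phi> w a b) x s t = z * moment_kernel n \<phi> x s t"
  by (simp add: moment_kernel_def weighted_scale)

lemma hermitian_moment_kernel:
  assumes "hermitian_functional \<phi>"
  shows "hermitian S (moment_kernel n \<phi> x)"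
  unfolding hermitian_def moment_kernel_def
  by (intro ballI weighted_swap) (use assms in \<open>simp add: hermitian_functional_def\<close>)

text \<open>
  A strictly positive Hermitian functional is a vector state of a measurement, so its pairing with \<open>c\<close> is a value of the positive
  polynomial. Definiteness of the Gram form comes from writing it as the sum of the forms of the outcomes
  of the first measurement.
\<close>

lemma strict_pairing_nonneg:
  assumes m: "m \<ge> 1" and N: "N \<ge> 1" and c: "positive_coeffs m n d c" and herm: "hermitian_functional \<phi>"
    and \<epsilon>: "\<epsilon> > 0" and strict: "\<And>x f. x \<in> outcomes m n \<Longrightarrow>
      \<epsilon> * (\<Sum>s\<in>words m n d \<times> {..<N}. (cmod (f s))\<^sup>2) \<le> Re (hform (words m n d \<times> {..<N}) (moment_kernel n \<phi> x) f f)"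
  shows "0 \<le> pairing m n d N c \<phi>"
proof -
  define S where "S = words m n d \<times> {..<N}"
  have fin: "finite S" by (simp add: S_def finite_words)
  note strict = strict[folded S_def]
  have nn: "0 \<le> \<epsilon> * (\<Sum>s\<in>S. (cmod (f s))\<^sup>2)" for f :: "_ \<Rightarrow> complex"
    using \<epsilon> by (intro mult_nonneg_nonneg sum_nonneg) auto
  have nonneg: "0 \<le> Re (hform S (moment_kernel n \<phi> x) f f)" if "x \<in> outcomes m n" for x f
    by (rule order_trans[OF nn strict[OF that]])
  have psd: "psd S (moment_kernel n \<phi> x)" if "x \<in> outcomes m n" for x
    by (rule psdI_Re[OF hermitian_moment_kernel[OF herm] nonneg[OF that]])
  have gram: "hform S (gram_kernel \<phi>) f f = (\<Sum>j\<in>{0..n 1 - 1}. hform S (moment_kernel n \<phi> (1, j)) f f)" for f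
    unfolding moment_kernel_partition[of n \<phi> 1, symmetric] hform_kernel_sum ..
  have out: "(1, j) \<in> outcomes m n" if "j \<in> {0..n 1 - 1}" for j
    using that m by (auto simp: outcomes_def)
  have "definite S (gram_kernel \<phi>)"
    unfolding definite_def psd_def gram
  proof (intro conjI allI impI ballI)
    show "0 \<le> (\<Sum>j\<in>{0..n 1 - 1}. hform S (moment_kernel n \<phi> (1, j)) f f)" for f
      by (intro sum_nonneg psdD psd out)
    fix f s
    assume z: "(\<Sum>j\<in>{0..n 1 - 1}. hform S (moment_kernel n \<phi> (1, j)) f f) = 0" and s: "s \<in> S"
    have "Re (hform S (moment_kernel n \<phi> (1, 0)) f f) \<le> (\<Sum>j\<in>{0..n 1 - 1}. Re (hform S (moment_kernel n \<phi> (1, j)) f f))"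
      by (rule member_le_sum) (use nonneg[OF out] in auto)
    also have "\<dots> = 0" using z by (metis Re_sum zero_complex.sel(1))
    finally have "\<epsilon> * (\<Sum>s\<in>S. (cmod (f s))\<^sup>2) \<le> 0" using strict[OF out[of 0], of f] by simp
    hence "(\<Sum>s\<in>S. (cmod (f s))\<^sup>2) = 0"
      using \<epsilon> nn[of f] by (simp add: mult_le_0_iff zero_le_mult_iff)
    thus "f s = 0" using s fin by (simp add: sum_nonneg_eq_0_iff)
  qed
  from truncated_gns[OF N psd[unfolded S_def] this[unfolded S_def]]
  obtain l E \<xi> where l: "l \<ge> 1" "E \<in> povm_tuples m n l" and \<phi>:
    "\<And>w a b. w \<in> words m n (2 * d + 1) \<Longrightarrow> a < N \<Longrightarrow> b < N \<Longrightarrow>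
      \<phi> w a b = vector_functional l E \<xi> w a b"
    by blast
  have "pairing m n d N c \<phi> = pairing m n d N c (vector_functional l E \<xi>)"
    by (rule pairing_cong) (rule \<phi>)
  thus ?thesis using c l unfolding positive_coeffs_def by simp
qed

lemma hform_moment_kernel_diagonal:
  "hform (W \<times> {..<N}) (moment_kernel n (\<lambda>w a b. if a = b then L w else 0) x) f f
    = (\<Sum>a<N. hform W (\<lambda>u v. weighted n L u x v) (\<lambda>u. f (u, a)) (\<lambda>u. f (u, a)))"
proof -
  have mk: "moment_kernel n (\<lambda>w a b. if a = b then L w else 0) x (u, a) (v, b)
      = (if a = b then weighted n L u x v else 0)" for u a v b
    by (auto simp: moment_kernel_def weighted_def)
  have "hform (W \<times> {..<N}) (moment_kernel n (\<lambda>w a b. if a = b then L w else 0) x) f f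
      = (\<Sum>u\<in>W. \<Sum>a<N. \<Sum>v\<in>W. \<Sum>b<N. if b = a then cnj (f (u, a)) * weighted n L u x v * f (v, a) else 0)"
    unfolding hform_def sum.cartesian_product'
    by (intro sum.cong refl) (auto simp: mk)
  also have "\<dots> = (\<Sum>u\<in>W. \<Sum>a<N. \<Sum>v\<in>W. cnj (f (u, a)) * weighted n L u x v * f (v, a))"
    by (intro sum.cong refl) simp
  also have "\<dots> = (\<Sum>a<N. \<Sum>u\<in>W. \<Sum>v\<in>W. cnj (f (u, a)) * weighted n L u x v * f (v, a))"
    by (rule sum.swap)
  finally show ?thesis by (simp add: hform_def)
qed

text \<open>
  A faithful functional is fixed and tensored with the trace on the coefficient indices. The
  constant \<open>\<kappa>\<close> says that the result is an interior point of the cone of positive functionals.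
\<close>

locale faithful =
  fixes m :: nat and n :: "nat \<Rightarrow> nat" and d :: nat
    and L :: "word \<Rightarrow> complex" and \<kappa> :: real
  assumes m: "m \<ge> 1" and \<kappa>: "\<kappa> > 0" and L_herm: "cnj (L w) = L (rev w)"
    and L_below: "x \<in> outcomes m n \<Longrightarrow>
      \<kappa> * (\<Sum>u\<in>words m n d. (cmod (f u))\<^sup>2) \<le> Re (hform (words m n d) (\<lambda>u v. weighted n L u x v) f f)"
begin

abbreviation "W \<equiv> words m n d"
abbreviation "W2 \<equiv> words m n (2 * d + 1)"

definition trace_functional :: "word \<Rightarrow> nat \<Rightarrow> nat \<Rightarrow> complex" where
  "trace_functional w a b = (if a = b then L w else 0)"

lemma hermitian_trace_functional: "hermitian_functional trace_functional"
  by (simp add: hermitian_functional_def trace_functional_def L_herm)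

lemma trace_functional_below:
  assumes "x \<in> outcomes m n"
  shows "\<kappa> * (\<Sum>s\<in>W \<times> {..<N}. (cmod (f s))\<^sup>2) \<le> Re (hform (W \<times> {..<N}) (moment_kernel n trace_functional x) f f)"
proof -
  have "\<kappa> * (\<Sum>s\<in>W \<times> {..<N}. (cmod (f s))\<^sup>2) = (\<Sum>a<N. \<kappa> * (\<Sum>u\<in>W. (cmod (f (u, a)))\<^sup>2))"
    unfolding sum_distrib_left[symmetric] by (subst sum.swap) (simp add: sum.cartesian_product)
  also have "\<dots> \<le> (\<Sum>a<N. Re (hform W (\<lambda>u v. weighted n L u x v) (\<lambda>u. f (u, a)) (\<lambda>u. f (u, a))))"
    by (intro sum_mono L_below assms)
  finally show ?thesis
    unfolding trace_functional_def[abs_def] hform_moment_kernel_diagonal by simp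
qed

text \<open>
  Positivity forces the coefficients to be Hermitian: every Hermitian functional is a difference
  of strictly positive ones, so it takes a real value.
\<close>

lemma positive_coeffs_hermitian:
  assumes c: "positive_coeffs m n d c" and w: "w \<in> W2"
  shows "c (rev w) b a = cnj (c w a b)"
proof -
  define N where "N = Suc (max a b)"
  let ?S = "W \<times> {..<N}"
  have N: "N \<ge> 1" "a < N" "b < N" by (auto simp: N_def)
  have real: "Im (pairing m n d N c \<phi>) = 0" if herm: "hermitian_functional \<phi>" for \<phi>
  proof -
    define M where "M = (\<Sum>x\<in>outcomes m n. \<Sum>s\<in>?S. \<Sum>t\<in>?S. cmod (moment_kernel n \<phi> x s t))"
    have M: "M \<ge> 0" unfolding M_def by (intro sum_nonneg) auto
    define t where "t = \<kappa> / (2 * (M + 1))"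
    let ?\<psi> = "\<lambda>w a b. trace_functional w a b + of_real t * \<phi> w a b"
    have t: "t > 0" "t * M \<le> \<kappa> / 2" using M \<kappa> by (auto simp: t_def field_simps)
    have "0 \<le> pairing m n d N c ?\<psi>"
    proof (rule strict_pairing_nonneg[OF m N(1) c, of _ "\<kappa> / 2"])
      show "hermitian_functional ?\<psi>"
        using herm hermitian_trace_functional by (simp add: hermitian_functional_def)
      show "\<kappa> / 2 > 0" using \<kappa> by simp
      fix x f assume x: "x \<in> outcomes m n"
      define Q where "Q = (\<Sum>s\<in>?S. (cmod (f s))\<^sup>2)"
      have Q: "Q \<ge> 0" by (simp add: Q_def sum_nonneg)
      have "(\<Sum>s\<in>?S. \<Sum>t\<in>?S. cmod (moment_kernel n \<phi> x s t)) \<le> M"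
        unfolding M_def by (rule member_le_sum) (use x finite_outcomes in \<open>auto intro!: sum_nonneg\<close>)
      hence MQ: "(\<Sum>s\<in>?S. \<Sum>t\<in>?S. cmod (moment_kernel n \<phi> x s t)) * Q \<le> M * Q"
        using Q by (rule mult_right_mono)
      have "cmod (hform ?S (moment_kernel n \<phi> x) f f) \<le> (\<Sum>s\<in>?S. \<Sum>t\<in>?S. cmod (moment_kernel n \<phi> x s t)) * Q"
        unfolding Q_def by (rule hform_bound) (simp add: finite_words)
      also note MQ
      finally have "\<bar>t * Re (hform ?S (moment_kernel n \<phi> x) f f)\<bar> \<le> t * (M * Q)"
        using abs_Re_le_cmod[of "hform ?S (moment_kernel n \<phi> x) f f"] t by (simp add: abs_mult)
      also have "\<dots> \<le> \<kappa> / 2 * Q" using mult_right_mono[OF t(2) Q] by (simp add: mult.assoc)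
      finally have "- (\<kappa> / 2 * Q) \<le> t * Re (hform ?S (moment_kernel n \<phi> x) f f)" by linarith
      moreover have "Re (hform ?S (moment_kernel n ?\<psi> x) f f)
          = Re (hform ?S (moment_kernel n trace_functional x) f f) + t * Re (hform ?S (moment_kernel n \<phi> x) f f)"
        unfolding moment_kernel_add[abs_def] moment_kernel_scale[abs_def] hform_kernel_add hform_kernel_scale by simp
      moreover have "\<kappa> * Q \<le> Re (hform ?S (moment_kernel n trace_functional x) f f)"
        unfolding Q_def by (rule trace_functional_below[OF x])
      moreover have "\<kappa> / 2 * Q + \<kappa> / 2 * Q = \<kappa> * Q" by simp
      ultimately show "\<kappa> / 2 * (\<Sum>s\<in>?S. (cmod (f s))\<^sup>2) \<le>
          Re (hform ?S (moment_kernel n ?\<psi> x) f f)"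
        unfolding Q_def[symmetric] by linarith
    qed
    moreover have "0 \<le> pairing m n d N c trace_functional"
      by (rule strict_pairing_nonneg[OF m N(1) c hermitian_trace_functional \<kappa>]) (rule trace_functional_below)
    ultimately show ?thesis
      unfolding pairing_add_right pairing_scale_right using t by (simp add: less_eq_complex_def)
  qed
  have w': "rev w \<in> W2" using w by (simp add: words_def)
  define point where "point w0 a0 b0 z = (\<lambda>w a b. if w = w0 \<and> a = a0 \<and> b = b0 then z else (0::complex))"
    for w0 :: "word" and a0 b0 :: nat and z
  have pairing_point: "pairing m n d N c (point w0 a0 b0 z) = z * c w0 a0 b0"
    if "w0 \<in> W2" "a0 < N" "b0 < N" for w0 a0 b0 z
  proof -
    have "pairing m n d N c (point w0 a0 b0 z) = (\<Sum>w\<in>W2. \<Sum>a<N. \<Sum>b<N.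
        if b = b0 then (if a = a0 then if w = w0 then z * c w a b else 0 else 0) else 0)"
      unfolding pairing_def point_def by (intro sum.cong refl) auto
    thus ?thesis using that by (simp add: finite_words sum.delta cong: if_cong)
  qed
  have cnj_point: "cnj (point w0 a0 b0 z w' a' b') = point (rev w0) b0 a0 (cnj z) (rev w') b' a'"
    for w0 a0 b0 z w' a' b' by (simp add: point_def)
  have "hermitian_functional (\<lambda>w' a' b'. point w a b z w' a' b' + point (rev w) b a (cnj z) w' a' b')" for z
    by (simp add: hermitian_functional_def cnj_point add.commute)
  from real[OF this] have im: "Im (z * c w a b + cnj z * c (rev w) b a) = 0" for z
    unfolding pairing_add_right pairing_point[OF w N(2,3)] pairing_point[OF w' N(3,2)] .
  \<comment> \<open>\<open>z = 1\<close> and \<open>z = \<i>\<close> give the imaginary and the real part of the Hermitian symmetry.\<close>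
  from im[of 1] im[of \<i>] show ?thesis by (simp add: complex_eq_iff)
qed

lemma pairing_certificate:
  "pairing m n d N (certificate m n d G) \<phi> =
    (\<Sum>x\<in>outcomes m n. \<Sum>s\<in>W \<times> {..<N}. \<Sum>t\<in>W \<times> {..<N}. G x s t * moment_kernel n \<phi> x s t)"
proof -
  have summand: "pairing m n d N (\<lambda>w a b. weighted n (dirac w) u x v * G x (u, a) (v, b)) \<phi>
      = (\<Sum>a<N. \<Sum>b<N. G x (u, a) (v, b) * moment_kernel n \<phi> x (u, a) (v, b))"
    if "x \<in> outcomes m n" "u \<in> W" "v \<in> W" for x u v
  proof -
    let ?t = "\<lambda>w a b. weighted n (dirac w) u x v * G x (u, a) (v, b) * \<phi> w a b"
    have "(\<Sum>w\<in>W2. \<Sum>a<N. \<Sum>b<N. ?t w a b) = (\<Sum>a<N. \<Sum>w\<in>W2. \<Sum>b<N. ?t w a b)" by (rule sum.swap)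
    also have "\<dots> = (\<Sum>a<N. \<Sum>b<N. \<Sum>w\<in>W2. ?t w a b)" by (rule sum.cong[OF refl]) (rule sum.swap)
    also have "\<dots> = (\<Sum>a<N. \<Sum>b<N. G x (u, a) (v, b) * moment_kernel n \<phi> x (u, a) (v, b))"
      unfolding moment_kernel_def fst_conv snd_conv
      by (intro sum.cong refl, subst weighted_expand[OF that(2,3,1)]) (simp add: sum_distrib_left mult_ac)
    finally show ?thesis unfolding pairing_def .
  qed
  have "pairing m n d N (certificate m n d G) \<phi> = (\<Sum>x\<in>outcomes m n. \<Sum>u\<in>W. \<Sum>v\<in>W.
      pairing m n d N (\<lambda>w a b. weighted n (dirac w) u x v * G x (u, a) (v, b)) \<phi>)"
    unfolding certificate_def[abs_def] pairing_sum_left ..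
  also have "\<dots> = (\<Sum>x\<in>outcomes m n. \<Sum>u\<in>W. \<Sum>v\<in>W. \<Sum>a<N. \<Sum>b<N. G x (u, a) (v, b) * moment_kernel n \<phi> x (u, a) (v, b))"
    by (intro sum.cong refl summand)
  also have "\<dots> = (\<Sum>x\<in>outcomes m n. \<Sum>u\<in>W. \<Sum>a<N. \<Sum>v\<in>W. \<Sum>b<N. G x (u, a) (v, b) * moment_kernel n \<phi> x (u, a) (v, b))"
    by (rule sum.cong[OF refl], rule sum.cong[OF refl]) (rule sum.swap)
  finally show ?thesis by (simp add: sum.cartesian_product')
qed

lemma certificate_hermitian:
  assumes "\<And>x. x \<in> outcomes m n \<Longrightarrow> hermitian (W \<times> {..<N}) (G x)" "a < N" "b < N"
  shows "cnj (certificate m n d G w a b) = certificate m n d G (rev w) b a"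
proof -
  have "cnj (certificate m n d G w a b) = (\<Sum>x\<in>outcomes m n. \<Sum>u\<in>W. \<Sum>v\<in>W. weighted n (dirac (rev w)) v x u * G x (v, b) (u, a))"
    unfolding certificate_def cnj_sum complex_cnj_mult
  proof (intro sum.cong refl arg_cong2[of _ _ _ _ "(*)"])
    fix x u v assume "x \<in> outcomes m n" "u \<in> W" "v \<in> W"
    thus "cnj (G x (u, a) (v, b)) = G x (v, b) (u, a)"
      using assms by (simp add: hermitian_def)
    show "cnj (weighted n (dirac w) u x v) = weighted n (dirac (rev w)) v x u"
      by (rule weighted_swap) auto
  qed
  also have "\<dots> = certificate m n d G (rev w) b a"
    unfolding certificate_def by (rule sum.cong[OF refl]) (rule sum.swap)
  finally show ?thesis .
qed

lemma certificate_cong: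
  assumes "\<And>x u v. x \<in> outcomes m n \<Longrightarrow> u \<in> W \<Longrightarrow> v \<in> W \<Longrightarrow> G x (u, a) (v, b) = G' x (u, a) (v, b)"
  shows "certificate m n d G w a b = certificate m n d G' w a b"
  unfolding certificate_def by (intro sum.cong refl) (simp add: assms)

text \<open>
  A functional separating the coefficients from the certificates would be positive, hence, after
  adding a small multiple of the faithful one, a vector state of a measurement; this contradicts
  positivity of the coefficients. The separating functional is replaced by its Hermitian part, whose
  values are the real parts of the original ones because all arrays in question are Hermitian.
\<close>

lemma approximate_certificate:
  assumes c: "positive_coeffs m n d c" and \<epsilon>: "\<epsilon> > 0"
  obtains G where "\<And>x. x \<in> outcomes m n \<Longrightarrow> psd (W \<times> {..<N}) (G x)"
    "\<And>w a b. w \<in> W2 \<Longrightarrow> a < N \<Longrightarrow> b < N \<Longrightarrow> cmod (c w a b - certificate m n d G w a b) < \<epsilon>"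
proof -
  define S where "S = W \<times> {..<N}"
  have fin: "finite S" by (simp add: S_def finite_words)
  define T where "T = W2 \<times> {..<N} \<times> {..<N}"
  have finT: "finite T" by (simp add: T_def finite_words)
  let ?array = "\<lambda>G (w, a, b). certificate m n d G w a b"
  define good where "good G \<longleftrightarrow> (\<forall>x\<in>outcomes m n. psd S (G x))" for G
  define C where "C = {?array G | G. good G}"
  have "\<exists>G. good G \<and> (\<forall>w\<in>W2. \<forall>a<N. \<forall>b<N. cmod (c w a b - certificate m n d G w a b) < \<epsilon>)"
  proof (rule ccontr)
    assume contra: "\<not> ?thesis"
    have far: "\<exists>t\<in>T. \<epsilon> \<le> cmod ((\<lambda>(w, a, b). c w a b) t - e t)" if "e \<in> C" for e
    proof -
      from that obtain G where G: "good G" "e = ?array G" by (auto simp: C_def)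
      with contra obtain w a b where "w \<in> W2" "a < N" "b < N" "\<not> cmod (c w a b - certificate m n d G w a b) < \<epsilon>" by blast
      thus ?thesis unfolding G T_def by (intro bexI[of _ "(w, a, b)"]) auto
    qed
    have C_zero: "(\<lambda>_. 0) \<in> C"
      unfolding C_def by (rule CollectI, rule exI[of _ "\<lambda>_ _ _. 0"])
        (auto simp: good_def psd_def hform_def certificate_def)
    have C_add: "(\<lambda>t. e t + e' t) \<in> C" if e: "e \<in> C" "e' \<in> C" for e e'
    proof -
      from e obtain G G' where G: "good G" "e = ?array G"
        "good G'" "e' = (\<lambda>(w, a, b). certificate m n d G' w a b)" by (auto simp: C_def)
      have "good (\<lambda>x s t. G x s t + G' x s t)"
        using G by (simp add: good_def psd_def hform_kernel_add)
      moreover have "(\<lambda>t. e t + e' t) = (\<lambda>(w, a, b). certificate m n d (\<lambda>x s t. G x s t + G' x s t) w a b)"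
        by (auto simp: G fun_eq_iff certificate_def distrib_left sum.distrib)
      ultimately show ?thesis unfolding C_def by blast
    qed
    have C_scale: "(\<lambda>t. of_real r * e t) \<in> C" if r: "0 \<le> r" and e: "e \<in> C" for r e
    proof -
      from e obtain G where G: "good G" "e = ?array G" by (auto simp: C_def)
      have "good (\<lambda>x s t. of_real r * G x s t)"
        using G r by (simp add: good_def psd_def hform_kernel_scale less_eq_complex_def)
      moreover have "(\<lambda>t. of_real r * e t) = (\<lambda>(w, a, b). certificate m n d (\<lambda>x s t. of_real r * G x s t) w a b)"
        by (auto simp: G fun_eq_iff certificate_def sum_distrib_left mult_ac)
      ultimately show ?thesis unfolding C_def by blast
    qed
    obtain \<Lambda> where pos: "\<And>e. e \<in> C \<Longrightarrow> 0 \<le> Re (\<Sum>t\<in>T. \<Lambda> t * e t)"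
      and neg: "Re (\<Sum>t\<in>T. \<Lambda> t * (\<lambda>(w, a, b). c w a b) t) < 0"
      by (rule cone_approximation_or_separation[OF finT C_zero C_add C_scale \<epsilon> far]) blast+
    have "T \<noteq> {}" using neg by auto
    hence N: "N \<ge> 1" by (auto simp: T_def)
    define \<phi> where "\<phi> w a b = (\<Lambda> (w, a, b) + cnj (\<Lambda> (rev w, b, a))) / 2" for w a b
    have \<phi>_herm: "hermitian_functional \<phi>" by (simp add: hermitian_functional_def \<phi>_def add.commute)
    have \<phi>_pairing: "pairing m n d N r \<phi> = of_real (Re (\<Sum>t\<in>T. \<Lambda> t * (\<lambda>(w, a, b). r w a b) t))"
      if r: "\<And>w a b. w \<in> W2 \<Longrightarrow> a < N \<Longrightarrow> b < N \<Longrightarrow> cnj (r w a b) = r (rev w) b a" for r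
    proof -
      let ?Z = "\<Sum>t\<in>T. \<Lambda> t * (\<lambda>(w, a, b). r w a b) t"
      have refl: "(\<Sum>t\<in>T. (\<lambda>(w, a, b). cnj (\<Lambda> (rev w, b, a)) * r w a b) t) = cnj ?Z"
        unfolding cnj_sum
        by (rule sum.reindex_bij_witness[of _ "\<lambda>(w, a, b). (rev w, b, a)" "\<lambda>(w, a, b). (rev w, b, a)"])
          (auto simp: T_def words_def r)
      have "pairing m n d N r \<phi> = (\<Sum>t\<in>T. (\<lambda>(w, a, b). r w a b * \<phi> w a b) t)"
        unfolding pairing_def T_def by (simp add: sum.cartesian_product)
      also have "\<dots> = (\<Sum>t\<in>T. (\<Lambda> t * (\<lambda>(w, a, b). r w a b) t + (\<lambda>(w, a, b). cnj (\<Lambda> (rev w, b, a)) * r w a b) t) / 2)"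
        by (intro sum.cong refl) (auto simp: \<phi>_def algebra_simps)
      also have "\<dots> = (?Z + cnj ?Z) / 2"
        unfolding sum_divide_distrib[symmetric] sum.distrib refl ..
      finally show ?thesis unfolding complex_add_cnj by simp
    qed
    have \<phi>_psd: "0 \<le> Re (hform S (moment_kernel n \<phi> x) f f)" if x: "x \<in> outcomes m n" for x f
    proof -
      \<comment> \<open>The certificate of the single weighted square with factor \<open>f\<close> at the outcome \<open>x\<close>.\<close>
      define G where "G y s t = (if y = x then cnj (f s) * f t else 0)" for y s t
      have "hform S (\<lambda>s t. cnj (f s) * f t) g g = cnj (\<Sum>t\<in>S. f t * g t) * (\<Sum>t\<in>S. f t * g t)" for g
        unfolding hform_def cnj_sum sum_product by (simp add: mult_ac)
      moreover have "0 \<le> cnj z * z" for z :: complex by (simp add: less_eq_complex_def)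
      ultimately have "psd S (\<lambda>s t. cnj (f s) * f t)" unfolding psd_def by presburger
      moreover have "psd S (\<lambda>_ _. 0)" by (simp add: psd_def hform_def)
      moreover have "G y = (if y = x then (\<lambda>s t. cnj (f s) * f t) else (\<lambda>_ _. 0))" for y
        by (simp add: G_def fun_eq_iff)
      ultimately have "good G" unfolding good_def by presburger
      hence "hermitian S (G y)" if "y \<in> outcomes m n" for y
        using psd_hermitian[OF _ fin] that by (auto simp: good_def)
      hence "pairing m n d N (certificate m n d G) \<phi> =
          of_real (Re (\<Sum>t\<in>T. \<Lambda> t * (?array G) t))"
        unfolding S_def by (intro \<phi>_pairing certificate_hermitian)
      moreover have "0 \<le> Re (\<Sum>t\<in>T. \<Lambda> t * (?array G) t)"
        by (rule pos) (use \<open>good G\<close> in \<open>auto simp: C_def\<close>)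
      moreover have "pairing m n d N (certificate m n d G) \<phi> = hform S (moment_kernel n \<phi> x) f f"
      proof -
        have "pairing m n d N (certificate m n d G) \<phi> =
            (\<Sum>y\<in>outcomes m n. if y = x then hform S (moment_kernel n \<phi> x) f f else 0)"
          unfolding pairing_certificate hform_def S_def[symmetric]
          by (intro sum.cong refl) (simp add: G_def mult_ac)
        thus ?thesis using x finite_outcomes by (simp add: sum.delta)
      qed
      ultimately show ?thesis by simp
    qed
    have shifted: "0 \<le> Re (pairing m n d N c \<phi>) + t * Re (pairing m n d N c trace_functional)" if t: "0 < t" for t
    proof -
      let ?\<psi> = "\<lambda>w a b. \<phi> w a b + of_real t * trace_functional w a b"
      have "0 \<le> pairing m n d N c ?\<psi>"
      proof (rule strict_pairing_nonneg[OF m N c, of _ "t * \<kappa>"])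
        show "hermitian_functional ?\<psi>"
          using \<phi>_herm hermitian_trace_functional by (simp add: hermitian_functional_def)
        show "t * \<kappa> > 0" using t \<kappa> by simp
        fix x f assume x: "x \<in> outcomes m n"
        have "Re (hform S (moment_kernel n ?\<psi> x) f f)
            = Re (hform S (moment_kernel n \<phi> x) f f) + t * Re (hform S (moment_kernel n trace_functional x) f f)"
          unfolding moment_kernel_add[abs_def] moment_kernel_scale[abs_def] hform_kernel_add hform_kernel_scale by simp
        moreover have "t * (\<kappa> * (\<Sum>s\<in>S. (cmod (f s))\<^sup>2)) \<le> t * Re (hform S (moment_kernel n trace_functional x) f f)"
          unfolding S_def using t by (intro mult_left_mono trace_functional_below[OF x]) auto
        ultimately show "t * \<kappa> * (\<Sum>s\<in>W \<times> {..<N}. (cmod (f s))\<^sup>2) \<le>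
            Re (hform (W \<times> {..<N}) (moment_kernel n ?\<psi> x) f f)"
          using \<phi>_psd[OF x, of f] unfolding S_def by (simp add: mult.assoc)
      qed
      thus ?thesis unfolding pairing_add_right pairing_scale_right by (simp add: less_eq_complex_def)
    qed
    have "0 \<le> Re (pairing m n d N c \<phi>)" by (rule nonneg_if_perturbed_nonneg[OF shifted])
    moreover have "pairing m n d N c \<phi> = of_real (Re (\<Sum>t\<in>T. \<Lambda> t * (\<lambda>(w, a, b). c w a b) t))"
      by (rule \<phi>_pairing) (simp add: positive_coeffs_hermitian[OF c])
    ultimately show False using neg by simp
  qed
  thus thesis using that unfolding good_def S_def by blast
qed

text \<open>
  The faithful functional controls the size of a certificate by its value: pairing the kernels with
  the forms \<open>L(f\<^sup>* y\<^sub>x f) - \<kappa> \<parallel>f\<parallel>\<^sup>2\<close> gives a nonnegative number. This is the compactness that lets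
  certificates converge. The vector \<open>h\<close> compresses the coefficients to scalars.
\<close>

lemma certificate_bound:
  assumes G: "\<And>x. x \<in> outcomes m n \<Longrightarrow> psd (W \<times> {..<N}) (G x)"
    and x: "x \<in> outcomes m n" and u: "u \<in> W"
  shows "\<kappa> * Re (hform {..<N} (\<lambda>a b. G x (u, a) (u, b)) h h)
    \<le> Re (\<Sum>w\<in>W2. L w * hform {..<N} (certificate m n d G w) h h)"
proof -
  let ?\<phi> = "\<lambda>w a b. L w * (cnj (h a) * h b)"
  define Gh where "Gh x u v = hform {..<N} (\<lambda>a b. G x (u, a) (v, b)) h h" for x u v
  have Gh_psd: "psd W (Gh x)" if "x \<in> outcomes m n" for x
    unfolding psd_def
  proof
    fix f :: "word \<Rightarrow> complex"
    let ?g = "\<lambda>s. f (fst s) * h (snd s)"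
    have "hform W (Gh x) f f = (\<Sum>u\<in>W. \<Sum>v\<in>W. \<Sum>a<N. \<Sum>b<N. cnj (?g (u, a)) * G x (u, a) (v, b) * ?g (v, b))"
      unfolding Gh_def hform_def by (simp add: sum_distrib_left sum_distrib_right mult_ac)
    also have "\<dots> = (\<Sum>u\<in>W. \<Sum>a<N. \<Sum>v\<in>W. \<Sum>b<N. cnj (?g (u, a)) * G x (u, a) (v, b) * ?g (v, b))"
      by (rule sum.cong[OF refl]) (rule sum.swap)
    also have "\<dots> = hform (W \<times> {..<N}) (G x) ?g ?g"
      unfolding hform_def by (simp add: sum.cartesian_product')
    finally show "0 \<le> hform W (Gh x) f f" using psdD[OF G[OF that], of ?g] by simp
  qed
  have diag: "0 \<le> Re (Gh x u u)" if "x \<in> outcomes m n" "u \<in> W" for x u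
    using psd_diag[OF Gh_psd[OF that(1)] finite_words that(2)] by (simp add: less_eq_complex_def)
  have below: "\<kappa> * (\<Sum>u\<in>W. Re (Gh x u u)) \<le> Re (\<Sum>u\<in>W. \<Sum>v\<in>W. Gh x u v * weighted n L u x v)"
    if x: "x \<in> outcomes m n" for x
  proof -
    let ?K = "\<lambda>u v. weighted n L u x v + (- 1) * (if u = v then of_real \<kappa> else 0)"
    have "psd W ?K"
    proof (rule psdI_Re)
      show "hermitian W ?K"
        using weighted_swap[of L L, OF L_herm] by (auto simp: hermitian_def)
      show "0 \<le> Re (hform W ?K f f)" for f
        unfolding hform_kernel_add hform_kernel_scale hform_id[OF finite_words]
          sum_cnj_mult_self
        using L_below[OF x, of f] by simp
    qed
    from psd_pairing[OF finite_words Gh_psd[OF x] this]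
    have "0 \<le> (\<Sum>u\<in>W. \<Sum>v\<in>W. Gh x u v * ?K u v)" .
    also have "\<dots> = (\<Sum>u\<in>W. \<Sum>v\<in>W. Gh x u v * weighted n L u x v) - (\<Sum>u\<in>W. \<Sum>v\<in>W. if v = u then of_real \<kappa> * Gh x u u else 0)"
      unfolding sum_subtractf[symmetric] by (intro sum.cong refl) (auto simp: algebra_simps)
    also have "(\<Sum>u\<in>W. \<Sum>v\<in>W. if v = u then of_real \<kappa> * Gh x u u else 0) = of_real \<kappa> * (\<Sum>u\<in>W. Gh x u u)"
      by (simp add: finite_words sum_distrib_left)
    finally show ?thesis by (simp add: less_eq_complex_def)
  qed
  have "(\<Sum>w\<in>W2. L w * hform {..<N} (certificate m n d G w) h h)
      = pairing m n d N (certificate m n d G) ?\<phi>"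
    unfolding pairing_def hform_def by (simp add: sum_distrib_left mult_ac)
  also have "\<dots> = (\<Sum>x\<in>outcomes m n. \<Sum>u\<in>W. \<Sum>v\<in>W. Gh x u v * weighted n L u x v)"
    unfolding pairing_certificate
  proof (rule sum.cong[OF refl])
    fix x
    have mk: "moment_kernel n ?\<phi> x (u, a) (v, b)
        = cnj (h a) * h b * weighted n L u x v" for u a v b
      unfolding moment_kernel_def using weighted_scale[of n "cnj (h a) * h b" L u x v] by (simp add: mult.commute)
    have "(\<Sum>s\<in>W \<times> {..<N}. \<Sum>t\<in>W \<times> {..<N}. G x s t * moment_kernel n ?\<phi> x s t)
        = (\<Sum>u\<in>W. \<Sum>a<N. \<Sum>v\<in>W. \<Sum>b<N. G x (u, a) (v, b) * (cnj (h a) * h b * weighted n L u x v))"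
      by (simp add: sum.cartesian_product' mk)
    also have "\<dots> = (\<Sum>u\<in>W. \<Sum>v\<in>W. \<Sum>a<N. \<Sum>b<N. G x (u, a) (v, b) * (cnj (h a) * h b * weighted n L u x v))"
      by (rule sum.cong[OF refl]) (rule sum.swap)
    also have "\<dots> = (\<Sum>u\<in>W. \<Sum>v\<in>W. Gh x u v * weighted n L u x v)"
      unfolding Gh_def hform_def by (simp add: sum_distrib_left sum_distrib_right mult_ac)
    finally show "(\<Sum>s\<in>W \<times> {..<N}. \<Sum>t\<in>W \<times> {..<N}. G x s t * moment_kernel n ?\<phi> x s t)
        = (\<Sum>u\<in>W. \<Sum>v\<in>W. Gh x u v * weighted n L u x v)" .
  qed
  finally have eq: "(\<Sum>w\<in>W2. L w * hform {..<N} (certificate m n d G w) h h)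
      = (\<Sum>x\<in>outcomes m n. \<Sum>u\<in>W. \<Sum>v\<in>W. Gh x u v * weighted n L u x v)" .
  have "Re (Gh x u u) \<le> (\<Sum>u\<in>W. Re (Gh x u u))"
    by (rule member_le_sum) (use x u diag finite_words in auto)
  also have "\<dots> \<le> (\<Sum>x\<in>outcomes m n. \<Sum>u\<in>W. Re (Gh x u u))"
    by (rule member_le_sum[of x _ "\<lambda>x. \<Sum>u\<in>W. Re (Gh x u u)"]) (use x diag finite_outcomes in \<open>auto intro!: sum_nonneg\<close>)
  finally have "\<kappa> * Re (Gh x u u) \<le> (\<Sum>x\<in>outcomes m n. \<kappa> * (\<Sum>u\<in>W. Re (Gh x u u)))"
    unfolding sum_distrib_left[of \<kappa>, symmetric] using \<kappa> by simp
  also have "\<dots> \<le> (\<Sum>x\<in>outcomes m n. Re (\<Sum>u\<in>W. \<Sum>v\<in>W. Gh x u v * weighted n L u x v))"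
    by (intro sum_mono below)
  finally show ?thesis unfolding eq Gh_def by simp
qed

end

lemma psd_limit:
  assumes "\<And>k. psd S (K k)" "\<And>s t. s \<in> S \<Longrightarrow> t \<in> S \<Longrightarrow> (\<lambda>k. K k s t) \<longlonglongrightarrow> K' s t"
  shows "psd S K'"
  unfolding psd_def
proof
  fix f
  have lim: "(\<lambda>k. hform S (K k) f f) \<longlonglongrightarrow> hform S K' f f"
    by (intro hform_tendsto tendsto_const assms(2))
  have nonneg: "0 \<le> hform S (K k) f f" for k by (rule psdD[OF assms(1)])
  have "0 \<le> Re (hform S K' f f)"
    by (rule LIMSEQ_le_const[OF tendsto_Re[OF lim]]) (use nonneg in \<open>auto simp: less_eq_complex_def\<close>)
  moreover have "(\<lambda>k. Im (hform S (K k) f f)) = (\<lambda>k. 0)"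
    using nonneg by (simp add: less_eq_complex_def)
  hence "Im (hform S K' f f) = 0" using tendsto_Im[OF lim] by (simp add: LIMSEQ_const_iff)
  ultimately show "0 \<le> hform S K' f f" by (simp add: less_eq_complex_def)
qed

context faithful
begin

text \<open>
  Approximate certificates for the first \<open>k + 1\<close> basis vectors, extended by zero, are bounded entrywise: on the
  diagonal by \<open>certificate_bound\<close>, elsewhere by the Cauchy--Schwarz inequality for positive kernels. Every
  coefficient of a certificate is a finite combination of entries, so it passes to the limit.
\<close>

lemma exact_certificate:
  assumes c: "positive_coeffs m n d c"
  obtains G where "\<And>x S. finite S \<Longrightarrow> psd S (G x)"
    "\<And>w a b. w \<in> W2 \<Longrightarrow> certificate m n d G w a b = c w a b"
proof -
  define S where "S k = W \<times> {..<Suc k}" for k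
  have finS: "finite (S k)" for k by (simp add: S_def finite_words)
  have "\<exists>G. (\<forall>x\<in>outcomes m n. psd (S k) (G x)) \<and>
      (\<forall>w\<in>W2. \<forall>a<Suc k. \<forall>b<Suc k. cmod (c w a b - certificate m n d G w a b) < inverse (real (Suc k)))" for k
    by (rule approximate_certificate[OF c, of "inverse (real (Suc k))" "Suc k"]) (simp, unfold S_def, blast)
  then obtain G0 where G0: "\<And>k x. x \<in> outcomes m n \<Longrightarrow> psd (S k) (G0 k x)"
    and close0: "\<And>k w a b. w \<in> W2 \<Longrightarrow> a < Suc k \<Longrightarrow> b < Suc k \<Longrightarrow>
      cmod (c w a b - certificate m n d (G0 k) w a b) < inverse (real (Suc k))"
    by metis
  define G1 where "G1 k x s t = (if s \<in> S k \<and> t \<in> S k then if x \<in> outcomes m n then G0 k x s t else 0 else 0)" for k x s t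
  have G1: "psd T (G1 k x)" if "finite T" for k x T
  proof -
    have "psd (S k) (\<lambda>s t. if x \<in> outcomes m n then G0 k x s t else 0)"
      using G0[of x k] by (cases "x \<in> outcomes m n") (simp_all add: psd_def hform_def)
    from psd_extend_zero[OF this finS that] show ?thesis by (simp add: G1_def[abs_def])
  qed
  have close: "cmod (c w a b - certificate m n d (G1 k) w a b) < inverse (real (Suc k))"
    if "w \<in> W2" "a < Suc k" "b < Suc k" for k w a b
  proof -
    have "certificate m n d (G1 k) w a b = certificate m n d (G0 k) w a b"
      by (rule certificate_cong) (use that in \<open>auto simp: G1_def S_def\<close>)
    thus ?thesis using close0[OF that] by simp
  qed
  define B where "B a = (\<Sum>w\<in>W2. cmod (L w) * (cmod (c w a a) + 1)) / \<kappa>" for a :: nat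
  have B_pos: "0 \<le> B a" for a unfolding B_def using \<kappa> by (auto intro!: divide_nonneg_pos sum_nonneg)
  have diag: "Re (G1 k x s s) \<le> B (snd s)" for k x s
  proof (cases "x \<in> outcomes m n \<and> s \<in> S k")
    case True
    obtain u a where s: "s = (u, a)" by force
    have ua: "u \<in> W" "a < Suc k" using True by (auto simp: s S_def)
    have "\<kappa> * Re (hform {..<Suc k} (\<lambda>a b. G1 k x (u, a) (u, b)) (dirac a) (dirac a))
        \<le> Re (\<Sum>w\<in>W2. L w * hform {..<Suc k} (certificate m n d (G1 k) w) (dirac a) (dirac a))"
      by (rule certificate_bound[OF G1]) (use True ua finite_words in auto)
    hence "\<kappa> * Re (G1 k x s s) \<le> Re (\<Sum>w\<in>W2. L w * certificate m n d (G1 k) w a a)"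
      using ua by (simp add: hform_dirac_dirac s)
    also have "\<dots> \<le> cmod (\<Sum>w\<in>W2. L w * certificate m n d (G1 k) w a a)" by (rule complex_Re_le_cmod)
    also have "\<dots> \<le> (\<Sum>w\<in>W2. cmod (L w) * (cmod (c w a a) + 1))"
    proof (rule sum_norm_le)
      fix w assume "w \<in> W2"
      hence "cmod (c w a a - certificate m n d (G1 k) w a a) \<le> 1"
        using close[of w a k a] ua le_imp_inverse_le[of 1 "real (Suc k)"] by simp
      hence "cmod (certificate m n d (G1 k) w a a) \<le> cmod (c w a a) + 1"
        using norm_triangle_ineq3[of "c w a a" "certificate m n d (G1 k) w a a"] by simp
      thus "cmod (L w * certificate m n d (G1 k) w a a) \<le> cmod (L w) * (cmod (c w a a) + 1)"
        unfolding norm_mult by (rule mult_left_mono) simp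
    qed
    finally show ?thesis using \<kappa> by (simp add: B_def s field_simps)
  next
    case False
    hence "G1 k x s s = 0" by (auto simp: G1_def)
    thus ?thesis using B_pos by simp
  qed
  have bound: "cmod (G1 k x s t) \<le> sqrt (B (snd s) * B (snd t))" for k x s t
  proof (rule real_le_rsqrt)
    have fin: "finite {s, t}" by simp
    have "0 \<le> Re (G1 k x r r)" if "r \<in> {s, t}" for r
      using psd_diag[OF G1[OF fin] fin that, of k x] by (simp add: less_eq_complex_def)
    hence "Re (G1 k x s s) * Re (G1 k x t t) \<le> B (snd s) * B (snd t)"
      by (intro mult_mono diag B_pos) auto
    thus "(cmod (G1 k x s t))\<^sup>2 \<le> B (snd s) * B (snd t)"
      using psd_cauchy[OF G1[OF fin] fin, of s t k x] by simp
  qed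
  define X where "X k = (\<lambda>(x, s, t). G1 k x s t)" for k
  have "cmod (X k y) \<le> (\<lambda>(x, s, t). sqrt (B (snd s) * B (snd t))) y" for k y
    using bound by (auto simp: X_def split: prod.split)
  from pointwise_bounded_subseq[of X, OF this]
  obtain r l where r: "strict_mono r" and "\<And>y. (\<lambda>k. X (r k) y) \<longlonglongrightarrow> l y" by metis
  hence lim: "(\<lambda>k. G1 (r k) x s t) \<longlonglongrightarrow> l (x, s, t)" for x s t
    by (simp add: X_def split_def) (metis fst_conv snd_conv)
  define G where "G x s t = l (x, s, t)" for x s t
  show thesis
  proof (rule that[of G])
    show "psd T (G x)" if "finite T" for x T
      by (rule psd_limit[of T "\<lambda>k. G1 (r k) x"]) (simp_all add: G1[OF that] G_def lim)
    fix w a b assume w: "w \<in> W2"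
    have "(\<lambda>k. certificate m n d (G1 (r k)) w a b) \<longlonglongrightarrow> certificate m n d G w a b"
      unfolding certificate_def G_def by (intro tendsto_intros lim)
    moreover have "(\<lambda>k. certificate m n d (G1 (r k)) w a b) \<longlonglongrightarrow> c w a b"
    proof (rule Lim_transform_eventually)
      have "(\<lambda>k. c w a b - certificate m n d (G1 (r k)) w a b) \<longlonglongrightarrow> 0"
      proof (rule Lim_null_comparison)
        show "(\<lambda>k. inverse (real (Suc (r k)))) \<longlonglongrightarrow> 0"
          using LIMSEQ_subseq_LIMSEQ[OF LIMSEQ_inverse_real_of_nat r] by (simp add: o_def)
        have "max a b < Suc (r k)" if "k \<ge> max a b" for k
          using seq_suble[OF r, of k] that by linarith
        thus "\<forall>\<^sub>F k in sequentially. cmod (c w a b - certificate m n d (G1 (r k)) w a b) \<le> inverse (real (Suc (r k)))"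
          by (intro eventually_sequentiallyI[of "max a b"] less_imp_le close w) auto
      qed
      from tendsto_diff[OF tendsto_const[of "c w a b"] this]
      show "(\<lambda>k. c w a b - (c w a b - certificate m n d (G1 (r k)) w a b)) \<longlonglongrightarrow> c w a b" by simp
    qed simp
    ultimately show "certificate m n d G w a b = c w a b" by (rule LIMSEQ_unique)
  qed
qed

end

section \<open>Orthonormal bases of separable Hilbert spaces\<close>

lemma cinner_add_left: "cinner (x + y) z = cinner x z + cinner y (z::'a::complex_inner)"
  by (metis cinner_add_right cinner_commute complex_cnj_add)

lemma cinner_scaleC_left: "cinner (c *\<^sub>C x) y = cnj c * cinner x (y::'a::complex_inner)"
  by (metis cinner_commute cinner_scaleC_right complex_cnj_mult)

lemma additive_cinner_right: "Modules.additive (\<lambda>y. cinner x (y::'a::complex_inner))"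
  by (simp add: Modules.additive_def cinner_add_right)

lemma additive_cinner_left: "Modules.additive (\<lambda>x. cinner x (y::'a::complex_inner))"
  by (simp add: Modules.additive_def cinner_add_left)

lemmas cinner_zero_right [simp] = Modules.additive.zero[OF additive_cinner_right]
lemmas cinner_zero_left [simp] = Modules.additive.zero[OF additive_cinner_left]
lemmas cinner_diff_right = Modules.additive.diff[OF additive_cinner_right]
lemmas cinner_sum_right = Modules.additive.sum[OF additive_cinner_right]
lemmas cinner_sum_left = Modules.additive.sum[OF additive_cinner_left]

lemma cinner_self: "cinner x (x::'a::complex_inner) = of_real ((norm x)\<^sup>2)"
proof -
  have "Im (cinner x x) = 0" using cinner_commute[of x x] by (metis cnj.sel(2) equal_neg_zero)
  thus ?thesis by (simp add: complex_eq_iff inner_eq_Re_cinner[symmetric] power2_norm_eq_inner)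
qed

lemma cinner_ext:
  assumes "\<And>x. cinner x u = cinner x (v::'a::complex_inner)"
  shows "u = v"
proof -
  have "cinner (u - v) (u - v) = 0" by (simp only: cinner_diff_right assms diff_self)
  thus ?thesis by (simp add: cinner_self)
qed

lemma mult_cnj_cmod: "z * cnj z = (of_real (cmod z))\<^sup>2" "cnj z * z = (of_real (cmod z))\<^sup>2"
  using complex_norm_square[of z] by (simp_all add: mult.commute)

lemma norm_scaleC: "norm (c *\<^sub>C x) = cmod c * norm (x::'a::complex_inner)"
proof -
  have "cinner (c *\<^sub>C x) (c *\<^sub>C x) = (cnj c * c) * cinner x x"
    by (simp add: cinner_scaleC_left cinner_scaleC_right)
  hence "complex_of_real ((norm (c *\<^sub>C x))\<^sup>2) = of_real ((cmod c * norm x)\<^sup>2)"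
    unfolding cinner_self by (simp add: mult_cnj_cmod power_mult_distrib)
  hence "(norm (c *\<^sub>C x))\<^sup>2 = (cmod c * norm x)\<^sup>2" by (simp only: of_real_eq_iff)
  thus ?thesis by (simp add: power2_eq_iff_nonneg)
qed

lemma cinner_Cauchy_Schwarz: "cmod (cinner x y) \<le> norm x * norm (y::'a::complex_inner)"
proof (cases "cinner x y = 0")
  case False
  define c where "c = cnj (cinner x y) / of_real (cmod (cinner x y))"
  have "cmod c = 1" using False by (simp add: c_def norm_divide)
  have "of_real (cmod (cinner x y)) = cinner x (c *\<^sub>C y)"
    using False complex_norm_square[of "cinner x y"]
    by (simp add: cinner_scaleC_right c_def field_simps power2_eq_square)
  hence "cmod (cinner x y) = inner x (c *\<^sub>C y)"
    by (metis Re_complex_of_real inner_eq_Re_cinner)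
  also have "\<dots> \<le> norm x * norm (c *\<^sub>C y)" by (rule norm_cauchy_schwarz)
  finally show ?thesis using \<open>cmod c = 1\<close> by (simp add: norm_scaleC)
qed simp

lemma scaleC_scaleR: "c *\<^sub>C (r *\<^sub>R x) = r *\<^sub>R (c *\<^sub>C (x::'a::complex_inner))"
  by (metis mult.commute scaleC_complex_of_real scaleC_scaleC)

lemma cinner_scaleR: "cinner x (r *\<^sub>R y) = r *\<^sub>R cinner x (y::'a::complex_inner)"
  by (metis cinner_scaleC_right scaleC_complex_of_real scaleR_conv_of_real)

lemma bounded_linear_cinner_right: "bounded_linear (\<lambda>y. cinner x (y::'a::complex_inner))"
  by (rule bounded_linear_intro[of _ "norm x"])
    (simp_all add: cinner_add_right cinner_scaleR, metis cinner_Cauchy_Schwarz mult.commute)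

lemma bounded_linear_scaleC_right: "bounded_linear (\<lambda>y. c *\<^sub>C (y::'a::complex_inner))"
  by (rule bounded_linear_intro[of _ "cmod c"])
    (simp_all add: scaleC_add_right scaleC_scaleR norm_scaleC mult.commute)

lemmas tendsto_cinner_right = bounded_linear.tendsto[OF bounded_linear_cinner_right]
lemmas tendsto_scaleC = bounded_linear.tendsto[OF bounded_linear_scaleC_right]

lemma tendsto_cinner_left:
  assumes "(f \<longlongrightarrow> x) F"
  shows "((\<lambda>k. cinner (f k) (y::'a::complex_inner)) \<longlongrightarrow> cinner x y) F"
  using tendsto_cnj[OF tendsto_cinner_right[OF assms, of y]] by (simp add: cinner_commute[symmetric])

text \<open>
  Zero vectors are admitted so that Gram--Schmidt needs no thinning and finite-dimensional spaces
  have a basis indexed by all natural numbers, too.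
\<close>

definition orthonormal_or_zero :: "(nat \<Rightarrow> 'h::complex_inner) \<Rightarrow> bool" where
  "orthonormal_or_zero e \<longleftrightarrow> (\<forall>j k. cinner (e j) (e k) = (if j = k \<and> e k \<noteq> 0 then 1 else 0))"

lemma cinner_orthonormal_sum:
  fixes e :: "nat \<Rightarrow> 'h::complex_inner"
  assumes "\<And>j k. j < N \<Longrightarrow> k < N \<Longrightarrow> cinner (e j) (e k) = (if j = k \<and> e k \<noteq> 0 then 1 else 0)" "j < N"
  shows "cinner (e j) (\<Sum>k<N. c k *\<^sub>C e k) = (if e j \<noteq> 0 then c j else 0)"
proof -
  have "cinner (e j) (\<Sum>k<N. c k *\<^sub>C e k) = (\<Sum>k<N. if k = j then (if e j \<noteq> 0 then c j else 0) else 0)"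
    unfolding cinner_sum_right cinner_scaleC_right by (intro sum.cong refl) (use assms in auto)
  thus ?thesis unfolding sum.delta[OF finite_lessThan] using assms(2) by simp
qed

lemma norm_orthonormal_sum:
  assumes "orthonormal_or_zero (e :: nat \<Rightarrow> 'h::complex_inner)"
  shows "(norm (\<Sum>k<N. c k *\<^sub>C e k))\<^sup>2 = (\<Sum>k<N. if e k \<noteq> 0 then (cmod (c k))\<^sup>2 else 0)"
proof -
  have "complex_of_real ((norm (\<Sum>k<N. c k *\<^sub>C e k))\<^sup>2) = (\<Sum>k<N. cnj (c k) * (if e k \<noteq> 0 then c k else 0))"
    unfolding cinner_self[symmetric]
    by (subst cinner_sum_left, intro sum.cong refl, unfold cinner_scaleC_left, subst cinner_orthonormal_sum)
      (use assms in \<open>auto simp: orthonormal_or_zero_def\<close>)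
  also have "\<dots> = of_real (\<Sum>k<N. if e k \<noteq> 0 then (cmod (c k))\<^sup>2 else 0)"
    unfolding of_real_sum by (intro sum.cong refl) (simp add: mult_cnj_cmod)
  finally show ?thesis by (simp only: of_real_eq_iff)
qed

lemma bessel:
  assumes "orthonormal_or_zero (e :: nat \<Rightarrow> 'h::complex_inner)"
  shows "(\<Sum>k<N. (cmod (cinner (e k) h))\<^sup>2) \<le> (norm h)\<^sup>2"
    and "(norm (\<Sum>k<N. cinner (e k) h *\<^sub>C e k))\<^sup>2 \<le> (norm h)\<^sup>2"
proof -
  let ?P = "\<Sum>k<N. cinner (e k) h *\<^sub>C e k" and ?s = "\<Sum>k<N. (cmod (cinner (e k) h))\<^sup>2"
  have nP: "(norm ?P)\<^sup>2 = ?s"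
    unfolding norm_orthonormal_sum[OF assms] by (intro sum.cong) auto
  have "cinner ?P h = of_real ?s"
    unfolding cinner_sum_left cinner_scaleC_left of_real_sum
    by (intro sum.cong refl) (simp add: mult_cnj_cmod)
  hence "inner ?P h = ?s" by (simp add: inner_eq_Re_cinner)
  hence "0 \<le> (norm h)\<^sup>2 - ?s"
    using inner_ge_zero[of "h - ?P"] nP
    by (simp add: inner_diff_left inner_diff_right inner_commute power2_norm_eq_inner)
  thus "?s \<le> (norm h)\<^sup>2" "(norm ?P)\<^sup>2 \<le> (norm h)\<^sup>2" unfolding nP by simp_all
qed

text \<open>
  Gram--Schmidt on a dense sequence. The projections \<open>P N\<close> are contractions and fix \<open>x k\<close> for \<open>k < N\<close>, so
  in the limit \<open>P N h\<close> is at most twice as far from \<open>h\<close> as any member of the sequence.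
\<close>

lemma orthonormal_basis_exists:
  assumes "separable_space (euclidean :: 'h::chilbert_space topology)"
  obtains e :: "nat \<Rightarrow> 'h::chilbert_space" where "orthonormal_or_zero e"
    "\<And>h. (\<lambda>N. \<Sum>k<N. cinner (e k) h *\<^sub>C e k) \<longlonglongrightarrow> h"
proof -
  obtain D :: "'h set" where D: "countable D" "closure D = UNIV"
    using assms unfolding separable_space_def by (auto simp: euclidean_closure_of)
  have "D \<noteq> {}" using D(2) by auto
  then obtain x :: "nat \<Rightarrow> 'h" where x: "range x = D" using D(1) uncountable_def by metis
  define nrm :: "'h \<Rightarrow> 'h" where "nrm v = inverse (norm v) *\<^sub>R v" for v
  \<comment> \<open>\<open>P k\<close> is the projection to the span of the first \<open>k\<close> vectors; the recursion runs over the projections because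
    the next basis vector is determined by the projection alone.\<close>
  define P where "P = rec_nat (\<lambda>_. 0) (\<lambda>k Q h. Q h + cinner (nrm (x k - Q (x k))) h *\<^sub>C nrm (x k - Q (x k)))"
  define r where "r k = x k - P k (x k)" for k
  define e where "e k = nrm (r k)" for k
  have P: "P N h = (\<Sum>k<N. cinner (e k) h *\<^sub>C e k)" for N h
    by (induction N) (simp_all add: P_def e_def r_def)
  have e_eq: "e k = of_real (inverse (norm (r k))) *\<^sub>C r k" for k
    unfolding e_def nrm_def scaleC_complex_of_real ..
  have e_self: "cinner (e k) (e k) = (if e k \<noteq> 0 then 1 else 0)" for k
    by (simp add: cinner_self e_def nrm_def)
  have orth: "\<forall>j<N. \<forall>k<N. cinner (e j) (e k) = (if j = k \<and> e k \<noteq> 0 then 1 else 0)" for N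
  proof (induction N)
    case (Suc N)
    have z: "cinner (e j) (e N) = 0" if "j < N" for j
    proof -
      have "cinner (e j) (P N (x N)) = cinner (e j) (x N)"
        unfolding P by (subst cinner_orthonormal_sum) (use Suc that in auto)
      thus ?thesis unfolding e_eq[of N] by (simp add: cinner_scaleC_right r_def cinner_diff_right)
    qed
    have z': "cinner (e N) (e j) = 0" if "j < N" for j
      using z[OF that] cinner_commute[of "e N" "e j"] by simp
    show ?case using Suc e_self z z' by (auto simp: less_Suc_eq)
  qed simp
  have orth': "cinner (e j) (e k) = (if j = k \<and> e k \<noteq> 0 then 1 else 0)" for j k
    using orth[of "Suc (max j k)"] by simp
  have e: "orthonormal_or_zero e" using orth' by (simp add: orthonormal_or_zero_def)
  have eP: "cinner (e k) (P N h) = 0" if "N \<le> k" for N k h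
    unfolding P cinner_sum_right cinner_scaleC_right using that by (intro sum.neutral) (auto simp: orth')
  have own: "P (Suc k) (x k) = x k" for k
  proof -
    have "cinner (e k) (x k) = cinner (e k) (r k)" by (simp add: r_def cinner_diff_right eP)
    also have "\<dots> = of_real (norm (r k))"
      unfolding e_eq cinner_scaleC_left cinner_self by (cases "r k = 0") (simp_all add: power2_eq_square)
    finally have "cinner (e k) (x k) *\<^sub>C e k = norm (r k) *\<^sub>R e k"
      by (simp only: scaleC_complex_of_real)
    also have "\<dots> = r k" by (cases "r k = 0") (simp_all add: e_def nrm_def)
    finally have "cinner (e k) (x k) *\<^sub>C e k = r k" .
    thus ?thesis unfolding P sum.lessThan_Suc unfolding P[symmetric] by (simp add: r_def)
  qed
  have fixed: "P N (x k) = x k" if "N > k" for N k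
    using that
  proof (induction N)
    case (Suc N)
    show ?case
    proof (cases "N = k")
      case False
      hence N: "k < N" using Suc by simp
      hence "cinner (e N) (x k) = 0" using eP[of "Suc k" N "x k"] own[of k] by simp
      hence "P (Suc N) (x k) = P N (x k)" by (simp add: P scaleC_complex_of_real[of 0, simplified])
      thus ?thesis using Suc.IH[OF N] by simp
    qed (simp add: own)
  qed simp
  have P_diff: "P N (h - h') = P N h - P N h'" for N h h'
  proof -
    have "(a - b) *\<^sub>C v = a *\<^sub>C v - b *\<^sub>C v" for a b and v :: 'h
      using scaleC_add_left[of "a - b" b v] by simp
    thus ?thesis by (simp add: P cinner_diff_right sum_subtractf)
  qed
  have P_norm: "norm (P N h) \<le> norm h" for N h
    using bessel(2)[OF e, where N=N and h=h] unfolding P[symmetric] by (simp add: power2_le_iff_abs_le)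
  have "(\<lambda>N. P N h) \<longlonglongrightarrow> h" for h
  proof (rule LIMSEQ_I)
    fix \<epsilon> :: real assume "\<epsilon> > 0"
    hence "\<epsilon> / 2 > 0" "h \<in> closure D" using D(2) by simp_all
    then obtain y where "y \<in> D" "dist y h < \<epsilon> / 2" unfolding closure_approachable by blast
    then obtain k where k: "dist (x k) h < \<epsilon> / 2" using x by blast
    have "norm (P N h - h) < \<epsilon>" if N: "N > k" for N
    proof -
      have eq: "P N h - h = P N (h - x k) + (x k - h)" by (simp add: P_diff fixed[OF N])
      have "norm (P N h - h) \<le> norm (P N (h - x k)) + norm (x k - h)"
        unfolding eq by (rule norm_triangle_ineq)
      also have "\<dots> \<le> norm (h - x k) + norm (x k - h)" using P_norm[of N "h - x k"] by simp
      finally have "norm (P N h - h) \<le> norm (h - x k) + norm (x k - h)" .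
      thus ?thesis using k by (simp add: dist_norm norm_minus_commute)
    qed
    thus "\<exists>N0. \<forall>N\<ge>N0. norm (P N h - h) < \<epsilon>" by (intro exI[of _ "Suc k"]) auto
  qed
  thus thesis using that[of e] e unfolding P by blast
qed

locale hilbert_basis =
  fixes e :: "nat \<Rightarrow> 'h::chilbert_space"
  assumes orth: "orthonormal_or_zero e"
    and total: "(\<lambda>N. \<Sum>k<N. cinner (e k) h *\<^sub>C e k) \<longlonglongrightarrow> h"
begin

lemma cinner_basis: "cinner (e j) (e k) = (if j = k \<and> e k \<noteq> 0 then 1 else 0)"
  using orth by (simp add: orthonormal_or_zero_def)

lemma independent_basis:
  "\<not> module.dependent (scaleC :: complex \<Rightarrow> 'h \<Rightarrow> 'h) (e ` {k. e k \<noteq> 0})"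
proof -
  interpret vector_space "scaleC :: complex \<Rightarrow> 'h \<Rightarrow> 'h" by (rule complex_vector_space)
  show ?thesis
    unfolding dependent_explicit
  proof clarify
    fix t u v assume t: "finite t" "t \<subseteq> e ` {k. e k \<noteq> 0}" "(\<Sum>v\<in>t. u v *\<^sub>C v) = 0" "v \<in> t" "u v \<noteq> 0"
    have *: "cinner v w = (if w = v then 1 else 0)" if w: "w \<in> t" for w
    proof -
      obtain j k where "v = e j" "e j \<noteq> 0" "w = e k" "e k \<noteq> 0" using t w by blast
      moreover from this have "j = k" if "w = v" using that cinner_basis[of j k] cinner_basis[of j j] by (auto split: if_splits)
      ultimately show ?thesis by (auto simp: cinner_basis)
    qed
    have "0 = cinner v (\<Sum>w\<in>t. u w *\<^sub>C w)" unfolding t(3) by simp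
    also have "\<dots> = (\<Sum>w\<in>t. if w = v then u v else 0)"
      unfolding cinner_sum_right cinner_scaleC_right by (intro sum.cong refl) (simp add: *)
    also have "\<dots> = u v" using t by simp
    finally show False using t(5) by simp
  qed
qed

lemma inj_on_basis: "inj_on e {k. e k \<noteq> 0}"
proof (rule inj_onI)
  fix j k assume jk: "j \<in> {k. e k \<noteq> 0}" "k \<in> {k. e k \<noteq> 0}" "e j = e k"
  hence "cinner (e j) (e k) = 1" using cinner_basis[of j j] by simp
  thus "j = k" using cinner_basis[of j k] by (simp split: if_splits)
qed

lemma cfinite_dim_iff: "cfinite_dim TYPE('h) \<longleftrightarrow> finite {k. e k \<noteq> 0}"
proof
  assume "cfinite_dim TYPE('h)"
  then obtain B :: "'h set" where "finite_dimensional_vector_space (scaleC :: complex \<Rightarrow> 'h \<Rightarrow> 'h) B"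
    unfolding cfinite_dim_def by blast
  then interpret finite_dimensional_vector_space "scaleC :: complex \<Rightarrow> 'h \<Rightarrow> 'h" B .
  have "finite (e ` {k. e k \<noteq> 0})" by (rule finiteI_independent[OF independent_basis])
  thus "finite {k. e k \<noteq> 0}" by (rule finite_imageD[OF _ inj_on_basis])
next
  assume fin: "finite {k. e k \<noteq> 0}"
  interpret vector_space "scaleC :: complex \<Rightarrow> 'h \<Rightarrow> 'h" by (rule complex_vector_space)
  have "h \<in> span (e ` {k. e k \<noteq> 0})" for h
  proof -
    obtain M where M: "\<forall>k\<in>{k. e k \<noteq> 0}. k < M"
      using fin unfolding finite_nat_set_iff_bounded by blast
    have vanish: "e k = 0" if "M \<le> k" for k using M that leD by blast
    have "(\<lambda>N. \<Sum>k<N. cinner (e k) h *\<^sub>C e k) \<longlonglongrightarrow> (\<Sum>k<M. cinner (e k) h *\<^sub>C e k)"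
    proof (rule tendsto_eventually, rule eventually_sequentiallyI[of M])
      fix N assume "M \<le> N"
      show "(\<Sum>k<N. cinner (e k) h *\<^sub>C e k) = (\<Sum>k<M. cinner (e k) h *\<^sub>C e k)"
        by (rule sum.mono_neutral_right) (use \<open>M \<le> N\<close> vanish in \<open>auto simp: scaleC_zero_right\<close>)
    qed
    hence h: "h = (\<Sum>k<M. cinner (e k) h *\<^sub>C e k)" by (rule LIMSEQ_unique[OF total])
    have "cinner (e k) h *\<^sub>C e k \<in> span (e ` {k. e k \<noteq> 0})" for k
      by (cases "e k = 0") (simp add: span_zero, rule span_scale, rule span_base, simp)
    hence "(\<Sum>k<M. cinner (e k) h *\<^sub>C e k) \<in> span (e ` {k. e k \<noteq> 0})" by (intro span_sum)
    thus ?thesis unfolding h[symmetric] .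
  qed
  hence "span (e ` {k. e k \<noteq> 0}) = UNIV" by blast
  hence "finite_dimensional_vector_space (scaleC :: complex \<Rightarrow> 'h \<Rightarrow> 'h) (e ` {k. e k \<noteq> 0})"
    by unfold_locales (rule finite_imageI[OF fin], rule independent_basis)
  thus "cfinite_dim TYPE('h)" unfolding cfinite_dim_def by blast
qed

text \<open>
  The hypothesis on \<open>t\<close> says that it is the sequence of columns of a bounded operator. With the basis
  itself as \<open>t\<close> this is the Riesz--Fischer theorem.
\<close>

lemma square_summable_convergent:
  assumes t: "\<And>N h. (norm (\<Sum>a<N. h a *\<^sub>C t a))\<^sup>2 \<le> C * (\<Sum>a<N. (cmod (h a))\<^sup>2)" and "C \<ge> 0"
    and c: "\<And>N. (\<Sum>a<N. (cmod (c a))\<^sup>2) \<le> K"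
  shows "convergent (\<lambda>N. \<Sum>a<N. c a *\<^sub>C (t a :: 'h))"
proof -
  let ?s = "\<lambda>N. \<Sum>a<N. (cmod (c a))\<^sup>2" and ?S = "\<lambda>N. \<Sum>a<N. c a *\<^sub>C t a"
  have inc: "(norm (?S N - ?S M))\<^sup>2 \<le> C * (?s N - ?s M)" if "M \<le> N" for M N
  proof -
    let ?h = "\<lambda>a. if a < M then 0 else c a"
    have split: "?S N = ?S M + (\<Sum>a=M..<N. c a *\<^sub>C t a)" "?s N = ?s M + (\<Sum>a=M..<N. (cmod (c a))\<^sup>2)"
      using sum.atLeastLessThan_concat[of 0 M N "\<lambda>a. c a *\<^sub>C t a"]
        sum.atLeastLessThan_concat[of 0 M N "\<lambda>a. (cmod (c a))\<^sup>2"] that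
      by (simp_all add: lessThan_atLeast0)
    have 1: "(\<Sum>a<N. ?h a *\<^sub>C t a) = (\<Sum>a=M..<N. c a *\<^sub>C t a)"
      by (rule sum.mono_neutral_cong_right) (auto simp: scaleC_complex_of_real[of 0, simplified])
    have 2: "(\<Sum>a<N. (cmod (?h a))\<^sup>2) = (\<Sum>a=M..<N. (cmod (c a))\<^sup>2)"
      by (rule sum.mono_neutral_cong_right) auto
    have "?S N - ?S M = (\<Sum>a=M..<N. c a *\<^sub>C t a)" "?s N - ?s M = (\<Sum>a=M..<N. (cmod (c a))\<^sup>2)"
      unfolding split by (rule add_diff_cancel_left')+
    thus ?thesis using t[of ?h N] by (simp only: 1 2)
  qed
  have "convergent ?s"
  proof (rule Bseq_mono_convergent)
    show "Bseq ?s" by (rule BseqI'[of _ K]) (use c in \<open>simp add: sum_nonneg\<close>)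
    show "\<forall>M. \<forall>N\<ge>M. ?s M \<le> ?s N" by (intro allI impI sum_mono2) auto
  qed
  hence cau: "Cauchy ?s" by (rule convergent_Cauchy)
  have "Cauchy ?S"
  proof (rule CauchyI')
    fix \<epsilon> :: real assume \<epsilon>: "\<epsilon> > 0"
    define \<delta> where "\<delta> = \<epsilon>\<^sup>2 / (C + 1)"
    have \<delta>_pos: "\<delta> > 0" using \<epsilon> \<open>C \<ge> 0\<close> by (simp add: \<delta>_def)
    moreover have "(C + 1) * \<delta> = \<epsilon>\<^sup>2" using \<open>C \<ge> 0\<close> by (simp add: \<delta>_def)
    ultimately have \<delta>: "C * \<delta> < \<epsilon>\<^sup>2" by (simp add: distrib_right)
    obtain M0 where M0: "\<And>M N. M \<ge> M0 \<Longrightarrow> N \<ge> M0 \<Longrightarrow> norm (?s M - ?s N) < \<delta>"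
      using CauchyD[OF cau \<delta>_pos] by blast
    have "dist (?S M) (?S N) < \<epsilon>" if "M \<ge> M0" "N > M" for M N
    proof -
      have "(norm (?S N - ?S M))\<^sup>2 \<le> C * (?s N - ?s M)" by (rule inc) (use that in simp)
      also have "\<dots> \<le> C * \<delta>" using M0[of N M] that \<open>C \<ge> 0\<close> by (intro mult_left_mono) auto
      also note \<delta>
      finally have "norm (?S N - ?S M) < \<epsilon>" by (rule power_less_imp_less_base) (use \<epsilon> in simp)
      thus ?thesis unfolding dist_norm by (subst norm_minus_commute)
    qed
    thus "\<exists>M. \<forall>m\<ge>M. \<forall>n>m. dist (?S m) (?S n) < \<epsilon>" by blast
  qed
  thus ?thesis by (simp add: Cauchy_convergent_iff)
qed

lemma norm_basis_sum: "(norm (\<Sum>a<N. h a *\<^sub>C e a))\<^sup>2 \<le> 1 * (\<Sum>a<N. (cmod (h a))\<^sup>2)"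
  unfolding norm_orthonormal_sum[OF orth] by (simp add: sum_mono)

lemma operator_from_columns:
  assumes t: "\<And>N h. (norm (\<Sum>a<N. h a *\<^sub>C t a))\<^sup>2 \<le> C * (\<Sum>a<N. (cmod (h a))\<^sup>2)" and C: "C \<ge> 0"
    and zero: "\<And>a. e a = 0 \<Longrightarrow> t a = 0"
  obtains F :: "'h bop" where "\<And>a. bop_apply F (e a) = t a"
proof -
  let ?S = "\<lambda>h N. \<Sum>a<N. cinner (e a) h *\<^sub>C t a"
  define F where "F h = lim (?S h)" for h
  have lim: "?S h \<longlonglongrightarrow> F h" for h
    unfolding F_def using square_summable_convergent[OF t C bessel(1)[OF orth]] by (simp add: convergent_LIMSEQ_iff)
  have add: "F (g + h) = F g + F h" for g h
  proof (rule LIMSEQ_unique[OF lim])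
    show "?S (g + h) \<longlonglongrightarrow> F g + F h"
      using tendsto_add[OF lim[of g] lim[of h]] by (simp add: cinner_add_right scaleC_add_left sum.distrib)
  qed
  have scale: "F (c *\<^sub>C h) = c *\<^sub>C F h" for c h
  proof (rule LIMSEQ_unique[OF lim])
    have "c *\<^sub>C (\<Sum>a<N. cinner (e a) h *\<^sub>C t a) = ?S (c *\<^sub>C h) N" for N
      by (induction N) (simp_all add: scaleC_add_right cinner_scaleC_right scaleC_scaleC scaleC_zero_right)
    thus "?S (c *\<^sub>C h) \<longlonglongrightarrow> c *\<^sub>C F h" using tendsto_scaleC[OF lim[of h], of c] by simp
  qed
  have bound: "norm (F h) \<le> norm h * sqrt C" for h
  proof (rule LIMSEQ_le_const2[OF tendsto_norm[OF lim]], intro exI allI impI)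
    fix N
    have "(norm (?S h N))\<^sup>2 \<le> C * (\<Sum>a<N. (cmod (cinner (e a) h))\<^sup>2)" by (rule t)
    also have "\<dots> \<le> C * (norm h)\<^sup>2" using bessel(1)[OF orth] C by (rule mult_left_mono)
    also have "\<dots> = (norm h * sqrt C)\<^sup>2" using C by (simp add: power_mult_distrib)
    finally show "norm (?S h N) \<le> norm h * sqrt C" by (rule power2_le_imp_le) (use C in simp)
  qed
  have "bounded_clinear F"
    unfolding bounded_clinear_def
    by (intro conjI allI scale bounded_linear_intro[of F "sqrt C"] add bound)
      (simp only: scaleC_complex_of_real[symmetric] scale)
  moreover have "F (e a) = t a" for a
  proof (rule LIMSEQ_unique[OF lim], rule tendsto_eventually, rule eventually_sequentiallyI[of "Suc a"])
    fix N assume "Suc a \<le> N"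
    have "?S (e a) N = (\<Sum>b<N. if b = a then t a else 0)"
      by (intro sum.cong refl)
        (use zero in \<open>auto simp: cinner_basis scaleC_complex_of_real[of 0, simplified] scaleC_complex_of_real[of 1, simplified]\<close>)
    thus "?S (e a) N = t a" using \<open>Suc a \<le> N\<close> by simp
  qed
  ultimately show thesis using that[of "Bop F"] by (simp add: Bop_inverse)
qed

text \<open>
  The vector $\sum_k \langle A e_k, y\rangle e_k$ represents $x \mapsto \langle A x, y\rangle$. Its coefficients
  are square summable: with \<open>s\<close> a partial sum of their squares, testing with the partial sum of the series
  gives $s \le \|A\| \sqrt s\, \|y\|$.
\<close>

lemma adjoint_exists:
  fixes A :: "'h bop"
  shows "\<exists>B. \<forall>x y. cinner (bop_apply A x) y = cinner x (bop_apply B y)"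
proof -
  have A: "bounded_clinear (bop_apply A)" using bop_apply[of A] by simp
  hence lin: "bounded_linear (bop_apply A)" and scale: "bop_apply A (c *\<^sub>C x) = c *\<^sub>C bop_apply A x" for c x
    by (auto simp: bounded_clinear_def)
  obtain K where K: "K > 0" "\<And>x. norm (bop_apply A x) \<le> norm x * K"
    using bounded_linear.pos_bounded[OF lin] by blast
  have A_sum: "bop_apply A (\<Sum>k<N. c k *\<^sub>C e k) = (\<Sum>k<N. c k *\<^sub>C bop_apply A (e k))" for N c
    by (simp add: linear_sum[OF bounded_linear.linear[OF lin]] scale)
  have "\<exists>z. \<forall>x. cinner (bop_apply A x) y = cinner x z" for y
  proof -
    define c where "c k = cinner (bop_apply A (e k)) y" for k
    have "(\<Sum>k<N. (cmod (c k))\<^sup>2) \<le> (K * norm y)\<^sup>2" for N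
    proof -
      define s where "s = (\<Sum>k<N. (cmod (c k))\<^sup>2)"
      have s: "s \<ge> 0" by (simp add: s_def sum_nonneg)
      let ?v = "\<Sum>k<N. c k *\<^sub>C e k"
      have "of_real s = cinner (bop_apply A ?v) y"
        unfolding A_sum cinner_sum_left cinner_scaleC_left c_def[symmetric] s_def of_real_sum
        by (intro sum.cong refl) (simp add: mult_cnj_cmod)
      hence "s = cmod (cinner (bop_apply A ?v) y)" using s by (metis abs_of_nonneg norm_of_real)
      also have "\<dots> \<le> norm (bop_apply A ?v) * norm y" by (rule cinner_Cauchy_Schwarz)
      also have "\<dots> \<le> (norm ?v * K) * norm y" by (intro mult_right_mono K) simp
      also have "\<dots> \<le> (sqrt s * K) * norm y"
      proof -
        have "norm ?v \<le> sqrt s" using norm_basis_sum[of c N] by (intro real_le_rsqrt) (simp add: s_def)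
        thus ?thesis using K by (intro mult_right_mono) auto
      qed
      finally have "sqrt s * sqrt s \<le> sqrt s * (K * norm y)" using s by (simp add: mult.assoc)
      hence "sqrt s \<le> K * norm y" if "s \<noteq> 0"
        by (rule mult_left_le_imp_le) (use s that in simp)
      hence "sqrt s \<le> K * norm y" using K by (cases "s = 0") auto
      hence "(sqrt s)\<^sup>2 \<le> (K * norm y)\<^sup>2" using s by (intro power_mono) auto
      thus ?thesis using s unfolding s_def[symmetric] by simp
    qed
    from square_summable_convergent[OF norm_basis_sum zero_le_one this]
    obtain z where z: "(\<lambda>N. \<Sum>k<N. c k *\<^sub>C e k) \<longlonglongrightarrow> z" by (auto simp: convergent_def)
    have "cinner (bop_apply A x) y = cinner x z" for x
    proof (rule LIMSEQ_unique)
      show "(\<lambda>N. cinner (bop_apply A (\<Sum>k<N. cinner (e k) x *\<^sub>C e k)) y) \<longlonglongrightarrow> cinner (bop_apply A x) y"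
        by (intro tendsto_cinner_left bounded_linear.tendsto[OF lin] total)
      have "cinner x (\<Sum>k<N. c k *\<^sub>C e k) = cinner (bop_apply A (\<Sum>k<N. cinner (e k) x *\<^sub>C e k)) y" for N
        unfolding A_sum cinner_sum_left cinner_sum_right cinner_scaleC_left cinner_scaleC_right c_def
        by (intro sum.cong refl) (simp add: cinner_commute[symmetric] mult.commute)
      thus "(\<lambda>N. cinner (bop_apply A (\<Sum>k<N. cinner (e k) x *\<^sub>C e k)) y) \<longlonglongrightarrow> cinner x z"
        using tendsto_cinner_right[OF z, of x] by simp
    qed
    thus ?thesis by blast
  qed
  then obtain B where B: "\<And>x y. cinner (bop_apply A x) y = cinner x (B y)" by metis
  have add: "B (y + y') = B y + B y'" for y y'
    by (rule cinner_ext) (simp add: B[symmetric] cinner_add_right)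
  have scaleB: "B (c *\<^sub>C y) = c *\<^sub>C B y" for c y
    by (rule cinner_ext) (simp add: B[symmetric] cinner_scaleC_right)
  have bound: "norm (B y) \<le> norm y * K" for y
  proof (cases "B y = 0")
    case False
    have "(norm (B y))\<^sup>2 = cmod (cinner (bop_apply A (B y)) y)" by (simp add: B cinner_self norm_power)
    also have "\<dots> \<le> norm (bop_apply A (B y)) * norm y" by (rule cinner_Cauchy_Schwarz)
    also have "\<dots> \<le> (norm (B y) * K) * norm y" by (intro mult_right_mono K) simp
    finally show ?thesis using False by (simp add: power2_eq_square mult_ac)
  qed (use K in simp)
  have "bounded_clinear B"
    unfolding bounded_clinear_def
    by (intro conjI allI scaleB bounded_linear_intro[of B K] add bound)
      (simp only: scaleC_complex_of_real[symmetric] scaleB)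
  thus ?thesis using B by (intro exI[of _ "Bop B"]) (simp add: Bop_inverse)
qed

lemma adj: "cinner (bop_apply (A :: 'h bop) x) y = cinner x (bop_apply (adj A) y)"
proof -
  obtain B where B: "\<forall>x y. cinner (bop_apply A x) y = cinner x (bop_apply B y)" using adjoint_exists by blast
  have "adj A = B"
    unfolding adj_def
  proof (rule the_equality)
    show "C = B" if "\<forall>x y. cinner (bop_apply A x) y = cinner x (bop_apply C y)" for C
    proof (rule bop_apply_inject[THEN iffD1], rule ext, rule cinner_ext)
      fix y x
      show "cinner x (bop_apply C y) = cinner x (bop_apply B y)"
        using spec[OF spec[OF that], of x y] spec[OF spec[OF B], of x y] by simp
    qed
  qed (rule B)
  thus ?thesis using B by simp
qed

lemma bop_eqI:
  assumes "\<And>a b. cinner (e a) (bop_apply A (e b)) = cinner (e a) (bop_apply B (e b))"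
  shows "A = (B :: 'h bop)"
proof -
  have lin: "bounded_linear (bop_apply A)" and scale: "bop_apply A (c *\<^sub>C x) = c *\<^sub>C bop_apply A x" for A :: "'h bop" and c x
    using bop_apply[of A] by (auto simp: bounded_clinear_def)
  have 1: "bop_apply A (e b) = bop_apply B (e b)" for b
  proof (rule LIMSEQ_unique[OF total])
    show "(\<lambda>N. \<Sum>k<N. cinner (e k) (bop_apply A (e b)) *\<^sub>C e k) \<longlonglongrightarrow> bop_apply B (e b)"
      unfolding assms by (rule total)
  qed
  have "bop_apply A h = bop_apply B h" for h
  proof (rule LIMSEQ_unique)
    show "(\<lambda>N. bop_apply A (\<Sum>k<N. cinner (e k) h *\<^sub>C e k)) \<longlonglongrightarrow> bop_apply A h"
      by (intro bounded_linear.tendsto[OF lin] total)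
    have "bop_apply A (\<Sum>k<N. cinner (e k) h *\<^sub>C e k) = bop_apply B (\<Sum>k<N. cinner (e k) h *\<^sub>C e k)" for N
      by (simp add: linear_sum[OF bounded_linear.linear[OF lin]] scale 1)
    thus "(\<lambda>N. bop_apply A (\<Sum>k<N. cinner (e k) h *\<^sub>C e k)) \<longlonglongrightarrow> bop_apply B h"
      using bounded_linear.tendsto[OF lin[of B] total[of h]] by simp
  qed
  thus ?thesis by (intro bop_apply_inject[THEN iffD1] ext)
qed

end

section \<open>Operator polynomials\<close>

lemma poly_mapping_expand:
  assumes "finite Z" "Poly_Mapping.keys p \<subseteq> Z"
  shows "p = (\<Sum>w\<in>Z. Poly_Mapping.single w (Poly_Mapping.lookup p w))"
proof (rule poly_mapping_eqI)
  fix k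
  have "Poly_Mapping.lookup (\<Sum>w\<in>Z. Poly_Mapping.single w (Poly_Mapping.lookup p w)) k
      = (\<Sum>w\<in>Z. if w = k then Poly_Mapping.lookup p k else 0)"
    unfolding lookup_sum by (intro sum.cong refl) (auto simp: lookup_single)
  also have "\<dots> = Poly_Mapping.lookup p k"
    using assms by (auto simp: in_keys_iff)
  finally show "Poly_Mapping.lookup p k = Poly_Mapping.lookup (\<Sum>w\<in>Z. Poly_Mapping.single w (Poly_Mapping.lookup p w)) k" ..
qed

definition weight_poly :: "(nat \<Rightarrow> nat) \<Rightarrow> nat \<times> nat \<Rightarrow> 'h::complex_inner ncpoly" where
  "weight_poly n x = (if snd x = 0 then ncone - (\<Sum>j\<in>{1..n (fst x) - 1}. ncvar (fst x) j) else ncvar (fst x) (snd x))"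

lemma single_weight_single:
  "Poly_Mapping.single (Word (rev u)) A * weight_poly n x * Poly_Mapping.single (Word v) (B :: 'h::complex_inner bop)
    = weighted n (\<lambda>w. Poly_Mapping.single (Word w) (A * B)) u x v"
  by (cases x) (simp add: weight_poly_def weighted_def ncone_def ncvar_def left_diff_distrib right_diff_distrib
    sum_distrib_left sum_distrib_right mult_single plus_ncword_def zero_ncword_def)

lemma bop_sum: "bop_apply P (\<Sum>k\<in>A. c k *\<^sub>C y k) = (\<Sum>k\<in>A. c k *\<^sub>C bop_apply P (y k))"
proof -
  have "bounded_linear (bop_apply P)" and "bop_apply P (c *\<^sub>C x) = c *\<^sub>C bop_apply P x" for c x
    using bop_apply[of P] by (auto simp: bounded_clinear_def)
  thus ?thesis by (simp add: linear_sum[OF bounded_linear.linear])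
qed

lemma psd_gram:
  fixes y :: "'s \<Rightarrow> 'a::complex_inner"
  shows "psd S (\<lambda>s t. cinner (y s) (y t))"
  unfolding psd_def
proof
  fix f
  have "hform S (\<lambda>s t. cinner (y s) (y t)) f f = cinner (\<Sum>s\<in>S. f s *\<^sub>C y s) (\<Sum>s\<in>S. f s *\<^sub>C y s)"
    by (simp add: hform_def cinner_sum_left cinner_sum_right cinner_scaleC_left cinner_scaleC_right sum_distrib_left mult_ac)
      (rule sum.swap)
  also have "\<dots> \<ge> 0" by (simp add: cinner_self less_eq_complex_def)
  finally show "0 \<le> hform S (\<lambda>s t. cinner (y s) (y t)) f f" .
qed

lemma psd_congruence:
  assumes "psd T D"
  shows "psd S (\<lambda>s t. hform T D (g s) (g t))"
  unfolding psd_def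
proof
  fix f
  have "hform S (\<lambda>s t. hform T D (g s) (g t)) f f = hform T D (\<lambda>r. \<Sum>s\<in>S. f s * g s r) (\<lambda>r. \<Sum>s\<in>S. f s * g s r)"
    unfolding hform_sum_left hform_sum_right hform_scale_left hform_scale_right
    by (subst hform_def) (simp add: sum_distrib_left mult_ac)
  thus "0 \<le> hform S (\<lambda>s t. hform T D (g s) (g t)) f f" using psdD[OF assms] by simp
qed

text \<open>The quadratic form of $p(E)$ on $\mathcal H\otimes\mathbb C^l$.\<close>

definition eval_form :: "nat \<Rightarrow> (nat \<times> nat \<Rightarrow> complex mat) \<Rightarrow> (nat \<Rightarrow> 'h::complex_inner) \<Rightarrow> 'h ncpoly \<Rightarrow> complex" where
  "eval_form l E v p = (\<Sum>a<l. cinner (v a) (ncpoly_eval l p E v a))"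

lemma eval_form_expand:
  assumes "finite Z" "Poly_Mapping.keys p \<subseteq> Z"
  shows "eval_form l E v p = (\<Sum>w\<in>Z. \<Sum>a<l. \<Sum>b<l.
    eval_word l E w $$ (a, b) * cinner (v a) (bop_apply (Poly_Mapping.lookup p w) (v b)))"
proof -
  have z: "bop_apply (0 :: 'h::complex_inner bop) x = 0" for x by (simp add: zero_bop.rep_eq)
  have "ncpoly_eval l p E v a = (\<Sum>w\<in>Z. tensor_apply l (Poly_Mapping.lookup p w) (eval_word l E w) v a)" for a
    unfolding ncpoly_eval_def
    by (rule sum.mono_neutral_left) (use assms in \<open>auto simp: in_keys_iff tensor_apply_def z scaleC_zero_right\<close>)
  hence "eval_form l E v p = (\<Sum>a<l. \<Sum>w\<in>Z. \<Sum>b<l.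
      eval_word l E w $$ (a, b) * cinner (v a) (bop_apply (Poly_Mapping.lookup p w) (v b)))"
    by (simp add: eval_form_def tensor_apply_def cinner_sum_right cinner_scaleC_right)
  thus ?thesis by (subst sum.swap)
qed

lemma additive_eval_form:
  fixes v :: "nat \<Rightarrow> 'h::complex_inner"
  shows "Modules.additive (eval_form l E v)"
proof
  fix p q :: "'h ncpoly"
  let ?Z = "Poly_Mapping.keys p \<union> Poly_Mapping.keys q"
  have Z: "finite ?Z" "Poly_Mapping.keys (p + q) \<subseteq> ?Z" using Poly_Mapping.keys_add[of p q] by auto
  show "eval_form l E v (p + q) = eval_form l E v p + eval_form l E v q"
    unfolding eval_form_expand[OF Z] eval_form_expand[OF Z(1), of p, OF Un_upper1] eval_form_expand[OF Z(1), of q, OF Un_upper2]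
    by (simp add: lookup_add plus_bop.rep_eq cinner_add_right distrib_left sum.distrib)
qed

lemma eval_form_single:
  "eval_form l E v (Poly_Mapping.single w P) = (\<Sum>a<l. \<Sum>b<l. eval_word l E w $$ (a, b) * cinner (v a) (bop_apply P (v b)))"
  using eval_form_expand[of "{w}" "Poly_Mapping.single w P" l E v] by simp

lemma povm_positive_iff:
  "povm_positive m n p \<longleftrightarrow> (\<forall>l\<ge>1. \<forall>E\<in>povm_tuples m n l. \<forall>v. 0 \<le> eval_form l E v p)"
  by (simp add: povm_positive_def eval_form_def)

definition outcome_kernel :: "(nat \<Rightarrow> nat) \<Rightarrow> (nat \<times> nat \<Rightarrow> complex mat) \<Rightarrow> nat \<times> nat \<Rightarrow> nat \<Rightarrow> nat \<Rightarrow> complex" where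
  "outcome_kernel n E x a b =
     (if snd x = 0 then (if a = b then 1 else 0) - (\<Sum>j\<in>{1..n (fst x) - 1}. E (fst x, j) $$ (a, b)) else E x $$ (a, b))"

lemma psd_outcome_kernel:
  assumes E: "E \<in> povm_tuples m n l" and x: "x \<in> outcomes m n"
  shows "psd {..<l} (outcome_kernel n E x)"
proof (cases "snd x = 0")
  case True
  have "psd {..<l} (\<lambda>a b. (1\<^sub>m l - mat l l (\<lambda>(a, b). \<Sum>j\<in>{1..n (fst x) - 1}. E (fst x, j) $$ (a, b))) $$ (a, b))"
    using E x by (auto simp: povm_tuples_def psd_mat_iff outcomes_def)
  also have "?this \<longleftrightarrow> psd {..<l} (outcome_kernel n E x)"
    by (rule psd_cong) (use True in \<open>auto simp: outcome_kernel_def\<close>)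
  finally show ?thesis .
next
  case False
  hence "psd {..<l} (\<lambda>a b. E (fst x, snd x) $$ (a, b))"
    using E x by (auto simp: povm_tuples_def psd_mat_iff outcomes_def)
  also have "?this \<longleftrightarrow> psd {..<l} (outcome_kernel n E x)"
    by (rule psd_cong) (use False in \<open>auto simp: outcome_kernel_def\<close>)
  finally show ?thesis .
qed

lemma povm_tuples_carrier: "E \<in> povm_tuples m n l \<Longrightarrow> y \<in> indices m n \<Longrightarrow> E y \<in> carrier_mat l l"
  by (auto simp: povm_tuples_def psd_mat_def indices_def)

lemma povm_tuples_hermitian:
  assumes "E \<in> povm_tuples m n l" "y \<in> indices m n" "a < l" "b < l"
  shows "cnj (E y $$ (a, b)) = E y $$ (b, a)"
proof -
  have "psd {..<l} (\<lambda>a b. E y $$ (a, b))"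
    using assms(1,2) by (auto simp: povm_tuples_def psd_mat_iff indices_def)
  from psd_hermitian[OF this] show ?thesis using assms(3,4) by (simp add: hermitian_def)
qed

text \<open>
  The entries of $E^{u^*}E_xE^v$, where $E_x$ may be the complementary effect: the Hermitian matrices
  of \<open>u\<close> are moved to the left vector.
\<close>

lemma weighted_eval_word:
  assumes E: "E \<in> povm_tuples m n l" and x: "x \<in> outcomes m n"
    and u: "set u \<subseteq> indices m n" and v: "set v \<subseteq> indices m n" and ab: "a < l" "b < l"
  shows "weighted n (\<lambda>w. eval_word l E (Word w) $$ (a, b)) u x v
    = hform {..<l} (outcome_kernel n E x) (act l E u (dirac a)) (act l E v (dirac b))"
proof -
  have entry: "eval_word l E (Word w) $$ (a, b) = act l E w (dirac b) a" if "set w \<subseteq> indices m n" for w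
  proof -
    have "act l E w (dirac b) a = (\<Sum>c<l. eval_word l E (Word w) $$ (a, c) * dirac b c)"
      using that by (intro eval_word_act[symmetric] povm_tuples_carrier[OF E] ab) auto
    thus ?thesis using ab by (simp add: if_distrib[of "\<lambda>x. _ * x"] cong: if_cong)
  qed
  have move: "eval_word l E (Word (rev u @ w)) $$ (a, b) = (\<Sum>c<l. cnj (act l E u (dirac a) c) * act l E w (dirac b) c)"
    if w: "set w \<subseteq> indices m n" for w
  proof -
    have "act l E (rev u) (act l E w (dirac b)) a = (\<Sum>c<l. cnj (dirac a c) * act l E (rev u) (act l E w (dirac b)) c)"
      using ab by (simp add: if_distrib[of cnj] if_distrib[of "\<lambda>x. x * _"] cong: if_cong)
    also have "\<dots> = (\<Sum>c<l. cnj (act l E (rev (rev u)) (dirac a) c) * act l E w (dirac b) c)"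
      using u by (intro act_adjoint povm_tuples_hermitian[OF E]) auto
    finally show ?thesis using entry[of "rev u @ w"] u w by (simp add: act_append)
  qed
  have letter: "eval_word l E (Word (rev u @ y # v)) $$ (a, b)
      = hform {..<l} (\<lambda>a b. E y $$ (a, b)) (act l E u (dirac a)) (act l E v (dirac b))" if "y \<in> indices m n" for y
    using move[of "y # v"] v that by (simp add: hform_def sum_distrib_left mult.assoc)
  have none: "eval_word l E (Word (rev u @ v)) $$ (a, b)
      = hform {..<l} (\<lambda>a b. if a = b then 1 else 0) (act l E u (dirac a)) (act l E v (dirac b))"
    using move[OF v] by (simp add: hform_id)
  show ?thesis
  proof (cases "snd x = 0")
    case True
    have "hform {..<l} (outcome_kernel n E x) (act l E u (dirac a)) (act l E v (dirac b))
        = hform {..<l} (\<lambda>a b. (if a = b then 1 else 0) + (\<Sum>j\<in>{1..n (fst x) - 1}. (-1) * E (fst x, j) $$ (a, b)))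
            (act l E u (dirac a)) (act l E v (dirac b))"
      by (rule hform_cong) (use True in \<open>auto simp: outcome_kernel_def sum_negf\<close>)
    also have "\<dots> = eval_word l E (Word (rev u @ v)) $$ (a, b) -
        (\<Sum>j\<in>{1..n (fst x) - 1}. hform {..<l} (\<lambda>a b. E (fst x, j) $$ (a, b)) (act l E u (dirac a)) (act l E v (dirac b)))"
      unfolding hform_kernel_add hform_kernel_sum hform_kernel_scale none by (simp add: sum_negf)
    also have "\<dots> = weighted n (\<lambda>w. eval_word l E (Word w) $$ (a, b)) u x v"
      using True x by (auto simp: weighted_def outcomes_def indices_def letter)
    finally show ?thesis ..
  next
    case False
    have "hform {..<l} (outcome_kernel n E x) (act l E u (dirac a)) (act l E v (dirac b))
        = hform {..<l} (\<lambda>a b. E x $$ (a, b)) (act l E u (dirac a)) (act l E v (dirac b))"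
      by (rule hform_cong) (use False in \<open>auto simp: outcome_kernel_def\<close>)
    moreover have "x \<in> indices m n" using False x by (cases x) (auto simp: outcomes_def indices_def)
    ultimately show ?thesis using False letter by (simp add: weighted_def)
  qed
qed

context hilbert_basis
begin

lemma adj_zero: "adj (0 :: 'h bop) = 0"
proof -
  have "cinner x (bop_apply (adj (0 :: 'h bop)) y) = cinner x (bop_apply 0 y)" for x y
    unfolding adj[symmetric] by (simp add: zero_bop.rep_eq)
  thus ?thesis by (intro bop_apply_inject[THEN iffD1] ext cinner_ext)
qed

lemma weighted_square_expand:
  fixes f :: "'h ncpoly"
  assumes Z: "finite Z" and keys: "Poly_Mapping.keys f \<subseteq> Word ` Z"
  shows "ncstar f * weight_poly n x * f = (\<Sum>u\<in>Z. \<Sum>v\<in>Z. weighted n (\<lambda>w. Poly_Mapping.single (Word w)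
      (adj (Poly_Mapping.lookup f (Word u)) * Poly_Mapping.lookup f (Word v))) u x v)"
proof -
  have inj: "inj_on Word Z" by (simp add: inj_on_def)
  have fin: "finite (Word ` Z)" using Z by simp
  have f: "f = (\<Sum>v\<in>Z. Poly_Mapping.single (Word v) (Poly_Mapping.lookup f (Word v)))"
    using poly_mapping_expand[OF fin keys] by (simp add: sum.reindex[OF inj] o_def)
  have star: "ncstar f = (\<Sum>u\<in>Z. Poly_Mapping.single (Word (rev u)) (adj (Poly_Mapping.lookup f (Word u))))"
  proof -
    have "ncstar f = (\<Sum>w\<in>Word ` Z. Poly_Mapping.single (Word (rev (letters w))) (adj (Poly_Mapping.lookup f w)))"
      unfolding ncstar_def by (rule sum.mono_neutral_left) (use fin keys in \<open>auto simp: in_keys_iff adj_zero\<close>)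
    thus ?thesis by (simp add: sum.reindex[OF inj] o_def)
  qed
  have "ncstar f * weight_poly n x * f = (\<Sum>u\<in>Z. \<Sum>v\<in>Z. Poly_Mapping.single (Word (rev u)) (adj (Poly_Mapping.lookup f (Word u)))
      * weight_poly n x * Poly_Mapping.single (Word v) (Poly_Mapping.lookup f (Word v)))"
    by (subst (2) f, subst star) (simp add: sum_distrib_left sum_distrib_right, rule sum.swap)
  thus ?thesis by (simp add: single_weight_single)
qed

lemma additive_weighted_square:
  fixes f :: "'h ncpoly"
  assumes "Modules.additive \<theta>" "finite Z" "Poly_Mapping.keys f \<subseteq> Word ` Z"
  shows "\<theta> (ncstar f * weight_poly n x * f) = (\<Sum>u\<in>Z. \<Sum>v\<in>Z. weighted n (\<lambda>w. \<theta> (Poly_Mapping.single (Word w)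
      (adj (Poly_Mapping.lookup f (Word u)) * Poly_Mapping.lookup f (Word v)))) u x v)"
  unfolding weighted_square_expand[OF assms(2,3)] Modules.additive.sum[OF assms(1)] additive_weighted[OF assms(1)] ..

text \<open>
  The value of a weighted square is a trace pairing of two positive kernels: the Gram kernel
  of the coefficients of the factor, and the congruence transform of an effect.
\<close>

lemma eval_form_weighted_square:
  fixes f :: "'h ncpoly"
  assumes f: "f \<in> op_povm m n" and E: "E \<in> povm_tuples m n l" and x: "x \<in> outcomes m n"
  shows "0 \<le> eval_form l E v (ncstar f * weight_poly n x * f)"
proof -
  define Z where "Z = letters ` Poly_Mapping.keys f"
  have Z: "finite Z" "Poly_Mapping.keys f \<subseteq> Word ` Z"
    by (auto simp: Z_def image_image)
  have sub: "set u \<subseteq> indices m n" if "u \<in> Z" for u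
    using that f by (auto simp: Z_def op_povm_def)
  define F where "F u = bop_apply (Poly_Mapping.lookup f (Word u))" for u
  let ?y = "\<lambda>s. F (fst s) (v (snd s))" and ?g = "\<lambda>s. act l E (fst s) (dirac (snd s))"
  let ?D = "outcome_kernel n E x" and ?S = "Z \<times> {..<l}"
  have "eval_form l E v (ncstar f * weight_poly n x * f) = (\<Sum>u\<in>Z. \<Sum>u'\<in>Z.
      weighted n (\<lambda>w. \<Sum>a<l. \<Sum>b<l. eval_word l E (Word w) $$ (a, b) * cinner (F u (v a)) (F u' (v b))) u x u')"
    unfolding additive_weighted_square[OF additive_eval_form Z] eval_form_single
    by (simp add: F_def times_bop.rep_eq adj[symmetric])
  also have "\<dots> = (\<Sum>u\<in>Z. \<Sum>u'\<in>Z. \<Sum>a<l. \<Sum>b<l. cinner (F u (v a)) (F u' (v b)) *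
      hform {..<l} ?D (act l E u (dirac a)) (act l E u' (dirac b)))"
  proof (intro sum.cong refl)
    fix u u' assume u: "u \<in> Z" "u' \<in> Z"
    show "weighted n (\<lambda>w. \<Sum>a<l. \<Sum>b<l. eval_word l E (Word w) $$ (a, b) * cinner (F u (v a)) (F u' (v b))) u x u'
        = (\<Sum>a<l. \<Sum>b<l. cinner (F u (v a)) (F u' (v b)) * hform {..<l} ?D (act l E u (dirac a)) (act l E u' (dirac b)))"
      unfolding weighted_sum mult.commute[of "eval_word _ _ _ $$ _"] weighted_scale
      by (intro sum.cong refl) (simp add: weighted_eval_word[OF E x sub[OF u(1)] sub[OF u(2)]])
  qed
  also have "\<dots> = (\<Sum>s\<in>?S. \<Sum>t\<in>?S. cinner (?y s) (?y t) * hform {..<l} ?D (?g s) (?g t))"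
    unfolding sum.cartesian_product' fst_conv snd_conv by (rule sum.cong[OF refl]) (rule sum.swap)
  also have "\<dots> \<ge> 0"
    by (rule psd_pairing[OF _ psd_gram psd_congruence[OF psd_outcome_kernel[OF E x]]]) (use Z in simp)
  finally show ?thesis .
qed

end

section \<open>From kernels to weighted squares\<close>

lemma op_povm_ncdeg_iff:
  "p \<in> op_povm m n \<and> ncdeg p \<le> k \<longleftrightarrow> Poly_Mapping.keys p \<subseteq> Word ` words m n k"
proof -
  have "ncdeg p \<le> k \<longleftrightarrow> (\<forall>w\<in>Poly_Mapping.keys p. length (letters w) \<le> k)"
    unfolding ncdeg_def by (subst Max_le_iff) auto
  moreover have "w \<in> Word ` words m n k \<longleftrightarrow> set (letters w) \<subseteq> indices m n \<and> length (letters w) \<le> k" for w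
    by (cases w) (auto simp: words_def image_iff)
  ultimately show ?thesis unfolding op_povm_def by blast
qed

lemma sum_swap_pairs:
  "(\<Sum>\<alpha>\<in>A. \<Sum>\<beta>\<in>B. \<Sum>a\<in>C. \<Sum>b\<in>D. g \<alpha> \<beta> a b) = (\<Sum>a\<in>C. \<Sum>b\<in>D. \<Sum>\<alpha>\<in>A. \<Sum>\<beta>\<in>B. g \<alpha> \<beta> a b)"
proof -
  have "(\<Sum>\<alpha>\<in>A. \<Sum>\<beta>\<in>B. \<Sum>a\<in>C. \<Sum>b\<in>D. g \<alpha> \<beta> a b) = (\<Sum>\<alpha>\<in>A. \<Sum>a\<in>C. \<Sum>\<beta>\<in>B. \<Sum>b\<in>D. g \<alpha> \<beta> a b)"
    by (rule sum.cong[OF refl]) (rule sum.swap)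
  also have "\<dots> = (\<Sum>a\<in>C. \<Sum>\<alpha>\<in>A. \<Sum>\<beta>\<in>B. \<Sum>b\<in>D. g \<alpha> \<beta> a b)"
    by (rule sum.swap)
  also have "\<dots> = (\<Sum>a\<in>C. \<Sum>\<alpha>\<in>A. \<Sum>b\<in>D. \<Sum>\<beta>\<in>B. g \<alpha> \<beta> a b)"
    by (rule sum.cong[OF refl], rule sum.cong[OF refl]) (rule sum.swap)
  also have "\<dots> = (\<Sum>a\<in>C. \<Sum>b\<in>D. \<Sum>\<alpha>\<in>A. \<Sum>\<beta>\<in>B. g \<alpha> \<beta> a b)"
    by (rule sum.cong[OF refl]) (rule sum.swap)
  finally show ?thesis .
qed

definition poly_of :: "word set \<Rightarrow> (word \<Rightarrow> 'h::complex_inner bop) \<Rightarrow> 'h ncpoly" where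
  "poly_of Z F = (\<Sum>u\<in>Z. Poly_Mapping.single (Word u) (F u))"

lemma lookup_poly_of:
  assumes "finite Z"
  shows "Poly_Mapping.lookup (poly_of Z F) (Word u) = (if u \<in> Z then F u else 0)"
proof -
  have "Poly_Mapping.lookup (poly_of Z F) (Word u) = (\<Sum>v\<in>Z. if v = u then F v else 0)"
    unfolding poly_of_def lookup_sum by (intro sum.cong refl) (auto simp: lookup_single when_def)
  thus ?thesis using assms by simp
qed

lemma keys_poly_of:
  assumes "finite Z"
  shows "Poly_Mapping.keys (poly_of Z F) \<subseteq> Word ` Z"
proof
  fix w assume w: "w \<in> Poly_Mapping.keys (poly_of Z F)"
  obtain u where "w = Word u" by (cases w)
  thus "w \<in> Word ` Z" using w lookup_poly_of[OF assms, of F u] by (auto simp: in_keys_iff split: if_splits)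
qed

lemma sum_outcomes:
  "(\<Sum>x\<in>outcomes m n. g x) = (\<Sum>i\<in>{1..m}. (\<Sum>j\<in>{1..n i - 1}. g (i, j)) + g (i, 0))"
proof -
  have "(\<Sum>x\<in>outcomes m n. g x) = (\<Sum>i\<in>{1..m}. \<Sum>j\<in>{0..n i - 1}. g (i, j))"
    unfolding outcomes_def by (subst sum.Sigma) auto
  also have "\<dots> = (\<Sum>i\<in>{1..m}. (\<Sum>j\<in>{1..n i - 1}. g (i, j)) + g (i, 0))"
  proof (rule sum.cong[OF refl])
    fix i
    have "{0..n i - 1} = insert 0 {1..n i - 1}" by auto
    thus "(\<Sum>j\<in>{0..n i - 1}. g (i, j)) = (\<Sum>j\<in>{1..n i - 1}. g (i, j)) + g (i, 0)"
      by (simp add: add.commute)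
  qed
  finally show ?thesis .
qed

context hilbert_basis
begin

definition coeffs :: "'h ncpoly \<Rightarrow> word \<Rightarrow> nat \<Rightarrow> nat \<Rightarrow> complex" where
  "coeffs p w a b = cinner (e a) (bop_apply (Poly_Mapping.lookup p (Word w)) (e b))"

lemma cinner_coeffs:
  "cinner (\<Sum>a<N. h a *\<^sub>C e a) (bop_apply (Poly_Mapping.lookup p (Word w)) (\<Sum>b<N. g b *\<^sub>C e b))
    = hform {..<N} (coeffs p w) h g"
  unfolding hform_def bop_sum cinner_sum_left
  by (simp add: cinner_sum_right cinner_scaleC_left cinner_scaleC_right coeffs_def sum_distrib_left mult_ac)

lemma positive_coeffs_if_povm_positive:
  assumes p: "Poly_Mapping.keys p \<subseteq> Word ` words m n (2 * d + 1)" and pos: "povm_positive m n p"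
  shows "positive_coeffs m n d (coeffs p)"
  unfolding positive_coeffs_def
proof (intro allI impI ballI)
  fix l E N and \<xi> :: "nat \<Rightarrow> nat \<Rightarrow> complex" assume l: "l \<ge> 1" "E \<in> povm_tuples m n l"
  define v where "v \<alpha> = (\<Sum>a<N. \<xi> a \<alpha> *\<^sub>C e a)" for \<alpha>
  have inj: "inj_on Word A" for A :: "word set" by (simp add: inj_on_def)
  have "eval_form l E v p = (\<Sum>w\<in>words m n (2 * d + 1). \<Sum>\<alpha><l. \<Sum>\<beta><l.
      eval_word l E (Word w) $$ (\<alpha>, \<beta>) * hform {..<N} (coeffs p w) (\<lambda>a. \<xi> a \<alpha>) (\<lambda>b. \<xi> b \<beta>))"
    using eval_form_expand[OF finite_imageI[OF finite_words] p, of l E v]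
    unfolding v_def cinner_coeffs[symmetric] by (simp add: sum.reindex[OF inj] o_def)
  also have "\<dots> = (\<Sum>w\<in>words m n (2 * d + 1). \<Sum>\<alpha><l. \<Sum>\<beta><l. \<Sum>a<N. \<Sum>b<N.
      coeffs p w a b * (cnj (\<xi> a \<alpha>) * eval_word l E (Word w) $$ (\<alpha>, \<beta>) * \<xi> b \<beta>))"
    by (simp add: hform_def sum_distrib_left mult_ac)
  also have "\<dots> = pairing m n d N (coeffs p) (vector_functional l E \<xi>)"
    unfolding pairing_def vector_functional_def sum_distrib_left by (rule sum.cong[OF refl]) (rule sum_swap_pairs)
  finally show "0 \<le> pairing m n d N (coeffs p) (vector_functional l E \<xi>)"
    using pos[unfolded povm_positive_iff, rule_format, OF l, of v] by simp
qed

text \<open>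
  An operator is determined by its entries in the basis, and the entries of a coefficient of the sum of
  weighted squares are those of the certificate whose Gram kernels are formed by the columns
  \<open>F k x u (e a)\<close>. Basis vectors that are zero carry no information, so the kernels may
  be arbitrary there.
\<close>

lemma weighted_squares_from_kernel:
  assumes p: "Poly_Mapping.keys p \<subseteq> Word ` words m n (2 * d + 1)"
    and G: "\<And>w a b. w \<in> words m n (2 * d + 1) \<Longrightarrow> certificate m n d G w a b = coeffs p w a b"
    and F: "\<And>x u v a b. x \<in> outcomes m n \<Longrightarrow> e a \<noteq> 0 \<Longrightarrow> e b \<noteq> 0 \<Longrightarrow>
      u \<in> words m n d \<Longrightarrow> v \<in> words m n d \<Longrightarrow>
      (\<Sum>k\<in>K. cinner (bop_apply (F k x u) (e a)) (bop_apply (F k x v) (e b))) = G x (u, a) (v, b)"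
  shows "p = (\<Sum>k\<in>K. \<Sum>x\<in>outcomes m n.
    ncstar (poly_of (words m n d) (F k x)) * weight_poly n x * poly_of (words m n d) (F k x))"
    (is "p = ?rhs")
proof (rule poly_mapping_eqI, rule bop_eqI)
  let ?W = "words m n d"
  fix k0 :: "(nat \<times> nat) ncword" and a b
  obtain w where w: "k0 = Word w" by (cases k0)
  define \<theta> where "\<theta> q = cinner (e a) (bop_apply (Poly_Mapping.lookup q (Word w)) (e b))" for q :: "'h ncpoly"
  have add: "Modules.additive \<theta>"
    by (simp add: Modules.additive_def \<theta>_def lookup_add plus_bop.rep_eq cinner_add_right)
  have zero: "bop_apply (0 :: 'h bop) y = 0" for y by (simp add: zero_bop.rep_eq)
  let ?c = "\<lambda>k x u v. cinner (bop_apply (F k x u) (e a)) (bop_apply (F k x v) (e b))"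
  have \<theta>_single: "\<theta> (Poly_Mapping.single (Word w') (adj A * B)) = cinner (bop_apply A (e a)) (bop_apply B (e b)) * dirac w w'"
    for w' A B by (simp add: \<theta>_def lookup_single when_def times_bop.rep_eq adj zero)
  have sq: "\<theta> (ncstar (poly_of ?W (F k x)) * weight_poly n x * poly_of ?W (F k x))
      = (\<Sum>u\<in>?W. \<Sum>v\<in>?W. ?c k x u v * weighted n (dirac w) u x v)" for k x
    unfolding additive_weighted_square[OF add finite_words keys_poly_of[OF finite_words]] \<theta>_single weighted_scale
    by (intro sum.cong refl) (simp add: lookup_poly_of finite_words)
  have "\<theta> ?rhs = (\<Sum>k\<in>K. \<Sum>x\<in>outcomes m n. \<Sum>u\<in>?W. \<Sum>v\<in>?W. ?c k x u v * weighted n (dirac w) u x v)"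
    unfolding Modules.additive.sum[OF add] sq ..
  also have "\<dots> = (\<Sum>x\<in>outcomes m n. \<Sum>k\<in>K. \<Sum>u\<in>?W. \<Sum>v\<in>?W. ?c k x u v * weighted n (dirac w) u x v)"
    by (rule sum.swap)
  also have "\<dots> = (\<Sum>x\<in>outcomes m n. \<Sum>u\<in>?W. \<Sum>k\<in>K. \<Sum>v\<in>?W. ?c k x u v * weighted n (dirac w) u x v)"
    by (rule sum.cong[OF refl]) (rule sum.swap)
  also have "\<dots> = (\<Sum>x\<in>outcomes m n. \<Sum>u\<in>?W. \<Sum>v\<in>?W. \<Sum>k\<in>K. ?c k x u v * weighted n (dirac w) u x v)"
    by (rule sum.cong[OF refl], rule sum.cong[OF refl]) (rule sum.swap)
  also have "\<dots> = (\<Sum>x\<in>outcomes m n. \<Sum>u\<in>?W. \<Sum>v\<in>?W. weighted n (dirac w) u x v * (\<Sum>k\<in>K. ?c k x u v))"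
    by (simp add: sum_distrib_left mult_ac)
  finally have rhs: "\<theta> ?rhs = (\<Sum>x\<in>outcomes m n. \<Sum>u\<in>?W. \<Sum>v\<in>?W. weighted n (dirac w) u x v * (\<Sum>k\<in>K. ?c k x u v))" .
  have "\<theta> p = \<theta> ?rhs"
  proof (cases "w \<in> words m n (2 * d + 1) \<and> e a \<noteq> 0 \<and> e b \<noteq> 0")
    case True
    have "\<theta> p = certificate m n d G w a b" using G[of w a b] True by (simp add: \<theta>_def coeffs_def)
    also have "\<dots> = \<theta> ?rhs"
      unfolding rhs certificate_def by (intro sum.cong refl) (use True F in auto)
    finally show ?thesis .
  next
    case False
    have "weighted n (dirac w) u x v * (\<Sum>k\<in>K. ?c k x u v) = 0" if "x \<in> outcomes m n" "u \<in> ?W" "v \<in> ?W" for x u v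
    proof (cases "w \<in> words m n (2 * d + 1)")
      case True
      hence "e a = 0 \<or> e b = 0" using False by blast
      moreover have "bop_apply A 0 = 0" for A :: "'h bop" using bop_sum[of A "\<lambda>_. 0" "\<lambda>_. 0" "{}"] by simp
      ultimately have "?c k x u v = 0" for k by auto
      thus ?thesis by simp
    next
      case False
      have "weighted n (dirac w) u x v = weighted n (\<lambda>_. 0) u x v"
        by (rule weighted_cong[OF that(2,3,1)]) (use False in auto)
      thus ?thesis by (simp add: weighted_zero)
    qed
    hence "\<theta> ?rhs = 0" unfolding rhs by (intro sum.neutral ballI) simp
    moreover have "\<theta> p = 0"
    proof (cases "w \<in> words m n (2 * d + 1)")
      case True
      hence "e a = 0 \<or> e b = 0" using False by blast
      moreover have "bop_apply A 0 = 0" for A :: "'h bop" using bop_sum[of A "\<lambda>_. 0" "\<lambda>_. 0" "{}"] by simp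
      ultimately show ?thesis by (auto simp: \<theta>_def)
    next
      case False
      hence "Word w \<notin> Poly_Mapping.keys p" using p by auto
      thus ?thesis by (simp add: \<theta>_def in_keys_iff zero)
    qed
    ultimately show ?thesis by simp
  qed
  thus "cinner (e a) (bop_apply (Poly_Mapping.lookup p k0) (e b)) = cinner (e a) (bop_apply (Poly_Mapping.lookup ?rhs k0) (e b))"
    unfolding w \<theta>_def .
qed

text \<open>
  Each diagonal block of an exact certificate is bounded, because the faithful functional of
  the certificate is a fixed operator.
\<close>

lemma kernel_block_bounded:
  assumes "faithful m n d L \<kappa>"
    and psd: "\<And>x S. finite S \<Longrightarrow> psd S (G x)"
    and G: "\<And>w a b. w \<in> words m n (2 * d + 1) \<Longrightarrow> certificate m n d G w a b = coeffs p w a b"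
    and x: "x \<in> outcomes m n" and u: "u \<in> words m n d"
  obtains C where "C \<ge> 0"
    "\<And>N h. Re (hform {..<N} (\<lambda>a b. G x (u, a) (u, b)) h h) \<le> C * (\<Sum>a<N. (cmod (h a))\<^sup>2)"
proof -
  interpret faithful m n d L \<kappa> by fact
  have "\<exists>B\<ge>0. \<forall>y. norm (bop_apply (Poly_Mapping.lookup p (Word w)) y) \<le> norm y * B" for w
  proof -
    have "bounded_linear (bop_apply (Poly_Mapping.lookup p (Word w)))"
      using bop_apply[of "Poly_Mapping.lookup p (Word w)"] by (auto simp: bounded_clinear_def)
    thus ?thesis using bounded_linear.nonneg_bounded by blast
  qed
  then obtain B where B: "\<And>w. B w \<ge> 0" "\<And>w y. norm (bop_apply (Poly_Mapping.lookup p (Word w)) y) \<le> norm y * B w"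
    by metis
  let ?P = "\<lambda>w. bop_apply (Poly_Mapping.lookup p (Word w))"
  define C where "C = (\<Sum>w\<in>W2. cmod (L w) * B w) / \<kappa>"
  show thesis
  proof (rule that[of C])
    show "C \<ge> 0" unfolding C_def using \<kappa> B by (intro divide_nonneg_pos sum_nonneg mult_nonneg_nonneg) auto
    fix N and h :: "nat \<Rightarrow> complex"
    let ?v = "\<Sum>a<N. h a *\<^sub>C e a" and ?s = "\<Sum>a<N. (cmod (h a))\<^sup>2"
    have v: "(norm ?v)\<^sup>2 \<le> ?s" using norm_basis_sum[of h N] by simp
    have "\<kappa> * Re (hform {..<N} (\<lambda>a b. G x (u, a) (u, b)) h h)
        \<le> Re (\<Sum>w\<in>W2. L w * hform {..<N} (certificate m n d G w) h h)"
      by (rule certificate_bound[OF _ x u]) (simp add: psd finite_words)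
    also have "(\<Sum>w\<in>W2. L w * hform {..<N} (certificate m n d G w) h h)
        = (\<Sum>w\<in>W2. L w * cinner ?v (?P w ?v))"
      unfolding cinner_coeffs hform_def by (intro sum.cong refl) (simp add: G)
    also have "Re \<dots> \<le> cmod (\<Sum>w\<in>W2. L w * cinner ?v (?P w ?v))"
      by (rule complex_Re_le_cmod)
    also have "\<dots> \<le> (\<Sum>w\<in>W2. cmod (L w) * B w * ?s)"
    proof (rule sum_norm_le)
      fix w
      have "cmod (cinner ?v (?P w ?v)) \<le> norm ?v * (norm ?v * B w)"
        by (rule order_trans[OF cinner_Cauchy_Schwarz]) (intro mult_left_mono B norm_ge_zero)
      also have "\<dots> = (norm ?v)\<^sup>2 * B w" by (simp add: power2_eq_square)
      also have "\<dots> \<le> ?s * B w" using v B(1) by (rule mult_right_mono)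
      finally have "cmod (L w) * cmod (cinner ?v (?P w ?v)) \<le> cmod (L w) * (?s * B w)"
        by (rule mult_left_mono) simp
      thus "cmod (L w * cinner ?v (?P w ?v)) \<le> cmod (L w) * B w * ?s"
        by (simp add: norm_mult mult_ac)
    qed
    also have "\<dots> = \<kappa> * (C * ?s)" using \<kappa> by (simp add: C_def sum_distrib_right)
    finally show "Re (hform {..<N} (\<lambda>a b. G x (u, a) (u, b)) h h) \<le> C * ?s" using \<kappa> by simp
  qed
qed

lemma exact_kernel:
  assumes m: "m \<ge> 1" and p: "Poly_Mapping.keys p \<subseteq> Word ` words m n (2 * d + 1)" and pos: "povm_positive m n p"
  obtains L \<kappa> G R where "faithful m n d L \<kappa>"
    "\<And>x S. finite S \<Longrightarrow> psd S (G x)"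
    "\<And>w a b. w \<in> words m n (2 * d + 1) \<Longrightarrow> certificate m n d G w a b = coeffs p w a b"
    "\<And>x k s. k > to_nat s \<Longrightarrow> R x k s = 0"
    "\<And>x N s t. N > to_nat s \<Longrightarrow> G x s t = (\<Sum>k<N. cnj (R x k s) * R x k t)"
proof -
  obtain L and \<kappa> :: real where L: "\<kappa> > 0" "\<And>w. cnj (L w) = L (rev w)"
    "\<And>x f. x \<in> outcomes m n \<Longrightarrow>
      \<kappa> * (\<Sum>u\<in>words m n d. (cmod (f u))\<^sup>2) \<le> Re (hform (words m n d) (\<lambda>u v. weighted n L u x v) f f)"
    by (rule faithful_functional[of m n d]) (rule that)
  have faith: "faithful m n d L \<kappa>" by unfold_locales (use m in simp, rule L(1), rule L(2), rule L(3))
  show thesis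
  proof (rule faithful.exact_certificate[OF faith positive_coeffs_if_povm_positive[OF p pos]])
    fix G assume G: "\<And>x S. finite S \<Longrightarrow> psd S (G x)"
      "\<And>w a b. w \<in> words m n (2 * d + 1) \<Longrightarrow> certificate m n d G w a b = coeffs p w a b"
    define factor where "factor x R \<longleftrightarrow> (\<forall>k s. k > to_nat s \<longrightarrow> R k s = 0) \<and>
        (\<forall>N s t. N > to_nat s \<longrightarrow> G x s t = (\<Sum>k<N. cnj (R k s) * R k t))" for x R
    have "\<exists>R. factor x R" for x
    proof (rule psd_factor[of "G x", OF G(1)])
      fix R assume "\<And>k s. k > to_nat s \<Longrightarrow> R k s = 0" "\<And>N s t. N > to_nat s \<Longrightarrow> G x s t = (\<Sum>k<N. cnj (R k s) * R k t)"
      thus ?thesis unfolding factor_def by blast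
    qed
    then obtain R where R: "\<And>x. factor x (R x)" by metis
    show thesis
    proof (rule that[OF faith G])
      show "R x k s = 0" if "k > to_nat s" for x k s
        using R[of x] that unfolding factor_def by blast
      show "G x s t = (\<Sum>k<N. cnj (R x k s) * R x k t)" if "N > to_nat s" for x N s t
        using R[of x] that unfolding factor_def by blast
    qed
  qed
qed

text \<open>
  In infinite dimension there is room for all rows of the triangular factor in one operator:
  row \<open>k\<close> is sent to the \<open>k\<close>-th vector of an orthonormal sequence.
\<close>

lemma weighted_squares_infinite_dim:
  assumes m: "m \<ge> 1" and p: "Poly_Mapping.keys p \<subseteq> Word ` words m n (2 * d + 1)" and pos: "povm_positive m n p"
    and inf: "infinite {k. e k \<noteq> 0}"
  obtains f :: "nat \<times> nat \<Rightarrow> 'h ncpoly"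
  where "\<And>x. Poly_Mapping.keys (f x) \<subseteq> Word ` words m n d"
    "p = (\<Sum>x\<in>outcomes m n. ncstar (f x) * weight_poly n x * f x)"
proof -
  let ?W = "words m n d"
  obtain L \<kappa> G R where faith: "faithful m n d L \<kappa>" and psd: "\<And>x S. finite S \<Longrightarrow> psd S (G x)"
    and G: "\<And>w a b. w \<in> words m n (2 * d + 1) \<Longrightarrow> certificate m n d G w a b = coeffs p w a b"
    and R0: "\<And>x k s. k > to_nat s \<Longrightarrow> R x k s = 0"
    and R: "\<And>x N s t. N > to_nat s \<Longrightarrow> G x s t = (\<Sum>k<N. cnj (R x k s) * R x k t)"
    by (rule exact_kernel[OF m p pos]) blast+
  define \<epsilon> where "\<epsilon> k = e (enumerate {k. e k \<noteq> 0} k)" for k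
  have \<epsilon>_ne: "\<epsilon> k \<noteq> 0" for k using enumerate_in_set[OF inf, of k] by (simp add: \<epsilon>_def)
  have inj: "inj (enumerate {k. e k \<noteq> 0})" using strict_mono_enumerate[OF inf] by (rule strict_mono_imp_inj_on)
  have \<epsilon>: "orthonormal_or_zero \<epsilon>"
    using \<epsilon>_ne unfolding orthonormal_or_zero_def \<epsilon>_def cinner_basis by (auto dest: injD[OF inj])
  \<comment> \<open>\<open>r x s\<close> realizes the column \<open>s\<close> of the factor as a vector; the factor is triangular, so the sum is finite.\<close>
  define r where "r x s = (\<Sum>k<Suc (to_nat s). R x k s *\<^sub>C \<epsilon> k)" for x s
  have zeroC: "0 *\<^sub>C y = 0" for y :: 'h using scaleC_complex_of_real[of 0 y] by simp
  have r_long: "r x s = (\<Sum>k<N. R x k s *\<^sub>C \<epsilon> k)" if "N > to_nat s" for x s N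
    unfolding r_def by (rule sum.mono_neutral_left) (use that R0 zeroC in auto)
  have r_gram: "cinner (r x s) (r x t) = G x s t" for x s t
  proof -
    define N where "N = Suc (max (to_nat s) (to_nat t))"
    have N: "N > to_nat s" "N > to_nat t" by (auto simp: N_def)
    have "cinner (r x s) (r x t) = (\<Sum>k<N. cnj (R x k s) * R x k t)"
      unfolding r_long[OF N(1)] cinner_sum_left cinner_scaleC_left unfolding r_long[OF N(2)]
      by (intro sum.cong refl) (subst cinner_orthonormal_sum, use \<epsilon> \<epsilon>_ne in \<open>auto simp: orthonormal_or_zero_def\<close>)
    thus ?thesis using R[OF N(1)] by simp
  qed
  have "\<exists>F. \<forall>a. bop_apply F (e a) = (if e a = 0 then 0 else r x (u, a))" if x: "x \<in> outcomes m n" and u: "u \<in> ?W" for x u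
  proof -
    let ?t = "\<lambda>a. if e a = 0 then 0 else r x (u, a)"
    obtain C where C: "C \<ge> 0"
      "\<And>N h. Re (hform {..<N} (\<lambda>a b. G x (u, a) (u, b)) h h) \<le> C * (\<Sum>a<N. (cmod (h a))\<^sup>2)"
      by (rule kernel_block_bounded[OF faith psd G x u]) blast+
    have bound: "(norm (\<Sum>a<N. h a *\<^sub>C ?t a))\<^sup>2 \<le> C * (\<Sum>a<N. (cmod (h a))\<^sup>2)" for N h
    proof -
      \<comment> \<open>The columns at vanishing basis vectors are zero although the kernel need not vanish there.\<close>
      let ?h = "\<lambda>a. if e a = 0 then 0 else h a"
      have t: "h a *\<^sub>C ?t a = ?h a *\<^sub>C r x (u, a)" for a by (simp add: zeroC scaleC_zero_right)
      have "complex_of_real ((norm (\<Sum>a<N. h a *\<^sub>C ?t a))\<^sup>2) = hform {..<N} (\<lambda>a b. G x (u, a) (u, b)) ?h ?h"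
        unfolding t cinner_self[symmetric] cinner_sum_left hform_def
        by (simp only: cinner_sum_right cinner_scaleC_left cinner_scaleC_right r_gram sum_distrib_left mult_ac)
      hence "(norm (\<Sum>a<N. h a *\<^sub>C ?t a))\<^sup>2 = Re (hform {..<N} (\<lambda>a b. G x (u, a) (u, b)) ?h ?h)"
        by (metis Re_complex_of_real)
      also have "\<dots> \<le> C * (\<Sum>a<N. (cmod (?h a))\<^sup>2)" by (rule C)
      also have "\<dots> \<le> C * (\<Sum>a<N. (cmod (h a))\<^sup>2)" by (intro mult_left_mono sum_mono C) auto
      finally show ?thesis .
    qed
    show ?thesis
    proof (rule operator_from_columns[OF bound C(1)])
      show "?t a = 0" if "e a = 0" for a using that by simp
      show ?thesis if "\<And>a. bop_apply A (e a) = ?t a" for A using that by blast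
    qed
  qed
  then obtain F where F: "\<And>x u a. x \<in> outcomes m n \<Longrightarrow> u \<in> ?W \<Longrightarrow> bop_apply (F x u) (e a) = (if e a = 0 then 0 else r x (u, a))"
    by metis
  have "p = (\<Sum>k\<in>{0::nat}. \<Sum>x\<in>outcomes m n. ncstar (poly_of ?W (F x)) * weight_poly n x * poly_of ?W (F x))"
    by (rule weighted_squares_from_kernel[OF p G]) (simp_all add: F r_gram)
  thus thesis by (intro that[of "\<lambda>x. poly_of ?W (F x)"] keys_poly_of[OF finite_words]) simp
qed

text \<open>
  In finite dimension only finitely many rows of the triangular factor concern nonzero basis vectors.
  Each of them yields a square of its own, whose coefficients have rank at most one.
\<close>

lemma weighted_squares_finite_dim:
  assumes m: "m \<ge> 1" and p: "Poly_Mapping.keys p \<subseteq> Word ` words m n (2 * d + 1)" and pos: "povm_positive m n p"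
    and fin: "finite {k. e k \<noteq> 0}"
  obtains N :: nat and f :: "nat \<Rightarrow> nat \<times> nat \<Rightarrow> 'h ncpoly"
  where "N \<ge> 1" "\<And>k x. Poly_Mapping.keys (f k x) \<subseteq> Word ` words m n d"
    "p = (\<Sum>k\<in>{1..N}. \<Sum>x\<in>outcomes m n. ncstar (f k x) * weight_poly n x * f k x)"
proof -
  let ?W = "words m n d" and ?J = "{k. e k \<noteq> 0}"
  obtain L \<kappa> G R where G: "\<And>w a b. w \<in> words m n (2 * d + 1) \<Longrightarrow> certificate m n d G w a b = coeffs p w a b"
    and R: "\<And>x N s t. N > to_nat s \<Longrightarrow> G x s t = (\<Sum>k<N. cnj (R x k s) * R x k t)"
    by (rule exact_kernel[OF m p pos]) blast+
  define N where "N = Suc (Max (insert 0 (to_nat ` (?W \<times> ?J))))"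
  have N: "N > to_nat (u, a)" if "u \<in> ?W" "e a \<noteq> 0" for u a
    unfolding N_def less_Suc_eq_le by (rule Max_ge) (use that fin finite_words in auto)
  \<comment> \<open>A unit vector if there is one. In the zero space \<open>\<epsilon>\<close> is zero, and all conditions on it are vacuous.\<close>
  define \<epsilon> where "\<epsilon> = e (SOME j. e j \<noteq> 0)"
  have \<epsilon>: "cinner \<epsilon> \<epsilon> = 1" if "e a \<noteq> 0" for a
    using someI[of "\<lambda>j. e j \<noteq> 0", OF that] by (simp add: \<epsilon>_def cinner_basis)
  have norm_\<epsilon>: "norm \<epsilon> \<le> 1"
  proof -
    have "complex_of_real ((norm \<epsilon>)\<^sup>2) = (if \<epsilon> \<noteq> 0 then 1 else 0)" unfolding cinner_self[symmetric] by (simp add: \<epsilon>_def cinner_basis)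
    hence "(norm \<epsilon>)\<^sup>2 = 1 \<or> \<epsilon> = 0" by (metis of_real_eq_1_iff)
    thus ?thesis by (auto simp: power2_eq_1_iff)
  qed
  have "\<exists>F. \<forall>a. bop_apply F (e a) = (if e a = 0 then 0 else g a *\<^sub>C \<epsilon>)" for g :: "nat \<Rightarrow> complex"
  proof -
    let ?t = "\<lambda>a. if e a = 0 then 0 else g a *\<^sub>C \<epsilon>" and ?g = "\<lambda>a. if e a = 0 then 0 else g a"
    define C where "C = (\<Sum>a\<in>?J. (cmod (g a))\<^sup>2)"
    have bound: "(norm (\<Sum>a<N. h a *\<^sub>C ?t a))\<^sup>2 \<le> C * (\<Sum>a<N. (cmod (h a))\<^sup>2)" for N h
    proof -
      have "norm (\<Sum>a<N. h a *\<^sub>C ?t a) \<le> (\<Sum>a<N. cmod (?g a) * cmod (h a))"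
      proof (rule sum_norm_le)
        fix a
        show "norm (h a *\<^sub>C ?t a) \<le> cmod (?g a) * cmod (h a)"
          using mult_left_mono[OF norm_\<epsilon>, of "cmod (g a) * cmod (h a)"]
          by (simp add: norm_scaleC scaleC_zero_right mult_ac)
      qed
      hence "(norm (\<Sum>a<N. h a *\<^sub>C ?t a))\<^sup>2 \<le> (\<Sum>a<N. cmod (?g a) * cmod (h a))\<^sup>2"
        by (intro power_mono norm_ge_zero)
      also have "\<dots> \<le> (\<Sum>a<N. (cmod (?g a))\<^sup>2) * (\<Sum>a<N. (cmod (h a))\<^sup>2)"
        by (rule Cauchy_Schwarz_ineq_sum)
      also have "\<dots> \<le> C * (\<Sum>a<N. (cmod (h a))\<^sup>2)"
      proof (rule mult_right_mono)
        have "(\<Sum>a<N. (cmod (?g a))\<^sup>2) = (\<Sum>a\<in>{..<N} \<inter> ?J. (cmod (g a))\<^sup>2)"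
          by (rule sum.mono_neutral_cong_right) auto
        also have "\<dots> \<le> C" unfolding C_def by (rule sum_mono2) (use fin in auto)
        finally show "(\<Sum>a<N. (cmod (?g a))\<^sup>2) \<le> C" .
      qed (simp add: sum_nonneg)
      finally show ?thesis .
    qed
    show ?thesis
    proof (rule operator_from_columns[OF bound])
      show "C \<ge> 0" by (simp add: C_def sum_nonneg)
      show "?t a = 0" if "e a = 0" for a using that by simp
      show ?thesis if "\<And>a. bop_apply A (e a) = ?t a" for A using that by blast
    qed
  qed
  then obtain rank_one where rank_one: "\<And>g a. bop_apply (rank_one g) (e a) = (if e a = 0 then 0 else g a *\<^sub>C \<epsilon>)"
    by metis
  define F where "F k x u = rank_one (\<lambda>a. R x (k - 1) (u, a))" for k :: nat and x :: "nat \<times> nat" and u :: "word"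
  have "p = (\<Sum>k\<in>{1..N}. \<Sum>x\<in>outcomes m n. ncstar (poly_of ?W (F k x)) * weight_poly n x * poly_of ?W (F k x))"
  proof (rule weighted_squares_from_kernel[OF p G])
    fix x u v a b assume ab: "e a \<noteq> 0" "e b \<noteq> 0" and u: "u \<in> ?W"
    have "(\<Sum>k\<in>{1..N}. cinner (bop_apply (F k x u) (e a)) (bop_apply (F k x v) (e b)))
        = (\<Sum>k\<in>{1..N}. cnj (R x (k - 1) (u, a)) * R x (k - 1) (v, b))"
      using ab by (simp add: F_def rank_one cinner_scaleC_left cinner_scaleC_right \<epsilon>[OF ab(1)] mult.commute)
    also have "\<dots> = (\<Sum>k<N. cnj (R x k (u, a)) * R x k (v, b))"
      by (rule sum.reindex_bij_witness[of _ Suc "\<lambda>k. k - 1"]) auto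
    also have "\<dots> = G x (u, a) (v, b)" using R[OF N[OF u ab(1)]] by simp
    finally show "(\<Sum>k\<in>{1..N}. cinner (bop_apply (F k x u) (e a)) (bop_apply (F k x v) (e b))) = G x (u, a) (v, b)" .
  qed
  moreover have "N \<ge> 1" by (simp add: N_def)
  ultimately show thesis by (intro that[of N "\<lambda>k x. poly_of ?W (F k x)"] keys_poly_of[OF finite_words])
qed

lemma povm_positive_sum:
  assumes "\<And>x. x \<in> A \<Longrightarrow> povm_positive m n (q x)"
  shows "povm_positive m n (\<Sum>x\<in>A. q x)"
  using assms unfolding povm_positive_iff Modules.additive.sum[OF additive_eval_form] by (auto intro!: sum_nonneg)

lemma povm_positive_add:
  "povm_positive m n q \<Longrightarrow> povm_positive m n q' \<Longrightarrow> povm_positive m n (q + q')"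
  unfolding povm_positive_iff by (simp add: Modules.additive.add[OF additive_eval_form])

lemma povm_positive_weighted_square:
  fixes f :: "'h ncpoly"
  shows "f \<in> op_povm m n \<Longrightarrow> x \<in> outcomes m n \<Longrightarrow> povm_positive m n (ncstar f * weight_poly n x * f)"
  unfolding povm_positive_iff using eval_form_weighted_square by blast

text \<open>A plain square is the sum of the weighted squares over the outcomes of one measurement.\<close>

lemma povm_positive_square:
  fixes f :: "'h ncpoly"
  assumes m: "m \<ge> 1" and f: "f \<in> op_povm m n"
  shows "povm_positive m n (ncstar f * f)"
proof -
  have one: "ncone * f = f"
  proof -
    let ?S = "\<Sum>w\<in>Poly_Mapping.keys f. Poly_Mapping.single w (Poly_Mapping.lookup f w)"
    have "ncone * ?S = ?S" by (simp add: sum_distrib_left ncone_def mult_single)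
    thus ?thesis by (simp only: poly_mapping_expand[OF finite_keys order_refl, of f, symmetric])
  qed
  have "{0..n 1 - 1} = insert 0 {1..n 1 - 1}" by auto
  hence "(\<Sum>j\<in>{0..n 1 - 1}. weight_poly n (1, j)) = (ncone :: 'h ncpoly)"
    by (simp add: weight_poly_def)
  hence "ncstar f * f = (\<Sum>j\<in>{0..n 1 - 1}. ncstar f * weight_poly n (1, j) * f)"
    unfolding sum_distrib_right[symmetric] sum_distrib_left[symmetric] by (simp add: mult.assoc one)
  thus ?thesis
    using m by (auto intro!: povm_positive_sum povm_positive_weighted_square f simp: outcomes_def)
qed

end

section \<open>The Positivstellensatz\<close>

text \<open>
  In the certificates constructed here the plain square is zero: it would be absorbed by the weights of
  one measurement.
\<close>

theorem theorem8p5: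
  fixes m d :: nat and n :: "nat \<Rightarrow> nat"
    and p :: "'h::chilbert_space ncpoly"
  assumes "m \<ge> 1" and "\<forall>i \<in> {1..m}. n i \<ge> 2"
    and "separable_space (euclidean :: 'h topology)"
    and "p \<in> op_povm m n" and "ncdeg p \<le> 2 * d + 1"
  shows "povm_positive m n p \<longleftrightarrow>
    (\<not> cfinite_dim TYPE('h) \<longrightarrow>
      (\<exists>(f :: 'h ncpoly) (fi :: nat \<Rightarrow> 'h ncpoly) (fij :: nat \<Rightarrow> nat \<Rightarrow> 'h ncpoly).
        f \<in> op_povm m n \<and> ncdeg f \<le> d \<and>
        (\<forall>i \<in> {1..m}. fi i \<in> op_povm m n \<and> ncdeg (fi i) \<le> d) \<and>
        (\<forall>i \<in> {1..m}. \<forall>j \<in> {1..n i - 1}. fij i j \<in> op_povm m n \<and> ncdeg (fij i j) \<le> d) \<and>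
        p = ncstar f * f +
          (\<Sum>i\<in>{1..m}.
             (\<Sum>j\<in>{1..n i - 1}. ncstar (fij i j) * ncvar i j * fij i j) +
             ncstar (fi i) * (ncone - (\<Sum>j\<in>{1..n i - 1}. ncvar i j)) * fi i))) \<and>
    (cfinite_dim TYPE('h) \<longrightarrow>
      (\<exists>(N :: nat) (f :: nat \<Rightarrow> 'h ncpoly) (fi :: nat \<Rightarrow> nat \<Rightarrow> 'h ncpoly)
         (fij :: nat \<Rightarrow> nat \<Rightarrow> nat \<Rightarrow> 'h ncpoly).
        N \<ge> 1 \<and>
        (\<forall>k \<in> {1..N}. f k \<in> op_povm m n \<and> ncdeg (f k) \<le> d) \<and>
        (\<forall>k \<in> {1..N}. \<forall>i \<in> {1..m}. fi i k \<in> op_povm m n \<and> ncdeg (fi i k) \<le> d) \<and>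
        (\<forall>k \<in> {1..N}. \<forall>i \<in> {1..m}. \<forall>j \<in> {1..n i - 1}.
           fij i j k \<in> op_povm m n \<and> ncdeg (fij i j k) \<le> d) \<and>
        p = (\<Sum>k\<in>{1..N}. ncstar (f k) * f k) +
          (\<Sum>k\<in>{1..N}. \<Sum>i\<in>{1..m}.
             (\<Sum>j\<in>{1..n i - 1}. ncstar (fij i j k) * ncvar i j * fij i j k) +
             ncstar (fi i k) * (ncone - (\<Sum>j\<in>{1..n i - 1}. ncvar i j)) * fi i k)))"
proof -
  obtain e :: "nat \<Rightarrow> 'h" where e: "orthonormal_or_zero e"
    "\<And>h. (\<lambda>N. \<Sum>k<N. cinner (e k) h *\<^sub>C e k) \<longlonglongrightarrow> h"
    using orthonormal_basis_exists[OF assms(3)] by blast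
  interpret hilbert_basis e by unfold_locales (rule e)+
  have keys: "Poly_Mapping.keys p \<subseteq> Word ` words m n (2 * d + 1)"
    using assms(4,5) op_povm_ncdeg_iff by blast
  have zero: "(0 :: 'h ncpoly) \<in> op_povm m n" "ncdeg (0 :: 'h ncpoly) \<le> d"
    by (simp_all add: op_povm_def ncdeg_def)
  have one_measurement: "(\<Sum>j\<in>{1..n i - 1}. ncstar (g j) * ncvar i j * g j) +
      ncstar g' * (ncone - (\<Sum>j\<in>{1..n i - 1}. ncvar i j)) * g' =
      (\<Sum>j\<in>{1..n i - 1}. ncstar (g j) * weight_poly n (i, j) * g j) + ncstar g' * weight_poly n (i, 0) * g'"
    for i and g :: "nat \<Rightarrow> 'h ncpoly" and g'
    by (rule arg_cong2[of _ _ _ _ "(+)"], rule sum.cong) (auto simp: weight_poly_def)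
  have positive: "povm_positive m n ((\<Sum>j\<in>{1..n i - 1}. ncstar (g j) * ncvar i j * g j) +
      ncstar g' * (ncone - (\<Sum>j\<in>{1..n i - 1}. ncvar i j)) * g')"
    if "i \<in> {1..m}" "\<And>j. j \<in> {1..n i - 1} \<Longrightarrow> g j \<in> op_povm m n" "g' \<in> op_povm m n"
    for i and g :: "nat \<Rightarrow> 'h ncpoly" and g'
    unfolding one_measurement
    by (intro povm_positive_add povm_positive_sum povm_positive_weighted_square that)
      (use that(1) in \<open>auto simp: outcomes_def\<close>)
  show ?thesis (is "?pos \<longleftrightarrow> (\<not> ?fin \<longrightarrow> ?inf_cert) \<and> (?fin \<longrightarrow> ?fin_cert)")
  proof
    assume pos: ?pos
    show "(\<not> ?fin \<longrightarrow> ?inf_cert) \<and> (?fin \<longrightarrow> ?fin_cert)"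
    proof (intro conjI impI)
      assume "\<not> ?fin"
      hence "infinite {k. e k \<noteq> 0}" by (simp add: cfinite_dim_iff)
      then obtain f :: "nat \<times> nat \<Rightarrow> 'h ncpoly"
        where f: "\<And>x. Poly_Mapping.keys (f x) \<subseteq> Word ` words m n d"
          and p: "p = (\<Sum>x\<in>outcomes m n. ncstar (f x) * weight_poly n x * f x)"
        using weighted_squares_infinite_dim[OF assms(1) keys pos] by blast
      have deg: "f x \<in> op_povm m n" "ncdeg (f x) \<le> d" for x
        using f[of x] unfolding op_povm_ncdeg_iff[symmetric] by auto
      show ?inf_cert
        by (rule exI[of _ 0], rule exI[of _ "\<lambda>i. f (i, 0)"], rule exI[of _ "\<lambda>i j. f (i, j)"])
          (simp only: one_measurement p[unfolded sum_outcomes, symmetric], simp add: zero deg)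
    next
      assume ?fin
      hence "finite {k. e k \<noteq> 0}" by (simp add: cfinite_dim_iff)
      then obtain N :: nat and f :: "nat \<Rightarrow> nat \<times> nat \<Rightarrow> 'h ncpoly"
        where N: "N \<ge> 1" and f: "\<And>k x. Poly_Mapping.keys (f k x) \<subseteq> Word ` words m n d"
          and p: "p = (\<Sum>k\<in>{1..N}. \<Sum>x\<in>outcomes m n. ncstar (f k x) * weight_poly n x * f k x)"
        using weighted_squares_finite_dim[OF assms(1) keys pos] by blast
      have deg: "f k x \<in> op_povm m n" "ncdeg (f k x) \<le> d" for k x
        using f[of k x] unfolding op_povm_ncdeg_iff[symmetric] by auto
      show ?fin_cert
        by (rule exI[of _ N], rule exI[of _ "\<lambda>_. 0"], rule exI[of _ "\<lambda>i k. f k (i, 0)"],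
            rule exI[of _ "\<lambda>i j k. f k (i, j)"])
          (simp only: one_measurement p[unfolded sum_outcomes, symmetric], simp add: zero deg N[simplified])
    qed
  next
    assume cert: "(\<not> ?fin \<longrightarrow> ?inf_cert) \<and> (?fin \<longrightarrow> ?fin_cert)"
    show ?pos
    proof (cases ?fin)
      case False
      with cert have ?inf_cert by blast
      then obtain f :: "'h ncpoly" and fi :: "nat \<Rightarrow> 'h ncpoly" and fij :: "nat \<Rightarrow> nat \<Rightarrow> 'h ncpoly" where
        f: "f \<in> op_povm m n" "\<forall>i\<in>{1..m}. fi i \<in> op_povm m n \<and> ncdeg (fi i) \<le> d"
          "\<forall>i\<in>{1..m}. \<forall>j\<in>{1..n i - 1}. fij i j \<in> op_povm m n \<and> ncdeg (fij i j) \<le> d"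
        and p: "p = ncstar f * f + (\<Sum>i\<in>{1..m}. (\<Sum>j\<in>{1..n i - 1}. ncstar (fij i j) * ncvar i j * fij i j) +
             ncstar (fi i) * (ncone - (\<Sum>j\<in>{1..n i - 1}. ncvar i j)) * fi i)"
        by (elim exE conjE) (rule that, assumption+)
      show ?thesis
        unfolding p
        by (intro povm_positive_add[of _ _ "ncstar f * f"] povm_positive_square povm_positive_sum positive assms(1) f(1))
          (use f(2,3) in auto)
    next
      case True
      with cert have ?fin_cert by blast
      then obtain N :: nat and f :: "nat \<Rightarrow> 'h ncpoly" and fi :: "nat \<Rightarrow> nat \<Rightarrow> 'h ncpoly"
        and fij :: "nat \<Rightarrow> nat \<Rightarrow> nat \<Rightarrow> 'h ncpoly" where
        f: "\<forall>k\<in>{1..N}. f k \<in> op_povm m n \<and> ncdeg (f k) \<le> d"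
          "\<forall>k\<in>{1..N}. \<forall>i\<in>{1..m}. fi i k \<in> op_povm m n \<and> ncdeg (fi i k) \<le> d"
          "\<forall>k\<in>{1..N}. \<forall>i\<in>{1..m}. \<forall>j\<in>{1..n i - 1}. fij i j k \<in> op_povm m n \<and> ncdeg (fij i j k) \<le> d"
        and p: "p = (\<Sum>k\<in>{1..N}. ncstar (f k) * f k) + (\<Sum>k\<in>{1..N}. \<Sum>i\<in>{1..m}.
             (\<Sum>j\<in>{1..n i - 1}. ncstar (fij i j k) * ncvar i j * fij i j k) +
             ncstar (fi i k) * (ncone - (\<Sum>j\<in>{1..n i - 1}. ncvar i j)) * fi i k)"
        by (elim exE conjE) (rule that, assumption+)
      show ?thesis
        unfolding p
        by (intro povm_positive_add[of _ _ "\<Sum>k\<in>{1..N}. ncstar (f k) * f k"] povm_positive_square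
            povm_positive_sum positive assms(1)) (use f in auto)
    qed
  qed
qed

end
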